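(* Let $A_1,\dots,A_n$ be real symmetric $m\times m$ matrices, $A(x)=x_1A_1+\cdots+x_nA_n$, and let $e\in\mathbb{R}^n$ be such that $A(e)$ is positive definite. Let $0\le k\le m$ and $h=D_e^k\det A(x)\in\mathbb{R}[x_1,\dots,x_n]$. Then for all $a\in C(h,e)$ with $D_eh(a)\ne0$ the polynomial $$\Delta_{e,a}(h)-\frac{h(a)}{D_eh(a)}\cdot(D_eh)^2$$ is a sum of squares of polynomials in $\mathbb{R}[x_1,\dots,x_n]$. In particular, the Wronskian polynomial $\Delta_{e,a}(h)$ is a sum of squares of polynomials for all $a\in C(h,e)$.
   Context: For $v\in\mathbb{R}^n$, $D_v=\sum_{i=1}^n v_i\frac{\partial}{\partial x_i}$, and $D_e^k$ is its $k$-th iterate for $v=e$. For $a,b\in\mathbb{R}^n$ and $h\in\mathbb{R}[x_1,\dots,x_n]$, the Wronskian polynomial is $\Delta_{a,b}(h)=D_ah\cdot D_bh-h\cdot D_aD_bh$. A homogeneous polynomial $h$ is hyperbolic with respect to $e$ if $h(e)>0$ and for all $a\in\mathbb{R}^n$ the polynomial $h(te-a)\in\mathbb{R}[t]$ has only real roots; its hyperbolicity cone $C(h,e)$ is the set of all $a\in\mathbb{R}^n$ such that all zeros of $h(te-a)$ are nonnegative. The polynomial $h=D_e^k\det A(x)$ above is hyperbolic with respect to $e$. *)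

theory Defs
  imports "HOL-Analysis.Analysis" "HOL-Library.Poly_Mapping"
begin

text \<open>
  Polynomials with real coefficients in variables indexed by the finite type \<open>'n\<close>:
  finitely supported maps from monomials (exponent vectors) to coefficients, with the
  convolution product of \<^theory>\<open>HOL-Library.Poly_Mapping\<close>.
\<close>

type_synonym 'n mpoly = "('n \<Rightarrow>\<^sub>0 nat) \<Rightarrow>\<^sub>0 real"

definition mconst :: "real \<Rightarrow> 'n mpoly" where
  "mconst c = Poly_Mapping.single 0 c"

definition mvar :: "'n \<Rightarrow> 'n mpoly" where
  "mvar i = Poly_Mapping.single (Poly_Mapping.single i 1) 1"

definition meval :: "'n::finite mpoly \<Rightarrow> real ^ 'n \<Rightarrow> real" where
  "meval p x = (\<Sum>u\<in>Poly_Mapping.keys p.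
     Poly_Mapping.lookup p u * (\<Prod>i\<in>UNIV. (x $ i) ^ Poly_Mapping.lookup u i))"

text \<open>
  In the formal partial derivative the truncated subtraction of exponents is harmless:
  a monomial not containing the variable \<open>i\<close> contributes with coefficient \<open>0\<close>.
\<close>

definition mpderiv :: "'n \<Rightarrow> 'n mpoly \<Rightarrow> 'n mpoly" where
  "mpderiv i p = (\<Sum>u\<in>Poly_Mapping.keys p.
     Poly_Mapping.single (u - Poly_Mapping.single i 1)
       (of_nat (Poly_Mapping.lookup u i) * Poly_Mapping.lookup p u))"

definition dderiv :: "real ^ 'n \<Rightarrow> 'n::finite mpoly \<Rightarrow> 'n mpoly" where
  "dderiv v p = (\<Sum>i\<in>UNIV. mconst (v $ i) * mpderiv i p)"

definition wronskian :: "real ^ 'n \<Rightarrow> real ^ 'n \<Rightarrow> 'n::finite mpoly \<Rightarrow> 'n mpoly" where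
  "wronskian a b h = dderiv a h * dderiv b h - h * dderiv a (dderiv b h)"

text \<open>
  The cone is only meant for \<open>h\<close> hyperbolic with respect to \<open>e\<close>. Then the univariate
  polynomial \<open>h(te - a)\<close> has only real zeros, so quantifying over real \<open>t\<close> covers all of them.
\<close>

definition hyperbolicity_cone :: "'n::finite mpoly \<Rightarrow> real ^ 'n \<Rightarrow> (real ^ 'n) set" where
  "hyperbolicity_cone h e = {a. \<forall>t. meval h (t *\<^sub>R e - a) = 0 \<longrightarrow> 0 \<le> t}"

definition is_sos :: "'n mpoly \<Rightarrow> bool" where
  "is_sos p \<longleftrightarrow> (\<exists>qs :: 'n mpoly list. p = (\<Sum>q\<leftarrow>qs. q ^ 2))"

definition symmetric_matrix :: "real ^ 'm ^ 'm \<Rightarrow> bool" where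
  "symmetric_matrix M \<longleftrightarrow> transpose M = M"

definition pos_definite :: "real ^ 'm ^ 'm \<Rightarrow> bool" where
  "pos_definite M \<longleftrightarrow> symmetric_matrix M \<and> (\<forall>v. v \<noteq> 0 \<longrightarrow> 0 < v \<bullet> (M *v v))"

text \<open>
  The matrix \<open>A(x)\<close> with linear forms as entries, and its value \<open>A(v)\<close> at a real point \<open>v\<close>.
\<close>

definition pencil :: "('n::finite \<Rightarrow> real ^ 'm ^ 'm) \<Rightarrow> 'n mpoly ^ 'm ^ 'm" where
  "pencil A = (\<chi> r s. \<Sum>i\<in>UNIV. mvar i * mconst (A i $ r $ s))"

definition pencil_at :: "('n::finite \<Rightarrow> real ^ 'm ^ 'm) \<Rightarrow> real ^ 'n \<Rightarrow> real ^ 'm ^ 'm" where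
  "pencil_at A v = (\<Sum>i\<in>UNIV. (v $ i) *\<^sub>R A i)"

end

theory Submission
  imports Defs "HOL-Computational_Algebra.Polynomial"
begin

text \<open>
  After a change of coordinates \<open>A(e)\<close> is the identity and \<open>A(a)\<close> is the diagonal matrix of
  \<open>b\<close>, and \<open>h\<close> is a positive multiple of \<open>\<sigma>\<^sub>d\<^sub>+\<^sub>1(X)\<close>, the sum of the principal minors of
  size \<open>d + 1\<close> of a symmetric matrix \<open>X\<close> of linear forms. Its Wronskian is linear in \<open>b\<close>.
  The coefficient of \<open>b\<^sub>i\<close> is a coefficient of the Christoffel--Darboux quotient
  \<open>(f(t) g(u) - f(u) g(t)) / (t - u)\<close> of \<open>f(t) = det(t + X)\<close> and the minor \<open>g\<close> of \<open>t + X\<close>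
  without the index \<open>i\<close>. This quotient is the corresponding minor of \<open>(t + X)(u + X)\<close>.
  Since \<open>(t + X)(u + X) = tu + (t + u)X + X\<^sup>2\<close>, comparing coefficients (Catalan numbers appear) with
  the Cauchy--Binet expansions of all principal minors of \<open>(t + X)(u + X)\<close> avoiding \<open>i\<close> writes
  the Wronskian as a quadratic form in the minors of \<open>X\<close> of size \<open>d\<close>.

  The minors with rows \<open>I \<union> M\<close> and columns \<open>J \<union> M\<close> for fixed disjoint \<open>I\<close>, \<open>J\<close> form one block of
  this quadratic form. A block with \<open>I \<noteq> {}\<close> is the restriction of the block of the principal
  minors to vectors that are antisymmetric under exchanging \<open>I\<close> with \<open>J\<close>. For the principal
  minors, the form is bounded from below by induction on \<open>d\<close>, using
  \<open>\<alpha>y\<^sup>2 + \<beta>z\<^sup>2 \<ge> (\<alpha>\<beta> / (\<alpha> + \<beta>)) (y + z)\<^sup>2\<close> for \<open>\<alpha> + \<beta> > 0\<close>; the positivity needed is that of the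
  elementary symmetric polynomials of \<open>b\<close>, which is what \<open>a \<in> C(h,e)\<close> provides.
\<close>

section \<open>Minors of matrices\<close>

text \<open>The numbers \<open>b\<^sub>i\<close> may be negative, so the form in the minors is not
  visibly a sum of squares. Each block is shown to be nonnegative on real vectors; diagonalizing its
  Gram matrix then gives squares of real combinations of minors. In the comparison of coefficients a
  set \<open>K\<close> with j = |K| - d carries the Catalan number C(2j,j)/(j+1) in the Wronskian,
  but only C(2j,j) in each principal minor. The weights (n-|P|-1)! (|P|-d)! bridge the gap: they are
  multiples of Beta integrals, and their sum over all \<open>P\<close> between \<open>K\<close> and
  the complement of \<open>i\<close> is (n-d)!/(j+1). The same summation produces the coefficients
  1/(d+1-|K \<inter> L|) of \<open>overlap_form\<close>. The subtracted square affects the principal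
  block only, because D_e h is a multiple of the sum of all principal minors of size
  \<open>d\<close>. At \<open>a\<close> the sums of principal minors become elementary symmetric
  polynomials of \<open>b\<close>, so h(a)/D_e h(a) is, up to scaling, the quotient
  e_(d+1)(b)/e_d(b) that the induction yields. On the boundary of the cone only the shifts b+s with
  s > 0 have positive values. This is why the claim without D_e h(a) \<noteq> 0 is reached by a
  limit and not from the first one.\<close>

definition minor :: "'i set \<Rightarrow> ('i \<Rightarrow> 'i \<Rightarrow> 'a::comm_ring_1) \<Rightarrow> 'a" where
  "minor S Y = (\<Sum>p | p permutes S. of_int (sign p) * (\<Prod>a\<in>S. Y a (p a)))"

lemma minor_cong:
  assumes "\<And>a c. a \<in> S \<Longrightarrow> c \<in> S \<Longrightarrow> Y a c = Z a c"
  shows "minor S Y = minor S Z"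
  unfolding minor_def
proof (intro sum.cong refl)
  fix p assume "p \<in> {p. p permutes S}"
  then have "p a \<in> S" if "a \<in> S" for a
    using that by (simp add: permutes_in_image)
  then show "of_int (sign p) * (\<Prod>a\<in>S. Y a (p a)) = of_int (sign p) * (\<Prod>a\<in>S. Z a (p a))"
    using assms by (intro arg_cong2[of _ _ _ _ "(*)"] prod.cong) auto
qed

lemma minor_UNIV: "minor UNIV Y = det (\<chi> r c. Y r c)"
  by (simp add: minor_def det_def)

lemma minor_empty [simp]: "minor {} Y = 1"
  by (simp add: minor_def sign_id)

lemma minor_hom:
  fixes f :: "'a::comm_ring_1 \<Rightarrow> 'b::comm_ring_1" and Y :: "'i \<Rightarrow> 'i \<Rightarrow> 'a"
  assumes f1: "f 1 = 1" and fm: "\<And>x y. f (x * y) = f x * f y"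
    and fa: "\<And>x y. f (x + y) = f x + f y"
  shows "f (minor S Y) = minor S (\<lambda>a c. f (Y a c))"
proof -
  have f0: "f 0 = 0" using fa[of 0 0] by simp
  have fneg: "f (- x) = - f x" for x
    using fa[of x "- x"] f0 by (simp add: eq_neg_iff_add_eq_0 add.commute)
  have fsign: "f (of_int (sign p)) = of_int (sign p)" for p :: "'i \<Rightarrow> 'i"
    by (simp add: sign_def f1 fneg)
  have fsum: "f (sum g A) = (\<Sum>x\<in>A. f (g x))" for g :: "('i \<Rightarrow> 'i) \<Rightarrow> 'a" and A
    by (induction A rule: infinite_finite_induct) (auto simp: f0 fa)
  have fprod: "f (prod g A) = (\<Prod>x\<in>A. f (g x))" for g :: "'i \<Rightarrow> 'a" and A
    by (induction A rule: infinite_finite_induct) (auto simp: f1 fm)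
  show ?thesis
    by (simp add: minor_def fsum fm fsign fprod)
qed

lemma minor_transpose:
  assumes "finite S"
  shows "minor S (\<lambda>a c. Y c a) = minor S Y"
proof -
  have "minor S (\<lambda>a c. Y c a)
      = (\<Sum>p | p permutes S. of_int (sign (inv p)) * (\<Prod>a\<in>S. Y (inv p a) a))"
    unfolding minor_def
    by (rule sum_permutations_inverse)
  also have "\<dots> = minor S Y"
    unfolding minor_def
  proof (intro sum.cong refl)
    fix p assume "p \<in> {p. p permutes S}"
    then have p: "p permutes S" by simp
    have "(\<Prod>a\<in>S. Y (inv p a) a) = (\<Prod>a\<in>S. Y (inv p (p a)) (p a))"
      using prod.permute[OF p, of "\<lambda>a. Y (inv p a) a"] by (simp add: o_def)
    also have "\<dots> = (\<Prod>a\<in>S. Y a (p a))"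
      using p by (simp add: permutes_inverses)
    moreover have "sign (inv p) = sign p"
      using p assms by (metis permutation_permutes sign_inverse)
    ultimately show "of_int (sign (inv p)) * (\<Prod>a\<in>S. Y (inv p a) a)
        = of_int (sign p) * (\<Prod>a\<in>S. Y a (p a))"
      by simp
  qed
  finally show ?thesis .
qed

lemma permutes_fixing_iff:
  assumes "K \<subseteq> S"
  shows "p permutes S \<and> (\<forall>a\<in>S - K. p a = a) \<longleftrightarrow> p permutes K"
  using assms unfolding permutes_def by blast

text \<open>When the rows are multiplied out, \<open>K\<close> is the set of rows contributing an
  entry of \<open>Z\<close>. Every other row contributes its diagonal entry and so must be fixed by
  the permutation; only permutations of \<open>K\<close> survive.\<close>

lemma minor_diag_add:
  assumes fin: "finite S"
  shows "minor S (\<lambda>a c. (if a = c then d a else 0) + Z a c)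
    = (\<Sum>K\<in>Pow S. (\<Prod>a\<in>S - K. d a) * minor K Z)"
proof -
  have inner: "(\<Sum>p | p permutes S. of_int (sign p)
        * ((\<Prod>a\<in>K. Z a (p a)) * (\<Prod>a\<in>S - K. if a = p a then d a else 0)))
      = (\<Prod>a\<in>S - K. d a) * minor K Z" if K: "K \<subseteq> S" for K
  proof -
    have "(\<Sum>p | p permutes S. of_int (sign p)
        * ((\<Prod>a\<in>K. Z a (p a)) * (\<Prod>a\<in>S - K. if a = p a then d a else 0)))
      = (\<Sum>p | p permutes K. of_int (sign p)
        * ((\<Prod>a\<in>K. Z a (p a)) * (\<Prod>a\<in>S - K. if a = p a then d a else 0)))"
    proof (rule sum.mono_neutral_right)
      show "finite {p. p permutes S}" using fin by (rule finite_permutations)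
      show "{p. p permutes K} \<subseteq> {p. p permutes S}"
        using K by (auto intro: permutes_subset)
      show "\<forall>p\<in>{p. p permutes S} - {p. p permutes K}. of_int (sign p)
        * ((\<Prod>a\<in>K. Z a (p a)) * (\<Prod>a\<in>S - K. if a = p a then d a else 0)) = 0"
      proof
        fix p assume "p \<in> {p. p permutes S} - {p. p permutes K}"
        then obtain a where "a \<in> S - K" "a \<noteq> p a"
          using permutes_fixing_iff[OF K, of p] by auto
        then have "(\<Prod>a\<in>S - K. if a = p a then d a else 0) = 0"
          using fin by (intro prod_zero) auto
        then show "of_int (sign p)
        * ((\<Prod>a\<in>K. Z a (p a)) * (\<Prod>a\<in>S - K. if a = p a then d a else 0)) = 0" by simp
      qed
    qed
    also have "\<dots> = (\<Sum>p | p permutes K. (\<Prod>a\<in>S - K. d a) * (of_int (sign p) * (\<Prod>a\<in>K. Z a (p a))))"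
    proof (intro sum.cong refl)
      fix p assume "p \<in> {p. p permutes K}"
      then have "p a = a" if "a \<in> S - K" for a
        using that by (simp add: permutes_def)
      then have "(\<Prod>a\<in>S - K. if a = p a then d a else 0) = (\<Prod>a\<in>S - K. d a)"
        by (intro prod.cong) auto
      then show "of_int (sign p) * ((\<Prod>a\<in>K. Z a (p a)) * (\<Prod>a\<in>S - K. if a = p a then d a else 0))
        = (\<Prod>a\<in>S - K. d a) * (of_int (sign p) * (\<Prod>a\<in>K. Z a (p a)))"
        by (simp add: ac_simps)
    qed
    finally show ?thesis by (simp add: minor_def sum_distrib_left)
  qed
  have "minor S (\<lambda>a c. (if a = c then d a else 0) + Z a c)
    = (\<Sum>p | p permutes S. of_int (sign p) * (\<Prod>a\<in>S. Z a (p a) + (if a = p a then d a else 0)))"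
    by (simp add: minor_def add.commute)
  also have "\<dots> = (\<Sum>p | p permutes S. \<Sum>K\<in>Pow S. of_int (sign p)
        * ((\<Prod>a\<in>K. Z a (p a)) * (\<Prod>a\<in>S - K. if a = p a then d a else 0)))"
    using fin by (simp add: prod_add sum_distrib_left)
  also have "\<dots> = (\<Sum>K\<in>Pow S. (\<Prod>a\<in>S - K. d a) * minor K Z)"
    by (subst sum.swap) (simp add: inner)
  finally show ?thesis .
qed

lemma minor_unit_row:
  assumes "finite S" "a \<in> S"
  shows "minor S (\<lambda>r c. if r = a then (if c = a then x else 0) else Y r c) = x * minor (S - {a}) Y"
proof -
  have "minor S (\<lambda>r c. if r = a then (if c = a then x else 0) else Y r c)
    = (\<Sum>p | p permutes (S - {a}). of_int (sign p) * (\<Prod>r\<in>S. if r = a then (if p r = a then x else 0) else Y r (p r)))"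
    unfolding minor_def
  proof (rule sum.mono_neutral_right)
    show "finite {p. p permutes S}" using assms by (simp add: finite_permutations)
    show "{p. p permutes S - {a}} \<subseteq> {p. p permutes S}"
      by (auto intro: permutes_subset)
    show "\<forall>p\<in>{p. p permutes S} - {p. p permutes S - {a}}. of_int (sign p)
        * (\<Prod>r\<in>S. if r = a then (if p r = a then x else 0) else Y r (p r)) = 0"
    proof
      fix p assume "p \<in> {p. p permutes S} - {p. p permutes S - {a}}"
      then have "p a \<noteq> a"
        using permutes_fixing_iff[of "S - {a}" S p] assms by auto
      then have "(\<Prod>r\<in>S. if r = a then (if p r = a then x else 0) else Y r (p r)) = 0"
        using assms by (intro prod_zero) auto
      then show "of_int (sign p)
        * (\<Prod>r\<in>S. if r = a then (if p r = a then x else 0) else Y r (p r)) = 0" by simp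
    qed
  qed
  also have "\<dots> = (\<Sum>p | p permutes (S - {a}). x * (of_int (sign p) * (\<Prod>r\<in>S - {a}. Y r (p r))))"
  proof (intro sum.cong refl)
    fix p assume "p \<in> {p. p permutes (S - {a})}"
    then have "p a = a" by (simp add: permutes_def)
    then have "(\<Prod>r\<in>S. if r = a then (if p r = a then x else 0) else Y r (p r))
        = x * (\<Prod>r\<in>S - {a}. Y r (p r))"
      using assms by (simp add: prod.remove)
    then show "of_int (sign p) * (\<Prod>r\<in>S. if r = a then (if p r = a then x else 0) else Y r (p r))
      = x * (of_int (sign p) * (\<Prod>r\<in>S - {a}. Y r (p r)))" by (simp add: ac_simps)
  qed
  finally show ?thesis by (simp add: minor_def sum_distrib_left)
qed

text \<open>By the product rule one row is differentiated at a time. The differentiated row is a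
  multiple of a unit vector, and expansion along it leaves the principal minor without that
  index.\<close>

lemma minor_derivation:
  fixes D :: "'a::comm_ring_1 \<Rightarrow> 'a"
  assumes fin: "finite S"
    and Dadd: "\<And>x y. D (x + y) = D x + D y"
    and Dmul: "\<And>x y. D (x * y) = D x * y + x * D y"
    and DY: "\<And>r c. D (Y r c) = (if r = c then \<beta> r else 0)"
  shows "D (minor S Y) = (\<Sum>a\<in>S. \<beta> a * minor (S - {a}) Y)"
proof -
  have D0: "D 0 = 0" using Dadd[of 0 0] by simp
  have D1: "D 1 = 0" using Dmul[of 1 1] by simp
  have Dneg: "D (- x) = - D x" for x
    using Dadd[of x "- x"] D0 by (simp add: eq_neg_iff_add_eq_0 add.commute)
  have Dsign: "D (of_int (sign p) * x) = of_int (sign p) * D x" for p :: "'b \<Rightarrow> 'b" and x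
    by (simp add: sign_def Dneg)
  have Dsum: "D (sum g A) = (\<Sum>x\<in>A. D (g x))" for g :: "('b \<Rightarrow> 'b) \<Rightarrow> 'a" and A
    by (induction A rule: infinite_finite_induct) (auto simp: D0 Dadd)
  have Dprod: "D (prod g A) = (\<Sum>a\<in>A. \<Prod>r\<in>A. if r = a then D (g r) else g r)"
    if "finite A" for g :: "'b \<Rightarrow> 'a" and A
    using that
  proof (induction A rule: finite_induct)
    case (insert x A)
    have "(\<Sum>a\<in>A. \<Prod>r\<in>insert x A. if r = a then D (g r) else g r)
        = (\<Sum>a\<in>A. g x * (\<Prod>r\<in>A. if r = a then D (g r) else g r))"
      using insert by (intro sum.cong refl) auto
    moreover have "(\<Prod>r\<in>A. if r = x then D (g r) else g r) = prod g A"
      using insert by (intro prod.cong) auto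
    ultimately show ?case
      using insert by (simp add: Dmul sum_distrib_left)
  qed (simp add: D1)
  have "D (minor S Y) = (\<Sum>p | p permutes S. \<Sum>a\<in>S. of_int (sign p) *
      (\<Prod>r\<in>S. if r = a then D (Y r (p r)) else Y r (p r)))"
    by (simp add: minor_def Dsum Dsign Dprod fin sum_distrib_left)
  also have "\<dots> = (\<Sum>a\<in>S. \<Sum>p | p permutes S. of_int (sign p) *
      (\<Prod>r\<in>S. if r = a then (if p r = a then \<beta> a else 0) else Y r (p r)))"
    by (subst sum.swap) (intro sum.cong refl arg_cong2[of _ _ _ _ "(*)"] prod.cong, auto simp: DY)
  also have "\<dots> = (\<Sum>a\<in>S. minor S (\<lambda>r c. if r = a then (if c = a then \<beta> a else 0) else Y r c))"
    by (simp add: minor_def)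
  also have "\<dots> = (\<Sum>a\<in>S. \<beta> a * minor (S - {a}) Y)"
    using fin by (intro sum.cong refl minor_unit_row) auto
  finally show ?thesis .
qed

lemma minor_permute_rows:
  assumes fin: "finite S" and \<rho>: "\<rho> permutes S"
  shows "minor S (\<lambda>a c. Y (\<rho> a) c) = of_int (sign \<rho>) * minor S Y"
proof -
  have perm: "permutation p" if "p permutes S" for p
    using that fin by (metis permutation_permutes)
  have "minor S (\<lambda>a c. Y (\<rho> a) c)
      = (\<Sum>p | p permutes S. of_int (sign (p \<circ> \<rho>)) * (\<Prod>a\<in>S. Y (\<rho> a) ((p \<circ> \<rho>) a)))"
    unfolding minor_def by (rule sum_permutations_compose_right[OF \<rho>])
  also have "\<dots> = (\<Sum>p | p permutes S. of_int (sign \<rho>) * (of_int (sign p) * (\<Prod>a\<in>S. Y a (p a))))"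
  proof (intro sum.cong refl)
    fix p assume "p \<in> {p. p permutes S}"
    then have p: "p permutes S" by simp
    have "(\<Prod>a\<in>S. Y (\<rho> a) ((p \<circ> \<rho>) a)) = (\<Prod>a\<in>S. Y a (p a))"
      using prod.permute[OF \<rho>, of "\<lambda>a. Y a (p a)"] by (simp add: o_def)
    then show "of_int (sign (p \<circ> \<rho>)) * (\<Prod>a\<in>S. Y (\<rho> a) ((p \<circ> \<rho>) a))
      = of_int (sign \<rho>) * (of_int (sign p) * (\<Prod>a\<in>S. Y a (p a)))"
      using sign_compose[OF perm[OF p] perm[OF \<rho>]] by (simp add: ac_simps)
  qed
  finally show ?thesis by (simp add: minor_def sum_distrib_left)
qed

text \<open>Permutations are paired by composition with the transposition of the two rows. Equating
  the minor with its own negative would only show that its double is zero, which is too weak over an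
  arbitrary commutative ring.\<close>

lemma minor_eq_rows:
  assumes fin: "finite S" and ab: "a \<in> S" "b \<in> S" "a \<noteq> b" and eq: "\<And>c. Y a c = Y b c"
  shows "minor S Y = 0"
proof -
  let ?t = "Transposition.transpose a b"
  have t: "?t permutes S" using ab(1,2) by (rule permutes_swap_id)
  have odd: "sign (p \<circ> ?t) = - sign p" if "p permutes S" for p
    using that fin ab sign_compose[of p ?t] by (metis minus_mult_right mult.right_neutral permutation_permutes permutation_swap_id sign_swap_id)
  have ev: "evenperm (p \<circ> ?t) \<longleftrightarrow> \<not> evenperm p" if "p permutes S" for p
    using odd[OF that] by (simp add: sign_def split: if_splits)
  let ?E = "{p. p permutes S \<and> evenperm p}" and ?O = "{p. p permutes S \<and> \<not> evenperm p}"
  let ?P = "\<lambda>p. \<Prod>r\<in>S. Y r (p r)"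
  have inv: "?P (p \<circ> ?t) = ?P p" for p
  proof -
    have "?P p = (\<Prod>r\<in>S. Y (?t r) (p (?t r)))"
      using prod.permute[OF t, of "\<lambda>r. Y r (p r)"] by (simp add: o_def)
    also have "\<dots> = ?P (p \<circ> ?t)"
      using eq by (intro prod.cong) (auto simp: Transposition.transpose_def)
    finally show ?thesis by simp
  qed
  have bij: "bij_betw (\<lambda>p. p \<circ> ?t) ?E ?O"
  proof (rule bij_betw_byWitness[where f' = "\<lambda>p. p \<circ> ?t"])
    show "(\<lambda>p. p \<circ> ?t) ` ?E \<subseteq> ?O" "(\<lambda>p. p \<circ> ?t) ` ?O \<subseteq> ?E"
      using ev t by (auto simp: permutes_compose)
  qed (auto simp: o_assoc[symmetric])
  have fE: "finite ?E" "finite ?O"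
    using finite_permutations[OF fin] by (auto intro: rev_finite_subset)
  have "minor S Y = (\<Sum>p\<in>?E \<union> ?O. of_int (sign p) * ?P p)"
    unfolding minor_def by (rule sum.cong) auto
  also have "\<dots> = (\<Sum>p\<in>?E. of_int (sign p) * ?P p) + (\<Sum>p\<in>?O. of_int (sign p) * ?P p)"
    using fE by (intro sum.union_disjoint) auto
  also have "(\<Sum>p\<in>?O. of_int (sign p) * ?P p) = (\<Sum>p\<in>?O. - ?P p)"
    by (intro sum.cong) (auto simp: sign_def)
  also have "\<dots> = (\<Sum>p\<in>?E. - ?P p)"
    using sum.reindex_bij_betw[OF bij, of "\<lambda>p. - ?P p"] by (simp add: inv[unfolded o_def] o_def)
  also have "(\<Sum>p\<in>?E. of_int (sign p) * ?P p) = (\<Sum>p\<in>?E. ?P p)"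
    by (intro sum.cong) (auto simp: sign_def)
  finally show ?thesis by (simp add: sum_negf)
qed

text \<open>Relabelling rows and columns conjugates each permutation by \<open>t\<close>, and the
  sign of \<open>t\<close> enters twice. This is what makes \<open>off_minor\<close> symmetric in
  its two index sets.\<close>

lemma minor_image_involution:
  fixes Y :: "'i::finite \<Rightarrow> 'i \<Rightarrow> 'a::comm_ring_1"
  assumes tt: "\<And>x. t (t x) = x"
  shows "minor (t ` S) Y = minor S (\<lambda>a c. Y (t a) (t c))"
proof -
  have inj: "inj t" using tt by (rule inj_on_inverseI)
  have tU: "t permutes UNIV"
    by (rule bij_imp_permutes[OF involuntory_imp_bij]) (simp_all only: tt UNIV_I not_True_eq_False)
  have conj: "t \<circ> p \<circ> t permutes (t ` A)" if p: "p permutes A" for p A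
  proof -
    have "t \<circ> p \<circ> t permutes UNIV"
      using p by (intro permutes_compose tU) (rule permutes_subset, auto)
    moreover have "(t \<circ> p \<circ> t) x = x" if "x \<notin> t ` A" for x
    proof -
      have "t x \<notin> A" using that tt by (metis image_eqI)
      then have "p (t x) = t x" using p by (rule permutes_not_in[rotated])
      then show ?thesis by (simp add: tt)
    qed
    ultimately show ?thesis using permutes_fixing_iff[of "t ` A" UNIV] by blast
  qed
  have conj': "t \<circ> p \<circ> t permutes A" if "p permutes (t ` A)" for p A
    using conj[OF that] by (simp only: image_image tt image_ident)
  have tt': "t \<circ> (t \<circ> p \<circ> t) \<circ> t = p" for p
    by (rule ext) (simp only: o_apply tt)
  have perm: "permutation p" if "p permutes A" for p :: "'i \<Rightarrow> 'i" and A
    unfolding permutation_permutes using that by (intro exI[of _ A]) simp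
  have sgn: "sign (t \<circ> p \<circ> t) = sign p" if "p permutes A" for p A
  proof -
    have "sign (t \<circ> p \<circ> t) = sign t * sign p * sign t"
      using perm[OF that] perm[OF tU] by (simp add: sign_compose permutation_compose)
    then show ?thesis by (simp add: sign_def)
  qed
  show ?thesis unfolding minor_def
  proof (rule sum.reindex_bij_witness[where i = "\<lambda>p. t \<circ> p \<circ> t" and j = "\<lambda>p. t \<circ> p \<circ> t"])
    fix p assume p: "p \<in> {p. p permutes t ` S}"
    have "(\<Prod>a\<in>t ` S. Y a (p a)) = (\<Prod>a\<in>S. Y (t a) (t ((t \<circ> p \<circ> t) a)))"
      by (subst prod.reindex[OF inj_on_subset[OF inj subset_UNIV]]) (simp only: o_def tt)
    then show "of_int (sign (t \<circ> p \<circ> t)) * (\<Prod>a\<in>S. Y (t a) (t ((t \<circ> p \<circ> t) a)))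
        = of_int (sign p) * (\<Prod>a\<in>t ` S. Y a (p a))"
      using sgn p by (simp only: mem_Collect_eq)
  qed (simp_all only: tt' mem_Collect_eq conj conj')
qed

text \<open>A minor with rows \<open>P\<close> and columns \<open>Q\<close> needs a matching of the
  two sets. Any matching \<open>\<beta> Q\<close> will do, since its sign enters both factors; this
  freedom is later used to choose \<open>swap_map\<close>.\<close>

lemma Cauchy_Binet_minor:
  fixes Y Z :: "'i::finite \<Rightarrow> 'i \<Rightarrow> 'a::comm_ring_1"
  assumes \<beta>: "\<And>Q. card Q = card P \<Longrightarrow> bij_betw (\<beta> Q) P Q"
  shows "minor P (\<lambda>a c. \<Sum>k\<in>UNIV. Y a k * Z k c)
    = (\<Sum>Q | card Q = card P. minor P (\<lambda>a c. Y a (\<beta> Q c)) * minor P (\<lambda>a c. Z (\<beta> Q a) c))"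
proof -
  let ?F = "P \<rightarrow>\<^sub>E (UNIV :: 'i set)"
  let ?I = "{h \<in> ?F. inj_on h P}"
  let ?t = "\<lambda>h. (\<Prod>a\<in>P. Y a (h a)) * minor P (\<lambda>a c. Z (h a) c)"
  have finF: "finite ?F" by (intro finite_PiE) auto
  have "minor P (\<lambda>a c. \<Sum>k\<in>UNIV. Y a k * Z k c)
      = (\<Sum>p | p permutes P. \<Sum>h\<in>?F. of_int (sign p) * (\<Prod>a\<in>P. Y a (h a) * Z (h a) (p a)))"
    by (simp add: minor_def prod_sum_PiE sum_distrib_left)
  also have "\<dots> = (\<Sum>h\<in>?F. ?t h)"
    by (subst sum.swap) (simp add: minor_def prod.distrib sum_distrib_left ac_simps)
  also have "\<dots> = (\<Sum>h\<in>?I. ?t h)"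
  proof (rule sum.mono_neutral_right[OF finF])
    show "\<forall>h\<in>?F - ?I. ?t h = 0"
    proof
      fix h assume "h \<in> ?F - ?I"
      then obtain a b where "a \<in> P" "b \<in> P" "a \<noteq> b" "h a = h b"
        by (auto simp: inj_on_def)
      then have "minor P (\<lambda>a c. Z (h a) c) = 0"
        by (intro minor_eq_rows[of P a b]) auto
      then show "?t h = 0" by simp
    qed
  qed auto
  \<comment> \<open>An injective selection \<open>h\<close> amounts to its image \<open>Q\<close>
    together with the permutation \<open>\<rho>\<close> of \<open>P\<close> that compares
    \<open>h\<close> with the fixed matching \<open>\<beta> Q\<close>.\<close>
  also have "\<dots> = (\<Sum>(Q, \<rho>)\<in>(SIGMA Q:{Q. card Q = card P}. {\<rho>. \<rho> permutes P}).
      ?t (restrict (\<beta> Q \<circ> \<rho>) P))"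
  proof (rule sum.reindex_bij_witness[where
        j = "\<lambda>h. (h ` P, \<lambda>a. if a \<in> P then inv_into P (\<beta> (h ` P)) (h a) else a)"
        and i = "\<lambda>(Q, \<rho>). restrict (\<beta> Q \<circ> \<rho>) P"])
    fix h assume h: "h \<in> ?I"
    let ?Q = "h ` P" and ?\<rho> = "\<lambda>a. if a \<in> P then inv_into P (\<beta> (h ` P)) (h a) else a"
    have cQ: "card ?Q = card P" using h by (simp add: card_image)
    note bQ = \<beta>[OF cQ]
    have ib: "bij_betw (inv_into P (\<beta> ?Q)) ?Q P" using bQ by (rule bij_betw_inv_into)
    have hb: "bij_betw h P ?Q" using h by (auto simp: bij_betw_def)
    have "bij_betw (inv_into P (\<beta> ?Q) \<circ> h) P P" using bij_betw_trans[OF hb ib] .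
    then have "bij_betw ?\<rho> P P" by (rule bij_betw_cong[THEN iffD1, rotated]) simp
    then have \<rho>: "?\<rho> permutes P" by (intro bij_imp_permutes) auto
    have r: "restrict (\<beta> ?Q \<circ> ?\<rho>) P = h"
    proof
      fix a show "restrict (\<beta> ?Q \<circ> ?\<rho>) P a = h a"
      proof (cases "a \<in> P")
        case True
        then have "\<beta> ?Q (inv_into P (\<beta> ?Q) (h a)) = h a"
          using bQ by (intro f_inv_into_f) (auto simp: bij_betw_def)
        then show ?thesis using True by simp
      next
        case False then show ?thesis using h by (auto simp: PiE_def extensional_def)
      qed
    qed
    show "(case (?Q, ?\<rho>) of (Q, \<rho>) \<Rightarrow> restrict (\<beta> Q \<circ> \<rho>) P) = h"
      by (simp only: prod.case r)
    show "(?Q, ?\<rho>) \<in> (SIGMA Q:{Q. card Q = card P}. {\<rho>. \<rho> permutes P})" using cQ \<rho> by simp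
    show "(case (?Q, ?\<rho>) of (Q, \<rho>) \<Rightarrow> ?t (restrict (\<beta> Q \<circ> \<rho>) P)) = ?t h"
      by (simp only: prod.case r)
  next
    fix x :: "'i set \<times> ('i \<Rightarrow> 'i)" assume x: "x \<in> (SIGMA Q:{Q. card Q = card P}. {\<rho>. \<rho> permutes P})"
    obtain Q \<rho> where [simp]: "x = (Q, \<rho>)" by (cases x)
    have cQ: "card Q = card P" and \<rho>: "\<rho> permutes P" using x by auto
    note bQ = \<beta>[OF cQ]
    let ?h = "restrict (\<beta> Q \<circ> \<rho>) P"
    have hb: "bij_betw (\<beta> Q \<circ> \<rho>) P Q"
      using bij_betw_trans[OF permutes_imp_bij[OF \<rho>] bQ] .
    have im: "?h ` P = Q" using hb by (auto simp: bij_betw_def)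
    have "inj_on ?h P" using hb by (simp add: bij_betw_def inj_on_restrict_eq)
    then show "(case x of (Q, \<rho>) \<Rightarrow> restrict (\<beta> Q \<circ> \<rho>) P) \<in> ?I" by simp
    have "(\<lambda>a. if a \<in> P then inv_into P (\<beta> Q) (?h a) else a) = \<rho>"
    proof
      fix a show "(if a \<in> P then inv_into P (\<beta> Q) (?h a) else a) = \<rho> a"
      proof (cases "a \<in> P")
        case True
        then have "\<rho> a \<in> P" using \<rho> by (simp add: permutes_in_image)
        then show ?thesis using True bQ by (simp add: bij_betw_def)
      next
        case False then show ?thesis using \<rho> by (simp add: permutes_def)
      qed
    qed
    then show "((case x of (Q, \<rho>) \<Rightarrow> restrict (\<beta> Q \<circ> \<rho>) P) ` P,
        \<lambda>a. if a \<in> P then inv_into P (\<beta> ((case x of (Q, \<rho>) \<Rightarrow> restrict (\<beta> Q \<circ> \<rho>) P) ` P))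
          ((case x of (Q, \<rho>) \<Rightarrow> restrict (\<beta> Q \<circ> \<rho>) P) a) else a) = x"
      by (simp only: \<open>x = (Q, \<rho>)\<close> prod.case im)
  qed
  also have "\<dots> = (\<Sum>Q | card Q = card P. \<Sum>\<rho> | \<rho> permutes P. ?t (restrict (\<beta> Q \<circ> \<rho>) P))"
    by (rule sum.Sigma[symmetric]) (auto simp: finite_permutations)
  also have "\<dots> = (\<Sum>Q | card Q = card P. minor P (\<lambda>a c. Y a (\<beta> Q c)) * minor P (\<lambda>a c. Z (\<beta> Q a) c))"
  proof (rule sum.cong[OF refl])
    fix Q
    have "(\<Sum>\<rho> | \<rho> permutes P. ?t (restrict (\<beta> Q \<circ> \<rho>) P))
        = (\<Sum>\<rho> | \<rho> permutes P. (\<Prod>a\<in>P. Y a (\<beta> Q (\<rho> a))) * minor P (\<lambda>a c. Z (\<beta> Q (\<rho> a)) c))"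
      by (intro sum.cong refl arg_cong2[of _ _ _ _ "(*)"] prod.cong minor_cong) auto
    also have "\<dots> = (\<Sum>\<rho> | \<rho> permutes P. (\<Prod>a\<in>P. Y a (\<beta> Q (\<rho> a)))
        * (of_int (sign \<rho>) * minor P (\<lambda>a c. Z (\<beta> Q a) c)))"
      by (intro sum.cong refl arg_cong2[of _ _ _ _ "(*)"])
         (auto intro: minor_permute_rows[of P _ "\<lambda>a. Z (\<beta> Q a)"])
    also have "\<dots> = minor P (\<lambda>a c. Y a (\<beta> Q c)) * minor P (\<lambda>a c. Z (\<beta> Q a) c)"
      by (simp add: minor_def[of P "\<lambda>a c. Y a (\<beta> Q c)"] sum_distrib_left ac_simps)
    finally show "(\<Sum>\<rho> | \<rho> permutes P. ?t (restrict (\<beta> Q \<circ> \<rho>) P))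
      = minor P (\<lambda>a c. Y a (\<beta> Q c)) * minor P (\<lambda>a c. Z (\<beta> Q a) c)" .
  qed
  finally show ?thesis .
qed

section \<open>The product of two commuting shifts of a matrix\<close>

text \<open>
  Replace row \<open>i\<close> of \<open>PQ = QP\<close> by row \<open>i\<close> of \<open>P\<close> or of \<open>Q\<close>: both determinants factor, and the two
  rows differ by \<open>x\<close> times a unit vector.
\<close>

lemma minor_compl_singleton_mult:
  fixes P Q :: "'m::finite \<Rightarrow> 'm \<Rightarrow> 'a::comm_ring_1"
  assumes comm: "\<And>a c. (\<Sum>k\<in>UNIV. P a k * Q k c) = (\<Sum>k\<in>UNIV. Q a k * P k c)"
    and diff: "\<And>a c. P a c - Q a c = (if a = c then x else 0)"
  shows "x * minor (- {i}) (\<lambda>a c. \<Sum>k\<in>UNIV. P a k * Q k c)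
    = minor UNIV P * minor (- {i}) Q - minor UNIV Q * minor (- {i}) P"
proof -
  define row where
    "row = (\<lambda>(Y :: 'm \<Rightarrow> 'm \<Rightarrow> 'a) w. (\<chi> r. if r = i then w else (\<chi> c. Y r c)) :: 'a^'m^'m)"
  have unit: "det (row Y (x *s axis i 1)) = x * minor (- {i}) Y" for x Y
  proof -
    have "det (row Y (x *s axis i 1)) = minor UNIV (\<lambda>r c. if r = i then (if c = i then x else 0) else Y r c)"
      unfolding minor_UNIV row_def by (rule arg_cong[where f=det]) (auto simp: vec_eq_iff axis_def)
    also have "\<dots> = x * minor (- {i}) Y"
      by (subst minor_unit_row) (auto simp: Compl_eq_Diff_UNIV)
    finally show ?thesis .
  qed
  \<comment> \<open>Row \<open>i\<close> of \<open>Z\<close> is a unit vector times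
    \<open>Z\<close>. Hence \<open>Z\<close> splits off on the right and leaves \<open>Y\<close>
    with a unit row.\<close>
  have prod: "det (row (\<lambda>a c. \<Sum>k\<in>UNIV. Y a k * Z k c) (\<chi> c. Z i c)) = minor UNIV Z * minor (- {i}) Y"
    for Y Z
  proof -
    have "row (\<lambda>a c. \<Sum>k\<in>UNIV. Y a k * Z k c) (\<chi> c. Z i c) = row Y (1 *s axis i 1) ** (\<chi> r c. Z r c)"
      by (auto simp: row_def vec_eq_iff matrix_matrix_mult_def axis_def if_distrib[of "\<lambda>y. y * _"]
          sum.delta cong: if_cong)
    then show ?thesis
      by (simp only: det_mul unit minor_UNIV) simp
  qed
  let ?PQ = "\<lambda>a c. \<Sum>k\<in>UNIV. P a k * Q k c"
  have split: "(\<chi> c. P i c) = x *s axis i 1 + (\<chi> c. Q i c)"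
    using diff[of i] by (auto simp: vec_eq_iff axis_def algebra_simps)
  \<comment> \<open>Commutativity enters here: \<open>prod\<close> needs \<open>P\<close> as the
    right factor, where \<open>?PQ\<close> has \<open>Q\<close>.\<close>
  have "minor UNIV P * minor (- {i}) Q = det (row ?PQ (\<chi> c. P i c))"
    using prod[of Q P] by (simp add: comm)
  also have "\<dots> = det (row ?PQ (x *s axis i 1)) + det (row ?PQ (\<chi> c. Q i c))"
    unfolding row_def split by (rule det_row_add)
  also have "\<dots> = x * minor (- {i}) ?PQ + minor UNIV Q * minor (- {i}) P"
    by (simp only: unit prod)
  finally show ?thesis by simp
qed

text \<open>A discrete Beta integral: with u = |U| and t = |T|, the summand divided by (u+q+1)! is
  the integral of x^(t+q) (1-x)^(u-t) over [0,1], and summation over \<open>T\<close> leaves the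
  integral of x^q. The induction pairs \<open>T\<close> with \<open>insert x T\<close>; the two new
  terms add up to u+q+2 times the old one.\<close>

lemma sum_fact_subsets:
  assumes "finite U"
  shows "(q + 1) * (\<Sum>T\<in>Pow U. fact (card U - card T) * fact (card T + q)) = (fact (card U + q + 1) :: nat)"
  using assms
proof (induction U rule: finite_induct)
  case (insert x U)
  have *: "Pow (insert x U) = Pow U \<union> insert x ` Pow U" by (rule Pow_insert)
  have inj: "inj_on (insert x) (Pow U)" using insert.hyps by (auto simp: inj_on_def)
  have "(\<Sum>T\<in>Pow (insert x U). fact (card (insert x U) - card T) * fact (card T + q))
      = (\<Sum>T\<in>Pow U. fact (card (insert x U) - card T) * fact (card T + q))
      + (\<Sum>T\<in>Pow U. fact (card (insert x U) - card (insert x T)) * fact (card (insert x T) + q) :: nat)"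
    unfolding * using insert.hyps inj
    by (subst sum.union_disjoint) (auto simp: sum.reindex)
  also have "\<dots> = (\<Sum>T\<in>Pow U. (card U + q + 2) * (fact (card U - card T) * fact (card T + q)))"
    unfolding sum.distrib[symmetric]
  proof (rule sum.cong[OF refl])
    fix T assume "T \<in> Pow U"
    then have T: "T \<subseteq> U" by simp
    have fT: "finite T" "x \<notin> T" using T insert.hyps by (auto intro: finite_subset)
    have le: "card T \<le> card U" using T insert.hyps by (simp add: card_mono)
    obtain j where j: "card U = card T + j" using le by (metis le_iff_add)
    show "fact (card (insert x U) - card T) * fact (card T + q)
        + fact (card (insert x U) - card (insert x T)) * fact (card (insert x T) + q)
        = (card U + q + 2) * (fact (card U - card T) * fact (card T + q) :: nat)"
      using insert.hyps fT by (simp add: j algebra_simps)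
  qed
  also have "\<dots> = (card U + q + 2) * (\<Sum>T\<in>Pow U. fact (card U - card T) * fact (card T + q))"
    by (rule sum_distrib_left[symmetric])
  finally have "(q + 1) * (\<Sum>T\<in>Pow (insert x U). fact (card (insert x U) - card T) * fact (card T + q))
      = (card U + q + 2) * ((q + 1) * (\<Sum>T\<in>Pow U. fact (card U - card T) * fact (card T + q)))"
    by (simp only: mult.left_commute)
  then show ?case
    unfolding insert.IH using insert.hyps by simp
qed simp

text \<open>The reason for the factorial weights: the sum over the sets between \<open>K\<close> and
  \<open>U\<close> depends on \<open>K\<close> only through the factor 1/(|K|-d+1), the one that
  turns a central binomial coefficient into a Catalan number.\<close>

lemma sum_fact_interval:
  assumes fin: "finite U" and KU: "K \<subseteq> U" and dK: "d \<le> card K"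
  shows "(card K - d + 1) * (\<Sum>S | K \<subseteq> S \<and> S \<subseteq> U. fact (card U - card S) * fact (card S - d))
    = (fact (card U - d + 1) :: nat)"
proof -
  let ?j = "card K - d"
  have fK: "finite K" using KU fin by (rule finite_subset)
  have kU: "card K \<le> card U" using KU fin by (simp add: card_mono)
  have cUK: "card (U - K) = card U - card K" using KU fK by (simp add: card_Diff_subset)
  have "(\<Sum>S | K \<subseteq> S \<and> S \<subseteq> U. fact (card U - card S) * fact (card S - d) :: nat)
      = (\<Sum>T\<in>Pow (U - K). fact (card (U - K) - card T) * fact (card T + ?j))"
  proof (rule sum.reindex_bij_witness[where i = "\<lambda>T. K \<union> T" and j = "\<lambda>S. S - K"])
    fix S assume "S \<in> {S. K \<subseteq> S \<and> S \<subseteq> U}"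
    then have S: "S \<subseteq> U" "K \<subseteq> S" by auto
    have "finite S" using S fin by (auto intro: finite_subset)
    then have "card (S - K) = card S - card K" "card K \<le> card S"
      using S fK by (auto simp: card_Diff_subset card_mono)
    then show "fact (card (U - K) - card (S - K)) * fact (card (S - K) + ?j)
        = (fact (card U - card S) * fact (card S - d) :: nat)"
      using dK by (simp add: cUK)
  qed (use KU in auto)
  then have "(?j + 1) * (\<Sum>S | K \<subseteq> S \<and> S \<subseteq> U. fact (card U - card S) * fact (card S - d) :: nat)
      = fact (card (U - K) + ?j + 1)"
    using fin by (simp only: sum_fact_subsets finite_Diff)
  moreover have "card (U - K) + ?j + 1 = card U - d + 1" using dK kU cUK by simp
  ultimately show ?thesis by simp
qed

text \<open>Two-variable polynomials are nested: \<open>bimon a b x\<close> is \<open>x t\<^sup>a u\<^sup>b\<close> with the variable \<open>t\<close> innermost.\<close>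

definition bimon :: "nat \<Rightarrow> nat \<Rightarrow> 'a::comm_ring_1 \<Rightarrow> 'a poly poly" where
  "bimon a b x = monom (monom x a) b"

definition bicoeff :: "nat \<Rightarrow> nat \<Rightarrow> 'a::comm_ring_1 poly poly \<Rightarrow> 'a" where
  "bicoeff a b F = coeff (coeff F b) a"

lemma bimon_mult: "bimon a b x * bimon c d y = bimon (a + c) (b + d) (x * y)"
  by (simp add: bimon_def mult_monom)

lemma bimon_add: "bimon a b (x + y) = bimon a b x + bimon a b y"
  by (simp add: bimon_def add_monom)

lemma bimon_0 [simp]: "bimon a b 0 = 0"
  by (simp add: bimon_def)

lemma bimon_1 [simp]: "bimon 0 0 1 = 1"
  by (simp add: bimon_def)

lemma bimon_sum: "bimon a b (sum f A) = (\<Sum>x\<in>A. bimon a b (f x))"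
  by (induction A rule: infinite_finite_induct) (auto simp: bimon_add)

lemma bimon_power: "bimon a b x ^ k = bimon (k * a) (k * b) (x ^ k)"
  by (induction k) (auto simp: bimon_mult)

lemma bimon_of_nat: "of_nat k * bimon a b x = bimon a b (of_nat k * x)"
  by (induction k) (auto simp: bimon_add algebra_simps)

lemma bicoeff_bimon: "bicoeff a b (bimon c d x) = (if a = c \<and> b = d then x else 0)"
  by (auto simp: bicoeff_def bimon_def)

lemma bicoeff_diff: "bicoeff a b (F - G) = bicoeff a b F - bicoeff a b G"
  by (simp add: bicoeff_def)

lemma bicoeff_sum: "bicoeff a b (sum F A) = (\<Sum>x\<in>A. bicoeff a b (F x))"
  by (simp add: bicoeff_def coeff_sum)

lemma minor_bimon: "minor S (\<lambda>a c. bimon 0 0 (Y a c)) = bimon 0 0 (minor S Y)"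
  by (rule minor_hom[symmetric]) (auto simp: bimon_mult bimon_add)

lemma bicoeff_sum_mult:
  assumes "finite A" "finite B"
  shows "bicoeff a b ((\<Sum>K\<in>A. bimon (p K) 0 (x K)) * (\<Sum>L\<in>B. bimon 0 (q L) (y L)))
    = (\<Sum>K | K \<in> A \<and> p K = a. x K) * (\<Sum>L | L \<in> B \<and> q L = b. y L)"
proof -
  have "bicoeff a b ((\<Sum>K\<in>A. bimon (p K) 0 (x K)) * (\<Sum>L\<in>B. bimon 0 (q L) (y L)))
      = (\<Sum>K\<in>A. \<Sum>L\<in>B. (if p K = a then x K else 0) * (if q L = b then y L else 0))"
    by (simp add: sum_product bicoeff_sum bimon_mult bicoeff_bimon)
       (intro sum.cong refl, auto)
  also have "\<dots> = (\<Sum>K\<in>A. if p K = a then x K else 0) * (\<Sum>L\<in>B. if q L = b then y L else 0)"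
    by (simp add: sum_product)
  also have "\<dots> = (\<Sum>K | K \<in> A \<and> p K = a. x K) * (\<Sum>L | L \<in> B \<and> q L = b. y L)"
    using assms by (simp add: sum.inter_filter)
  finally show ?thesis .
qed

lemma bicoeff_binomial:
  "bicoeff a b (bimon e e 1 * (bimon 1 0 1 + bimon 0 1 1) ^ q * bimon 0 0 x)
    = (if e \<le> a \<and> e \<le> b \<and> a + b = 2 * e + q then of_nat (q choose (a - e)) * x else 0)"
proof -
  have "bimon e e 1 * (bimon 1 0 1 + bimon 0 1 1) ^ q * bimon 0 0 x
      = (\<Sum>k\<le>q. bimon (e + k) (e + (q - k)) (of_nat (q choose k) * x))"
    by (simp add: binomial_ring bimon_power bimon_mult bimon_of_nat sum_distrib_left sum_distrib_right
        mult.assoc)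
  also have "bicoeff a b \<dots> = (\<Sum>k\<le>q. if a = e + k \<and> b = e + (q - k) then of_nat (q choose k) * x else 0)"
    by (simp add: bicoeff_sum bicoeff_bimon)
  also have "\<dots> = (\<Sum>k\<le>q. if k = a - e then (if e \<le> a \<and> e \<le> b \<and> a + b = 2 * e + q
      then of_nat (q choose (a - e)) * x else 0) else 0)"
    by (intro sum.cong refl) auto
  also have "\<dots> = (if e \<le> a \<and> e \<le> b \<and> a + b = 2 * e + q then of_nat (q choose (a - e)) * x else 0)"
    by auto
  finally show ?thesis .
qed

text \<open>The bracket is the Catalan number C(2j,j)/(j+1), because (j+1) C(2j,j+1) = j C(2j,j).
  The difference of binomial coefficients will come from multiplication by
  \<open>t - u\<close>.\<close>

lemma Catalan_ballot:
  "(int j + 1) * (int (2 * j choose j) - int (2 * j choose (j + 1))) = int (2 * j choose j)"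
proof -
  have "(j + 1) * (2 * j choose (j + 1)) = j * (2 * j choose j)"
    using binomial_absorb_comp[of "2 * j" j] binomial_absorption[of j "2 * j"] 
    by (cases j) (auto simp: algebra_simps)
  then have "(int j + 1) * int (2 * j choose (j + 1)) = int j * int (2 * j choose j)"
    by (metis of_nat_1 of_nat_add of_nat_mult)
  then show ?thesis by (simp add: algebra_simps)
qed

section \<open>Minors with different rows and columns\<close>

definition minor_sum :: "'i set \<Rightarrow> nat \<Rightarrow> ('i \<Rightarrow> 'i \<Rightarrow> 'a::comm_ring_1) \<Rightarrow> 'a" where
  "minor_sum V r Y = (\<Sum>S | S \<subseteq> V \<and> card S = r. minor S Y)"

lemma bicoeff_mult_left_var: "bicoeff (Suc a) b (bimon 1 0 1 * F) = bicoeff a b F"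
  by (simp add: bicoeff_def bimon_def coeff_monom_mult)

lemma bicoeff_mult_right_var:
  "bicoeff a b (bimon 0 1 1 * F) = (if b = 0 then 0 else bicoeff a (b - 1) F)"
  by (auto simp: bicoeff_def bimon_def coeff_monom_mult)

text \<open>Only the existence of coefficients free of \<open>w\<close> matters. The values
  \<open>\<omega> K q\<close> are never computed, since both sides of the final identity are
  compared as linear combinations of them.\<close>

lemma minor_linear_expansion:
  fixes X Z :: "'m::finite \<Rightarrow> 'm \<Rightarrow> 'a::comm_ring_1"
  obtains \<omega> where "\<And>K. minor K (\<lambda>a c. w * bimon 0 0 (X a c) + bimon 0 0 (Z a c))
    = (\<Sum>q\<le>card K. w ^ q * bimon 0 0 (\<omega> K q))"
proof
  define \<omega> where "\<omega> = (\<lambda>K q. \<Sum>p | p permutes K. of_int (sign p) *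
    (\<Sum>J | J \<in> Pow K \<and> card J = q. (\<Prod>a\<in>J. X a (p a)) * (\<Prod>a\<in>K - J. Z a (p a))))"
  fix K
  have bprod: "(\<Prod>a\<in>J. bimon 0 0 (f a)) = bimon 0 0 (\<Prod>a\<in>J. f a)" for J :: "'m set" and f :: "'m \<Rightarrow> 'a"
    by (induction J rule: infinite_finite_induct) (auto simp: bimon_mult)
  have bsign: "of_int (sign p) * bimon 0 0 x = bimon 0 0 (of_int (sign p) * x)" for p :: "'m \<Rightarrow> 'm" and x :: 'a
    using bimon_add[of 0 0 x "- x"] by (simp add: sign_def neg_eq_iff_add_eq_0)
  have "(\<Prod>a\<in>K. w * bimon 0 0 (X a (p a)) + bimon 0 0 (Z a (p a)))
      = (\<Sum>q\<le>card K. w ^ q * bimon 0 0 (\<Sum>J | J \<in> Pow K \<and> card J = q.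
          (\<Prod>a\<in>J. X a (p a)) * (\<Prod>a\<in>K - J. Z a (p a))))" for p
  proof -
    have "(\<Prod>a\<in>K. w * bimon 0 0 (X a (p a)) + bimon 0 0 (Z a (p a)))
        = (\<Sum>J\<in>Pow K. w ^ card J * bimon 0 0 ((\<Prod>a\<in>J. X a (p a)) * (\<Prod>a\<in>K - J. Z a (p a))))"
      by (simp add: prod_add prod.distrib bprod bimon_mult mult.assoc)
    also have "\<dots> = (\<Sum>q\<le>card K. \<Sum>J | J \<in> Pow K \<and> card J = q.
        w ^ card J * bimon 0 0 ((\<Prod>a\<in>J. X a (p a)) * (\<Prod>a\<in>K - J. Z a (p a))))"
      by (rule sum.group[symmetric]) (auto intro: card_mono)
    finally show ?thesis by (simp add: bimon_sum sum_distrib_left)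
  qed
  then have "minor K (\<lambda>a c. w * bimon 0 0 (X a c) + bimon 0 0 (Z a c))
    = (\<Sum>p | p permutes K. \<Sum>q\<le>card K. w ^ q * bimon 0 0 (of_int (sign p) *
        (\<Sum>J | J \<in> Pow K \<and> card J = q. (\<Prod>a\<in>J. X a (p a)) * (\<Prod>a\<in>K - J. Z a (p a)))))"
    unfolding minor_def bsign[symmetric] by (simp only: sum_distrib_left mult.left_commute)
  also have "\<dots> = (\<Sum>q\<le>card K. w ^ q * bimon 0 0 (\<omega> K q))"
    unfolding \<omega>_def bimon_sum sum_distrib_left by (rule sum.swap)
  finally show "minor K (\<lambda>a c. w * bimon 0 0 (X a c) + bimon 0 0 (Z a c))
    = (\<Sum>q\<le>card K. w ^ q * bimon 0 0 (\<omega> K q))" .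
qed

text \<open>
  The matching of rows with columns in an off-diagonal minor is an involution depending only on
  the unordered pair \<open>{I, J}\<close>, so that exchanging rows and columns produces no sign.
\<close>

definition swap_map :: "'i set \<Rightarrow> 'i set \<Rightarrow> 'i \<Rightarrow> 'i" where
  "swap_map I J = (SOME \<tau>. (\<forall>x. \<tau> (\<tau> x) = x) \<and> \<tau> ` I = J \<and> (\<forall>x. x \<notin> I \<union> J \<longrightarrow> \<tau> x = x))"

lemma swap_map_commute: "swap_map I J = swap_map J I"
proof -
  have "\<tau> ` \<tau> ` A = A" if "\<forall>x. \<tau> (\<tau> x) = x" for \<tau> :: "'a \<Rightarrow> 'a" and A
    using that by (simp add: image_image)
  then have iff: "\<tau> ` I = J \<longleftrightarrow> \<tau> ` J = I" if "\<forall>x. \<tau> (\<tau> x) = x" for \<tau> :: "'a \<Rightarrow> 'a"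
    using that by (auto simp del: image_image)
  have "(\<lambda>\<tau>. (\<forall>x. \<tau> (\<tau> x) = x) \<and> \<tau> ` I = J \<and> (\<forall>x. x \<notin> I \<union> J \<longrightarrow> \<tau> x = x))
      = (\<lambda>\<tau>. (\<forall>x. \<tau> (\<tau> x) = x) \<and> \<tau> ` J = I \<and> (\<forall>x. x \<notin> J \<union> I \<longrightarrow> \<tau> x = x))"
    unfolding Un_commute[of J I] by (intro ext conj_cong refl iff)
  then show ?thesis unfolding swap_map_def by (rule arg_cong)
qed

lemma swap_map:
  assumes fin: "finite I" "finite J" and disj: "I \<inter> J = {}" and card: "card I = card J"
  shows "swap_map I J (swap_map I J x) = x" and "swap_map I J ` I = J"
    and "x \<notin> I \<union> J \<Longrightarrow> swap_map I J x = x"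
proof -
  obtain f where f: "bij_betw f I J" using finite_same_card_bij[OF fin card] by auto
  define \<tau> where "\<tau> = (\<lambda>x. if x \<in> I then f x else if x \<in> J then inv_into I f x else x)"
  have fJ: "f x \<in> J" "inv_into I f (f x) = x" if "x \<in> I" for x
    using f that by (auto simp: bij_betw_def)
  have fI: "inv_into I f x \<in> I" "f (inv_into I f x) = x" if "x \<in> J" for x
    using f that by (auto simp: bij_betw_def inv_into_into f_inv_into_f)
  have "\<tau> (\<tau> x) = x" for x
    using fJ[of x] fI[of x] disj by (auto simp: \<tau>_def)
  moreover have "\<tau> ` I = J" using f by (auto simp: \<tau>_def bij_betw_def)
  moreover have "\<forall>x. x \<notin> I \<union> J \<longrightarrow> \<tau> x = x" by (simp add: \<tau>_def)
  ultimately have "\<exists>\<tau>. (\<forall>x. \<tau> (\<tau> x) = x) \<and> \<tau> ` I = J \<and> (\<forall>x. x \<notin> I \<union> J \<longrightarrow> \<tau> x = x)"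
    by blast
  from someI_ex[OF this] have "(\<forall>x. swap_map I J (swap_map I J x) = x) \<and> swap_map I J ` I = J
      \<and> (\<forall>x. x \<notin> I \<union> J \<longrightarrow> swap_map I J x = x)"
    unfolding swap_map_def .
  then show "swap_map I J (swap_map I J x) = x" and "swap_map I J ` I = J"
    and "x \<notin> I \<union> J \<Longrightarrow> swap_map I J x = x" by blast+
qed

text \<open>The columns are matched with the rows by \<open>swap_map I J\<close>, the same for every
  \<open>M\<close>. Sums over \<open>M\<close> are meaningful only with this common choice of
  signs.\<close>

definition off_minor :: "('i \<Rightarrow> 'i \<Rightarrow> 'a::comm_ring_1) \<Rightarrow> 'i set \<Rightarrow> 'i set \<Rightarrow> 'i set \<Rightarrow> 'a" where
  "off_minor X I J M = minor (I \<union> M) (\<lambda>a c. X a (swap_map I J c))"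

lemma card_Diff_eq:
  assumes "finite P" "finite Q" "card Q = card P"
  shows "card (P - Q) = card (Q - P)"
  using assms card_Diff_subset_Int[of P Q] card_Diff_subset_Int[of Q P] by (simp add: Int_commute)

lemma swap_map_bij:
  fixes P Q :: "'i::finite set"
  assumes "card Q = card P"
  shows "bij_betw (swap_map (P - Q) (Q - P)) P Q"
proof -
  note sw = swap_map[OF finite finite _ card_Diff_eq[OF finite finite assms]]
  have disj: "(P - Q) \<inter> (Q - P) = {}" by auto
  have "swap_map (P - Q) (Q - P) ` (P \<inter> Q) = (\<lambda>x. x) ` (P \<inter> Q)"
    by (intro image_cong refl sw(3)[OF disj]) blast
  then have "swap_map (P - Q) (Q - P) ` ((P - Q) \<union> (P \<inter> Q)) = (Q - P) \<union> (P \<inter> Q)"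
    by (simp only: image_Un sw(2)[OF disj] image_ident)
  moreover have "(P - Q) \<union> (P \<inter> Q) = P" "(Q - P) \<union> (P \<inter> Q) = Q" by auto
  moreover have "inj_on (swap_map (P - Q) (Q - P)) P"
    by (rule inj_on_inverseI[where g = "swap_map (P - Q) (Q - P)"]) (rule sw(1)[OF disj])
  ultimately show ?thesis by (simp only: bij_betw_def simp_thms)
qed

lemma swap_map_eq_iff:
  fixes P Q :: "'i::finite set"
  assumes "card Q = card P" "a \<in> P" "c \<in> P"
  shows "a = swap_map (P - Q) (Q - P) c \<longleftrightarrow> a = c \<and> a \<in> Q"
proof
  note sw = swap_map[OF finite finite _ card_Diff_eq[OF finite finite assms(1)]]
  have disj: "(P - Q) \<inter> (Q - P) = {}" by auto
  show "a = c \<and> a \<in> Q" if eq: "a = swap_map (P - Q) (Q - P) c"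
  proof -
    have "c \<in> Q"
    proof (rule ccontr)
      assume "c \<notin> Q"
      then have "a \<in> swap_map (P - Q) (Q - P) ` (P - Q)" using eq assms(3) by blast
      then have "a \<in> Q - P" unfolding sw(2)[OF disj] .
      then show False using assms(2) by simp
    qed
    then have "c \<notin> (P - Q) \<union> (Q - P)" using assms(3) by blast
    then have "swap_map (P - Q) (Q - P) c = c" by (rule sw(3)[OF disj])
    then show ?thesis using eq \<open>c \<in> Q\<close> by simp
  qed
  show "a = swap_map (P - Q) (Q - P) c" if "a = c \<and> a \<in> Q"
  proof -
    have "c \<notin> (P - Q) \<union> (Q - P)" using that assms(3) by blast
    then have "swap_map (P - Q) (Q - P) c = c" by (rule sw(3)[OF disj])
    then show ?thesis using that by simp
  qed
qed

lemma off_minor_commute: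
  fixes X :: "'i::finite \<Rightarrow> 'i \<Rightarrow> 'a::comm_ring_1"
  assumes sym: "\<And>a c. X a c = X c a" and disj: "I \<inter> J = {}" and card: "card I = card J"
    and M: "M \<inter> (I \<union> J) = {}"
  shows "off_minor X J I M = off_minor X I J M"
proof -
  let ?t = "swap_map I J" and ?S = "I \<union> M"
  note sw = swap_map[OF finite finite disj card]
  have "?t ` M = (\<lambda>x. x) ` M" by (intro image_cong refl sw(3)) (use M in blast)
  then have tS: "?t ` ?S = J \<union> M" by (simp only: image_Un sw(2) image_ident)
  have "off_minor X J I M = minor (?t ` ?S) (\<lambda>a c. X a (?t c))"
    unfolding off_minor_def tS by (simp add: swap_map_commute)
  also have "\<dots> = minor ?S (\<lambda>a c. X c (?t a))"
  proof (subst minor_image_involution)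
    show "minor ?S (\<lambda>a c. X (?t a) (?t (?t c))) = minor ?S (\<lambda>a c. X c (?t a))"
      by (simp only: sw(1)) (rule minor_cong, rule sym)
  qed (rule sw(1))
  also have "\<dots> = off_minor X I J M"
    unfolding off_minor_def by (rule minor_transpose) simp
  finally show ?thesis .
qed

text \<open>In the submatrix with rows \<open>P\<close> and columns \<open>Q\<close>, diagonal
  entries of the full matrix occur only at indices in \<open>P \<inter> Q\<close>. So every row in
  \<open>P - Q\<close> must contribute an entry of \<open>X\<close>, and \<open>K\<close> has the
  form \<open>(P - Q) \<union> M\<close>.\<close>

lemma minor_off_diagonal_expansion:
  fixes X :: "'i::finite \<Rightarrow> 'i \<Rightarrow> 'a::comm_ring_1"
  assumes cQ: "card Q = card P"
  shows "minor P (\<lambda>a c. (if a = swap_map (P - Q) (Q - P) c then x else 0)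
      + X a (swap_map (P - Q) (Q - P) c))
    = (\<Sum>M\<in>Pow (P \<inter> Q). x ^ (card (P \<inter> Q) - card M) * off_minor X (P - Q) (Q - P) M)"
proof -
  let ?g = "swap_map (P - Q) (Q - P)"
  have "minor P (\<lambda>a c. (if a = ?g c then x else 0) + X a (?g c))
      = minor P (\<lambda>a c. (if a = c then (if a \<in> Q then x else 0) else 0) + X a (?g c))"
    by (rule minor_cong) (auto simp: swap_map_eq_iff[OF cQ])
  also have "\<dots> = (\<Sum>K\<in>Pow P. (\<Prod>a\<in>P - K. if a \<in> Q then x else 0) * minor K (\<lambda>a c. X a (?g c)))"
    by (rule minor_diag_add) simp
  also have "\<dots> = (\<Sum>K\<in>(\<union>) (P - Q) ` Pow (P \<inter> Q).
      (\<Prod>a\<in>P - K. if a \<in> Q then x else 0) * minor K (\<lambda>a c. X a (?g c)))"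
  proof (rule sum.mono_neutral_right)
    show "\<forall>K\<in>Pow P - (\<union>) (P - Q) ` Pow (P \<inter> Q).
        (\<Prod>a\<in>P - K. if a \<in> Q then x else 0) * minor K (\<lambda>a c. X a (?g c)) = 0"
    proof
      fix K assume K: "K \<in> Pow P - (\<union>) (P - Q) ` Pow (P \<inter> Q)"
      have "\<not> P - Q \<subseteq> K"
      proof
        assume "P - Q \<subseteq> K"
        then have "K = (P - Q) \<union> (K \<inter> Q)" using K by blast
        moreover have "K \<inter> Q \<in> Pow (P \<inter> Q)" using K by blast
        ultimately have "K \<in> (\<union>) (P - Q) ` Pow (P \<inter> Q)" by (rule image_eqI)
        then show False using K by blast
      qed
      then have "(\<Prod>a\<in>P - K. if a \<in> Q then x else 0) = 0"
        by (intro prod_zero) auto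
      then show "(\<Prod>a\<in>P - K. if a \<in> Q then x else 0) * minor K (\<lambda>a c. X a (?g c)) = 0" by simp
    qed
  qed auto
  also have "\<dots> = (\<Sum>M\<in>Pow (P \<inter> Q). (\<Prod>a\<in>P - ((P - Q) \<union> M). if a \<in> Q then x else 0)
      * minor ((P - Q) \<union> M) (\<lambda>a c. X a (?g c)))"
    by (subst sum.reindex) (auto simp: inj_on_def)
  also have "\<dots> = (\<Sum>M\<in>Pow (P \<inter> Q). x ^ (card (P \<inter> Q) - card M) * off_minor X (P - Q) (Q - P) M)"
  proof (rule sum.cong[OF refl])
    fix M assume M: "M \<in> Pow (P \<inter> Q)"
    have "P - ((P - Q) \<union> M) = P \<inter> Q - M" by auto
    moreover have "card (P \<inter> Q - M) = card (P \<inter> Q) - card M"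
      using M by (intro card_Diff_subset) auto
    ultimately show "(\<Prod>a\<in>P - ((P - Q) \<union> M). if a \<in> Q then x else 0)
      * minor ((P - Q) \<union> M) (\<lambda>a c. X a (?g c))
      = x ^ (card (P \<inter> Q) - card M) * off_minor X (P - Q) (Q - P) M"
      by (simp add: off_minor_def)
  qed
  finally show ?thesis .
qed

text \<open>For |Q| = |P| and \<open>d \<le> card P\<close> this is the coefficient of x^(|P|-d) in
  the minor of x + X with rows \<open>P\<close> and columns \<open>Q\<close>, with the sign given by
  the matching.\<close>

definition off_minor_sum :: "nat \<Rightarrow> ('i \<Rightarrow> 'i \<Rightarrow> 'a::comm_ring_1) \<Rightarrow> 'i set \<Rightarrow> 'i set \<Rightarrow> 'a" where
  "off_minor_sum d X P Q = (\<Sum>M | M \<subseteq> P \<inter> Q \<and> card (P - Q) + card M = d. off_minor X (P - Q) (Q - P) M)"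

text \<open>In the application \<open>e\<close> is the exponent of \<open>t * u\<close> and
  \<open>q\<close> that of \<open>t + u\<close>. The exponent pair (v+1, v-1) has the same sum as
  (v, v), hence requires the same \<open>q\<close>, but it excludes \<open>e = v\<close>, that is,
  \<open>k = d\<close>.\<close>

lemma ballot_exponents:
  fixes d v k e q :: nat
  assumes "d + v = k + e" "v \<noteq> 0"
  shows "(e \<le> v + 1 \<and> e \<le> v - 1 \<and> v + 1 + (v - 1) = 2 * e + q) \<longleftrightarrow> q = 2 * (k - d) \<and> d < k"
    and "d < k \<Longrightarrow> v + 1 - e = k - d + 1"
proof -
  obtain w where v: "v = Suc w" using assms(2) not0_implies_Suc by blast
  have "(e \<le> w \<and> w + w + 2 = 2 * e + q) \<longleftrightarrow> q = 2 * (k - d) \<and> d < k"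
    using assms(1) unfolding v by linarith
  then show "(e \<le> v + 1 \<and> e \<le> v - 1 \<and> v + 1 + (v - 1) = 2 * e + q) \<longleftrightarrow> q = 2 * (k - d) \<and> d < k"
    unfolding v by auto
  show "d < k \<Longrightarrow> v + 1 - e = k - d + 1" using assms(1) by linarith
qed

text \<open>Let n = \<open>CARD('m)\<close> and v = n-1-d. In the Christoffel--Darboux identity the
  coefficient of t^(v+1) u^v is the bracket on the left. In terms of the quotient it is the
  coefficient of t^v u^v minus that of t^(v+1) u^(v-1), which gives each \<open>K\<close> a Catalan
  number. The sums of squares on the right are diagonal coefficients of principal minors, which give
  \<open>K\<close> a central binomial coefficient; \<open>sum_fact_interval\<close> reconciles the
  two.\<close>

theorem minor_sum_wronskian:
  fixes X :: "'m::finite \<Rightarrow> 'm \<Rightarrow> 'a::comm_ring_1"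
  assumes sym: "\<And>a c. X a c = X c a" and d: "d < CARD('m)"
  shows "of_nat (fact (CARD('m) - d)) * (minor_sum UNIV d X * minor_sum (- {i}) d X
      - minor_sum UNIV (d + 1) X * (if d = 0 then 0 else minor_sum (- {i}) (d - 1) X))
    = (\<Sum>P | P \<subseteq> - {i} \<and> d \<le> card P. of_nat (fact (CARD('m) - card P - 1) * fact (card P - d))
        * (\<Sum>Q | card Q = card P. (off_minor_sum d X P Q)\<^sup>2))"
proof -
  let ?V = "- {i}" and ?n = "CARD('m)"
  define t u :: "'a poly poly" where "t = bimon 1 0 1" and "u = bimon 0 1 1"
  define C :: "'a \<Rightarrow> 'a poly poly" where "C = bimon 0 0"
  define XX where "XX = (\<lambda>a c. \<Sum>k\<in>UNIV. X a k * X k c)"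
  define PT where "PT = (\<lambda>x a c. (if a = c then x else 0) + C (X a c))"
  define PQ where "PQ = (\<lambda>a c. \<Sum>k\<in>UNIV. PT t a k * PT u k c)"
  have cV: "card ?V = ?n - 1" by (simp add: Compl_eq_Diff_UNIV card_Diff_singleton)
  have Cmul: "C (x * y) = C x * C y" and Cadd: "C (x + y) = C x + C y" for x y
    by (auto simp: C_def bimon_mult bimon_add)
  have Csum: "C (sum f A) = (\<Sum>x\<in>A. C (f x))" for f :: "'m \<Rightarrow> 'a" and A
    by (simp add: C_def bimon_sum)
  have Cminor: "minor S (\<lambda>a c. C (Y a c)) = C (minor S Y)" for S and Y :: "'m \<Rightarrow> 'm \<Rightarrow> 'a"
    by (simp add: C_def minor_bimon)
  have prod_entry: "(\<Sum>k\<in>UNIV. PT x a k * PT y k c)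
      = (if a = c then x * y else 0) + ((x + y) * C (X a c) + C (XX a c))" for x y a c
  proof -
    have "(\<Sum>k\<in>UNIV. PT x a k * PT y k c) = (\<Sum>k\<in>UNIV. (if a = k then x * (if k = c then y else 0) else 0)
        + (if a = k then x * C (X k c) else 0) + (if k = c then C (X a k) * y else 0) + C (X a k * X k c))"
      by (intro sum.cong refl) (auto simp: PT_def Cmul algebra_simps)
    also have "\<dots> = (if a = c then x * y else 0) + x * C (X a c) + C (X a c) * y + C (XX a c)"
      by (simp add: sum.distrib XX_def Csum)
    finally show ?thesis by (simp add: algebra_simps)
  qed
  obtain \<omega> where \<omega>: "\<And>K. minor K (\<lambda>a c. (t + u) * C (X a c) + C (XX a c))
      = (\<Sum>q\<le>card K. (t + u) ^ q * C (\<omega> K q))"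
    using minor_linear_expansion[of "t + u" X XX] unfolding C_def by blast
  have tu: "(t * u) ^ e = bimon e e 1" for e
    by (simp add: t_def u_def bimon_mult bimon_power)
  have minor_PQ: "minor S PQ = (\<Sum>K\<in>Pow S. \<Sum>q\<le>card K.
      bimon (card S - card K) (card S - card K) 1 * (t + u) ^ q * C (\<omega> K q))" for S
  proof -
    have "minor S PQ = (\<Sum>K\<in>Pow S. (\<Prod>a\<in>S - K. t * u) * minor K (\<lambda>a c. (t + u) * C (X a c) + C (XX a c)))"
      unfolding PQ_def prod_entry by (rule minor_diag_add) simp
    also have "\<dots> = (\<Sum>K\<in>Pow S. \<Sum>q\<le>card K.
      bimon (card S - card K) (card S - card K) 1 * (t + u) ^ q * C (\<omega> K q))"
      by (intro sum.cong refl) (auto simp: \<omega> tu sum_distrib_left mult.assoc card_Diff_subset finite_subset)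
    finally show ?thesis .
  qed
  have coeff_PQ: "bicoeff a b (minor S PQ) = (\<Sum>K\<in>Pow S. \<Sum>q\<le>card K.
      if card S - card K \<le> a \<and> card S - card K \<le> b \<and> a + b = 2 * (card S - card K) + q
      then of_nat (q choose (a - (card S - card K))) * \<omega> K q else 0)" for a b S
    unfolding minor_PQ by (simp only: bicoeff_sum C_def t_def u_def bicoeff_binomial)
  \<comment> \<open>On the diagonal the power of \<open>t + u\<close> belonging to \<open>K\<close>
    is forced to be \<open>2 * (card K - d)\<close>. The guards give 0 when \<open>K\<close> is too
    small or that power exceeds \<open>card K\<close> and does not occur.\<close>
  define g where "g = (\<lambda>K. if d \<le> card K \<and> 2 * (card K - d) \<le> card K then \<omega> K (2 * (card K - d)) else 0)"
  \<comment> \<open>Needed for general \<open>S\<close>: for the complement of \<open>i\<close> in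
    the Wronskian, and for every \<open>P\<close> on the right-hand side.\<close>
  have diag_coeff: "bicoeff (card S - d) (card S - d) (minor S PQ)
      = (\<Sum>K\<in>Pow S. of_nat (2 * (card K - d) choose (card K - d)) * g K)" if dS: "d \<le> card S" for S
    unfolding coeff_PQ
  proof (rule sum.cong[OF refl])
    fix K assume "K \<in> Pow S"
    then have le: "card K \<le> card S" by (simp add: card_mono)
    have cond: "(card S - card K \<le> card S - d \<and> card S - card K \<le> card S - d
        \<and> card S - d + (card S - d) = 2 * (card S - card K) + q) \<longleftrightarrow> q = 2 * (card K - d) \<and> d \<le> card K" for q
      using le dS by linarith
    have sub: "card S - d - (card S - card K) = card K - d"
      using le dS by linarith
    have "(\<Sum>q\<le>card K. if card S - card K \<le> card S - d \<and> card S - card K \<le> card S - d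
        \<and> card S - d + (card S - d) = 2 * (card S - card K) + q
      then of_nat (q choose (card S - d - (card S - card K))) * \<omega> K q else 0)
      = (\<Sum>q\<le>card K. if q = 2 * (card K - d) then
          (if d \<le> card K then of_nat (2 * (card K - d) choose (card K - d)) * \<omega> K q else 0) else 0)"
      unfolding cond sub by (intro sum.cong refl) auto
    also have "\<dots> = of_nat (2 * (card K - d) choose (card K - d)) * g K"
      by (simp add: g_def)
    finally show "(\<Sum>q\<le>card K. if card S - card K \<le> card S - d \<and> card S - card K \<le> card S - d
        \<and> card S - d + (card S - d) = 2 * (card S - card K) + q
      then of_nat (q choose (card S - d - (card S - card K))) * \<omega> K q else 0)
      = of_nat (2 * (card K - d) choose (card K - d)) * g K" .
  qed
  \<comment> \<open>If the exponent of \<open>u\<close> is already 0, it cannot be lowered and the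
    coefficient counts as 0. In that case \<open>card K \<le> d\<close> for all \<open>K\<close>, so
    the binomial coefficients on the right are all \<open>0 choose 1\<close>.\<close>
  have off_coeff: "(if ?n - 1 - d = 0 then 0 else bicoeff (?n - 1 - d + 1) (?n - 1 - d - 1) (minor ?V PQ))
      = (\<Sum>K\<in>Pow ?V. of_nat (2 * (card K - d) choose (card K - d + 1)) * g K)"
  proof (cases "?n - 1 - d = 0")
    case True
    have "of_nat (2 * (card K - d) choose (card K - d + 1)) * g K = 0" if "K \<in> Pow ?V" for K
    proof -
      have "card K \<le> ?n - 1" using that cV by (metis PowD card_mono finite)
      then have "card K - d = 0" using True by simp
      then show ?thesis by simp
    qed
    then have "(\<Sum>K\<in>Pow ?V. of_nat (2 * (card K - d) choose (card K - d + 1)) * g K) = 0"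
      by (rule sum.neutral[OF ballI])
    then show ?thesis by (simp only: if_P[OF True])
  next
    case False
    have "bicoeff (?n - 1 - d + 1) (?n - 1 - d - 1) (minor ?V PQ)
      = (\<Sum>K\<in>Pow ?V. of_nat (2 * (card K - d) choose (card K - d + 1)) * g K)"
      unfolding coeff_PQ cV
    proof (rule sum.cong[OF refl])
      fix K assume "K \<in> Pow ?V"
      then have le: "card K \<le> ?n - 1" using cV by (metis PowD card_mono finite)
      have "(\<Sum>q\<le>card K. if ?n - 1 - card K \<le> ?n - 1 - d + 1 \<and> ?n - 1 - card K \<le> ?n - 1 - d - 1
          \<and> ?n - 1 - d + 1 + (?n - 1 - d - 1) = 2 * (?n - 1 - card K) + q
        then of_nat (q choose (?n - 1 - d + 1 - (?n - 1 - card K))) * \<omega> K q else 0)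
        = (\<Sum>q\<le>card K. if q = 2 * (card K - d) then
          (if d < card K then of_nat (2 * (card K - d) choose (card K - d + 1)) * \<omega> K q else 0) else 0)"
      proof -
        have dv: "d + (?n - 1 - d) = card K + (?n - 1 - card K)" using d le by simp
        have cond: "(?n - 1 - card K \<le> ?n - 1 - d + 1 \<and> ?n - 1 - card K \<le> ?n - 1 - d - 1
          \<and> ?n - 1 - d + 1 + (?n - 1 - d - 1) = 2 * (?n - 1 - card K) + q) \<longleftrightarrow> q = 2 * (card K - d) \<and> d < card K" for q
          by (rule ballot_exponents(1)[OF dv False])
        show ?thesis
        proof (cases "d < card K")
          case True
          then have "?n - 1 - d + 1 - (?n - 1 - card K) = card K - d + 1"
            by (rule ballot_exponents(2)[OF dv False])
          then show ?thesis using True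
            by (simp only: cond simp_thms if_True) (intro sum.cong refl, simp)
        qed (simp only: cond simp_thms if_False if_cancel)
      qed
      also have "\<dots> = of_nat (2 * (card K - d) choose (card K - d + 1)) * g K"
      proof (cases "d < card K")
        case True
        then show ?thesis by (simp add: g_def)
      next
        case False
        then have "card K - d = 0" by simp
        then have "2 * (card K - d) choose (card K - d + 1) = 0" by simp
        then show ?thesis using False by (simp only: if_False if_cancel sum.neutral_const of_nat_0 mult_zero_left)
      qed
      finally show "(\<Sum>q\<le>card K. if ?n - 1 - card K \<le> ?n - 1 - d + 1 \<and> ?n - 1 - card K \<le> ?n - 1 - d - 1
          \<and> ?n - 1 - d + 1 + (?n - 1 - d - 1) = 2 * (?n - 1 - card K) + q
        then of_nat (q choose (?n - 1 - d + 1 - (?n - 1 - card K))) * \<omega> K q else 0)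
        = of_nat (2 * (card K - d) choose (card K - d + 1)) * g K" .
    qed
    then show ?thesis by (simp only: if_not_P[OF False])
  qed
  have square_coeff: "bicoeff (card P - d) (card P - d) (minor P PQ)
      = (\<Sum>Q | card Q = card P. (off_minor_sum d X P Q)\<^sup>2)" if dP: "d \<le> card P" for P
  proof -
    define \<beta> where "\<beta> = (\<lambda>Q. swap_map (P - Q) (Q - P))"
    have "minor P PQ = (\<Sum>Q | card Q = card P.
        minor P (\<lambda>a c. PT t a (\<beta> Q c)) * minor P (\<lambda>a c. PT u (\<beta> Q a) c))"
      unfolding PQ_def by (rule Cauchy_Binet_minor) (simp add: \<beta>_def swap_map_bij)
    moreover have "bicoeff (card P - d) (card P - d)
        (minor P (\<lambda>a c. PT t a (\<beta> Q c)) * minor P (\<lambda>a c. PT u (\<beta> Q a) c)) = (off_minor_sum d X P Q)\<^sup>2"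
      if Q: "card Q = card P" for Q
    proof -
      have exp: "minor P (\<lambda>a c. PT x a (\<beta> Q c)) = (\<Sum>M\<in>Pow (P \<inter> Q).
          x ^ (card (P \<inter> Q) - card M) * C (off_minor X (P - Q) (Q - P) M))" for x
        unfolding PT_def \<beta>_def minor_off_diagonal_expansion[OF Q, of x "\<lambda>a c. C (X a c)"]
        by (simp only: off_minor_def Cminor)
      \<comment> \<open>By symmetry of \<open>X\<close> the second Cauchy--Binet factor is the first
        one with \<open>u\<close> in place of \<open>t\<close>. Equal exponents of \<open>t\<close>
        and \<open>u\<close> therefore select a square.\<close>
      have "minor P (\<lambda>a c. PT u (\<beta> Q a) c) = minor P (\<lambda>a c. PT u a (\<beta> Q c))"
        by (subst minor_transpose[symmetric]) (auto intro!: minor_cong simp: PT_def sym)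
      then have "minor P (\<lambda>a c. PT t a (\<beta> Q c)) * minor P (\<lambda>a c. PT u (\<beta> Q a) c)
         = (\<Sum>M\<in>Pow (P \<inter> Q). bimon (card (P \<inter> Q) - card M) 0 (off_minor X (P - Q) (Q - P) M))
         * (\<Sum>M\<in>Pow (P \<inter> Q). bimon 0 (card (P \<inter> Q) - card M) (off_minor X (P - Q) (Q - P) M))"
        by (simp add: exp t_def u_def C_def bimon_power bimon_mult)
      moreover have "{M. M \<in> Pow (P \<inter> Q) \<and> card (P \<inter> Q) - card M = card P - d}
          = {M. M \<subseteq> P \<inter> Q \<and> card (P - Q) + card M = d}"
      proof -
        have "card P = card (P \<inter> Q) + card (P - Q)"
          by (rule card_Int_Diff) simp
        then have "card (P \<inter> Q) - card M = card P - d \<longleftrightarrow> card (P - Q) + card M = d"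
          if "M \<subseteq> P \<inter> Q" for M
          using card_mono[OF _ that] dP by simp linarith
        then show ?thesis by blast
      qed
      ultimately show ?thesis
        by (simp only: bicoeff_sum_mult finite_Pow_iff finite off_minor_sum_def power2_eq_square)
    qed
    ultimately show ?thesis
      by (simp only: bicoeff_sum) (intro sum.cong refl, simp only: mem_Collect_eq)
  qed
  have f_exp: "minor S (PT x) = (\<Sum>K\<in>Pow S. x ^ (card S - card K) * C (minor K X))" for S x
  proof -
    have "minor S (PT x) = (\<Sum>K\<in>Pow S. (\<Prod>a\<in>S - K. x) * minor K (\<lambda>a c. C (X a c)))"
      unfolding PT_def by (rule minor_diag_add) simp
    also have "\<dots> = (\<Sum>K\<in>Pow S. x ^ (card S - card K) * C (minor K X))"
      by (intro sum.cong refl) (simp add: Cminor card_Diff_subset)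
    finally show ?thesis .
  qed
  have "(t - u) * minor ?V PQ = minor UNIV (PT t) * minor ?V (PT u) - minor UNIV (PT u) * minor ?V (PT t)"
    unfolding PQ_def
    by (rule minor_compl_singleton_mult) (simp_all only: prod_entry, auto simp: PT_def algebra_simps)
  then have "bicoeff (?n - 1 - d + 1) (?n - 1 - d) ((t - u) * minor ?V PQ)
      = bicoeff (?n - 1 - d + 1) (?n - 1 - d) (minor UNIV (PT t) * minor ?V (PT u))
      - bicoeff (?n - 1 - d + 1) (?n - 1 - d) (minor ?V (PT t) * minor UNIV (PT u))"
    by (simp add: bicoeff_diff mult.commute)
  moreover have "bicoeff (?n - 1 - d + 1) (?n - 1 - d) (minor UNIV (PT t) * minor ?V (PT u))
      = minor_sum UNIV d X * minor_sum ?V d X"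
  proof -
    have 1: "{K. K \<in> Pow (UNIV :: 'm set) \<and> ?n - card K = ?n - 1 - d + 1} = {K. K \<subseteq> UNIV \<and> card K = d}"
    proof -
      have "card K \<le> ?n" for K :: "'m set" by (simp add: card_mono)
      then have "?n - card K = ?n - 1 - d + 1 \<longleftrightarrow> card K = d" for K :: "'m set"
        using d by (metis Suc_diff_Suc Suc_eq_plus1 diff_Suc_eq_diff_pred diff_diff_cancel less_imp_le_nat)
      then show ?thesis by simp
    qed
    have 2: "{K. K \<in> Pow ?V \<and> card ?V - card K = ?n - 1 - d} = {K. K \<subseteq> ?V \<and> card K = d}"
    proof -
      have "card K \<le> ?n - 1" if "K \<subseteq> ?V" for K using that cV by (metis card_mono finite)
      then have "?n - 1 - card K = ?n - 1 - d \<longleftrightarrow> card K = d" if "K \<subseteq> ?V" for K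
        using d that by fastforce
      then show ?thesis using cV by auto
    qed
    show ?thesis
      unfolding f_exp t_def u_def C_def bimon_power bimon_mult
      by (simp only: mult_0_right mult_1_right add_0_right power_one mult_1 bicoeff_sum_mult finite_Pow_iff finite 1 2 minor_sum_def)
  qed
  moreover have "bicoeff (?n - 1 - d + 1) (?n - 1 - d) (minor ?V (PT t) * minor UNIV (PT u))
      = (if d = 0 then 0 else minor_sum ?V (d - 1) X) * minor_sum UNIV (d + 1) X"
  proof -
    have 1: "{K. K \<in> Pow (UNIV :: 'm set) \<and> ?n - card K = ?n - 1 - d} = {K. K \<subseteq> UNIV \<and> card K = d + 1}"
    proof -
      have "card K \<le> ?n" for K :: "'m set" by (simp add: card_mono)
      then have "?n - card K = ?n - 1 - d \<longleftrightarrow> card K = d + 1" for K :: "'m set"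
        using d by (metis Suc_eq_plus1 Suc_leI diff_diff_cancel diff_diff_left plus_1_eq_Suc)
      then show ?thesis by simp
    qed
    have 2: "{K. K \<in> Pow ?V \<and> card ?V - card K = ?n - 1 - d + 1} = (if d = 0 then {} else {K. K \<subseteq> ?V \<and> card K = d - 1})"
    proof -
      have "card K \<le> ?n - 1" if "K \<subseteq> ?V" for K using that cV by (metis card_mono finite)
      then have "?n - 1 - card K = ?n - 1 - d + 1 \<longleftrightarrow> d \<noteq> 0 \<and> card K = d - 1" if "K \<subseteq> ?V" for K
        using d that by fastforce
      then have "{K. K \<in> Pow ?V \<and> card ?V - card K = ?n - 1 - d + 1} = {K. K \<subseteq> ?V \<and> d \<noteq> 0 \<and> card K = d - 1}"
        unfolding cV by blast
      then show ?thesis by simp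
    qed
    show ?thesis
      unfolding f_exp t_def u_def C_def bimon_power bimon_mult
      by (simp only: mult_0_right mult_1_right add_0_right power_one mult_1 bicoeff_sum_mult
          finite_Pow_iff finite 1 2 minor_sum_def) (cases "d = 0"; simp)
  qed
  moreover have "bicoeff (?n - 1 - d + 1) (?n - 1 - d) ((t - u) * minor ?V PQ)
      = (\<Sum>K\<in>Pow ?V. of_int (int (2 * (card K - d) choose (card K - d)) - int (2 * (card K - d) choose (card K - d + 1))) * g K)"
  proof -
    have "bicoeff (?n - 1 - d + 1) (?n - 1 - d) ((t - u) * minor ?V PQ)
       = bicoeff (?n - 1 - d) (?n - 1 - d) (minor ?V PQ)
       - (if ?n - 1 - d = 0 then 0 else bicoeff (?n - 1 - d + 1) (?n - 1 - d - 1) (minor ?V PQ))"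
      by (simp only: left_diff_distrib bicoeff_diff t_def u_def bicoeff_mult_left_var
          bicoeff_mult_right_var Suc_eq_plus1[symmetric])
    also have "\<dots> = (\<Sum>K\<in>Pow ?V. of_nat (2 * (card K - d) choose (card K - d)) * g K)
        - (\<Sum>K\<in>Pow ?V. of_nat (2 * (card K - d) choose (card K - d + 1)) * g K)"
      using diag_coeff[of ?V] d unfolding off_coeff cV by simp
    finally show ?thesis by (simp add: sum_subtractf left_diff_distrib)
  qed
  ultimately have W: "minor_sum UNIV d X * minor_sum ?V d X
      - minor_sum UNIV (d + 1) X * (if d = 0 then 0 else minor_sum ?V (d - 1) X)
    = (\<Sum>K\<in>Pow ?V. of_int (int (2 * (card K - d) choose (card K - d)) - int (2 * (card K - d) choose (card K - d + 1))) * g K)"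
    by (simp only: mult.commute)
  \<comment> \<open>On the right-hand side, exchanging the sums lets each \<open>K\<close> collect
    the weights of all \<open>P\<close> that contain it.\<close>
  have "(\<Sum>P | P \<subseteq> ?V \<and> d \<le> card P. of_nat (fact (?n - card P - 1) * fact (card P - d))
        * (\<Sum>Q | card Q = card P. (off_minor_sum d X P Q)\<^sup>2))
     = (\<Sum>P | P \<subseteq> ?V \<and> d \<le> card P. \<Sum>K\<in>Pow P. of_nat (fact (?n - card P - 1) * fact (card P - d))
         * (of_nat (2 * (card K - d) choose (card K - d)) * g K))"
    by (intro sum.cong refl) (simp add: square_coeff[symmetric] diag_coeff sum_distrib_left)
  also have "\<dots> = (\<Sum>P | P \<subseteq> ?V \<and> d \<le> card P. \<Sum>K | K \<in> Pow ?V \<and> K \<subseteq> P.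
      of_nat (fact (?n - card P - 1) * fact (card P - d))
         * (of_nat (2 * (card K - d) choose (card K - d)) * g K))"
    by (intro sum.cong refl) auto
  also have "\<dots> = (\<Sum>K\<in>Pow ?V. \<Sum>P | P \<in> {P. P \<subseteq> ?V \<and> d \<le> card P} \<and> K \<subseteq> P.
      of_nat (fact (?n - card P - 1) * fact (card P - d))
         * (of_nat (2 * (card K - d) choose (card K - d)) * g K))"
    by (rule sum.swap_restrict) auto
  also have "\<dots> = (\<Sum>K\<in>Pow ?V. of_nat (fact (?n - d)) *
     (of_int (int (2 * (card K - d) choose (card K - d)) - int (2 * (card K - d) choose (card K - d + 1))) * g K))"
  proof (rule sum.cong[OF refl])
    fix K assume "K \<in> Pow ?V"
    then have K: "K \<subseteq> ?V" by simp
    let ?j = "card K - d"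
    define c where "c = (\<Sum>P | P \<in> {P. P \<subseteq> ?V \<and> d \<le> card P} \<and> K \<subseteq> P.
      fact (?n - card P - 1) * fact (card P - d) :: nat)"
    show "(\<Sum>P | P \<in> {P. P \<subseteq> ?V \<and> d \<le> card P} \<and> K \<subseteq> P.
      of_nat (fact (?n - card P - 1) * fact (card P - d)) * (of_nat (2 * ?j choose ?j) * g K))
      = of_nat (fact (?n - d)) * (of_int (int (2 * ?j choose ?j) - int (2 * ?j choose (?j + 1))) * g K)"
    proof (cases "d \<le> card K")
      case False
      then show ?thesis by (simp add: g_def)
    next
      case True
      have "c = (\<Sum>P | K \<subseteq> P \<and> P \<subseteq> ?V. fact (card ?V - card P) * fact (card P - d))"
        unfolding c_def cV using True
        by (intro sum.cong) (auto intro: order_trans[OF _ card_mono[OF finite]])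
      then have "(?j + 1) * c = fact (card ?V - d + 1)"
        using sum_fact_interval[OF finite K True] by simp
      also have "card ?V - d + 1 = ?n - d" unfolding cV using d by simp
      finally have "int ((?j + 1) * c) = int (fact (?n - d))"
        by (rule arg_cong[where f = int])
      then have c: "(int ?j + 1) * int c = int (fact (?n - d))"
        by (simp only: of_nat_mult of_nat_add of_nat_1)
      have "(int ?j + 1) * (int c * int (2 * ?j choose ?j))
          = (int ?j + 1) * (int (fact (?n - d)) * (int (2 * ?j choose ?j) - int (2 * ?j choose (?j + 1))))"
        unfolding c[symmetric] using Catalan_ballot[of ?j] by (simp only: mult.assoc mult.left_commute)
      then have "int c * int (2 * ?j choose ?j)
          = int (fact (?n - d)) * (int (2 * ?j choose ?j) - int (2 * ?j choose (?j + 1)))"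
        by (subst (asm) mult_cancel_left) linarith
      then have "(of_int (int c * int (2 * ?j choose ?j)) :: 'a)
          = of_int (int (fact (?n - d)) * (int (2 * ?j choose ?j) - int (2 * ?j choose (?j + 1))))"
        by (rule arg_cong)
      then have "of_nat c * (of_nat (2 * ?j choose ?j) * g K)
        = of_nat (fact (?n - d)) * (of_int (int (2 * ?j choose ?j) - int (2 * ?j choose (?j + 1))) * g K)"
        by (simp only: of_int_mult of_int_of_nat_eq mult.assoc[symmetric])
      then show ?thesis by (simp only: c_def of_nat_sum sum_distrib_right)
    qed
  qed
  finally show ?thesis
    by (simp only: W sum_distrib_left)
qed

section \<open>Elementary symmetric polynomials\<close>

definition esym :: "('i \<Rightarrow> real) \<Rightarrow> 'i set \<Rightarrow> nat \<Rightarrow> real" where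
  "esym b V r = (\<Sum>K | K \<subseteq> V \<and> card K = r. \<Prod>a\<in>K. b a)"

lemma finite_subsets_card [simp]: "finite V \<Longrightarrow> finite {K. K \<subseteq> V \<and> card K = r}"
  by (rule rev_finite_subset[of "Pow V"]) auto

lemma subsets_card_split:
  assumes "finite V" "i \<in> V"
  shows "(\<Sum>K | K \<subseteq> V \<and> card K = Suc r. f K)
    = (\<Sum>K | K \<subseteq> V - {i} \<and> card K = Suc r. f K) + (\<Sum>K | K \<subseteq> V - {i} \<and> card K = r. f (insert i K))"
proof -
  have fK: "finite K" if "K \<subseteq> V" for K using that assms finite_subset by blast
  have "{K. K \<subseteq> V \<and> card K = Suc r} = {K. K \<subseteq> V - {i} \<and> card K = Suc r}
      \<union> insert i ` {K. K \<subseteq> V - {i} \<and> card K = r}"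
  proof (intro equalityI subsetI)
    fix K assume K: "K \<in> {K. K \<subseteq> V \<and> card K = Suc r}"
    show "K \<in> {K. K \<subseteq> V - {i} \<and> card K = Suc r} \<union> insert i ` {K. K \<subseteq> V - {i} \<and> card K = r}"
    proof (cases "i \<in> K")
      case True
      then have "K = insert i (K - {i})" "K - {i} \<subseteq> V - {i}" "card (K - {i}) = r"
        using K fK[of K] by auto
      then show ?thesis by blast
    qed (use K in auto)
  next
    fix K assume "K \<in> {K. K \<subseteq> V - {i} \<and> card K = Suc r} \<union> insert i ` {K. K \<subseteq> V - {i} \<and> card K = r}"
    then show "K \<in> {K. K \<subseteq> V \<and> card K = Suc r}"
    proof
      assume "K \<in> insert i ` {K. K \<subseteq> V - {i} \<and> card K = r}"
      then obtain L where L: "K = insert i L" "L \<subseteq> V - {i}" "card L = r" by auto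
      have "finite L" "i \<notin> L" using L fK[of L] by auto
      then show ?thesis using L assms by auto
    qed auto
  qed
  moreover have "inj_on (insert i) {K. K \<subseteq> V - {i} \<and> card K = r}"
    by (auto simp: inj_on_def)
  ultimately show ?thesis
    using assms by (subst \<open>{K. K \<subseteq> V \<and> card K = Suc r} = _\<close>, subst sum.union_disjoint)
      (auto simp: sum.reindex)
qed

lemma esym_0 [simp]: "finite V \<Longrightarrow> esym b V 0 = 1"
proof -
  assume "finite V"
  then have "{K. K \<subseteq> V \<and> card K = 0} = {{}}" by (auto dest: finite_subset)
  then show ?thesis by (simp add: esym_def)
qed

lemma esym_Suc:
  assumes "finite V" "i \<in> V"
  shows "esym b V (Suc r) = b i * esym b (V - {i}) r + esym b (V - {i}) (Suc r)"
proof -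
  have "(\<Sum>K | K \<subseteq> V - {i} \<and> card K = r. prod b (insert i K))
      = (\<Sum>K | K \<subseteq> V - {i} \<and> card K = r. b i * prod b K)"
  proof (intro sum.cong refl)
    fix K assume "K \<in> {K. K \<subseteq> V - {i} \<and> card K = r}"
    then have "finite K" "i \<notin> K" using assms finite_subset[of K V] by auto
    then show "prod b (insert i K) = b i * prod b K" by simp
  qed
  then show ?thesis
    using subsets_card_split[OF assms, of "prod b" r] by (simp add: esym_def sum_distrib_left)
qed

lemma sum_subsets_remove:
  fixes f :: "'i set \<Rightarrow> 'a::comm_semiring_1"
  assumes "finite V"
  shows "(\<Sum>i\<in>V. g i * (\<Sum>K | K \<subseteq> V - {i} \<and> card K = r. f K))
    = (\<Sum>K | K \<subseteq> V \<and> card K = r. (\<Sum>i\<in>V - K. g i) * f K)"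
proof -
  have "(\<Sum>i\<in>V. g i * (\<Sum>K | K \<subseteq> V - {i} \<and> card K = r. f K))
      = (\<Sum>i\<in>V. \<Sum>K | K \<in> {K. K \<subseteq> V \<and> card K = r} \<and> i \<notin> K. g i * f K)"
    by (intro sum.cong refl) (auto simp: sum_distrib_left intro!: sum.cong)
  also have "\<dots> = (\<Sum>K | K \<subseteq> V \<and> card K = r. \<Sum>i | i \<in> V \<and> i \<notin> K. g i * f K)"
    using assms by (intro sum.swap_restrict) auto
  also have "\<dots> = (\<Sum>K | K \<subseteq> V \<and> card K = r. (\<Sum>i\<in>V - K. g i) * f K)"
    by (simp add: sum_distrib_right set_diff_eq)
  finally show ?thesis .
qed

lemma sum_esym_remove:
  assumes "finite V"
  shows "(\<Sum>i\<in>V. esym b (V - {i}) r) = real (card V - r) * esym b V r"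
proof -
  have "(\<Sum>i\<in>V. esym b (V - {i}) r) = (\<Sum>K | K \<subseteq> V \<and> card K = r. (\<Sum>i\<in>V - K. 1) * prod b K)"
    using sum_subsets_remove[OF assms, where g = "\<lambda>_. 1" and f = "prod b" and r = r] by (simp add: esym_def)
  also have "\<dots> = (\<Sum>K | K \<subseteq> V \<and> card K = r. real (card V - r) * prod b K)"
    using assms by (intro sum.cong refl) (auto simp: card_Diff_subset finite_subset)
  finally show ?thesis by (simp add: esym_def sum_distrib_left)
qed

lemma sum_mult_esym_remove:
  assumes "finite V"
  shows "(\<Sum>i\<in>V. b i * esym b (V - {i}) r) = real (r + 1) * esym b V (r + 1)"
proof (cases "V = {}")
  case True
  then have "{K. K \<subseteq> V \<and> card K = Suc r} = {}" by auto
  then show ?thesis using True by (simp add: esym_def)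
next
  case False
  have "(\<Sum>i\<in>V. b i * esym b (V - {i}) r) = (\<Sum>i\<in>V. esym b V (Suc r) - esym b (V - {i}) (Suc r))"
    using assms by (intro sum.cong refl) (auto simp: esym_Suc)
  also have "\<dots> = (real (card V) - real (card V - Suc r)) * esym b V (Suc r)"
    using assms by (simp add: sum_subtractf sum_esym_remove left_diff_distrib)
  also have "\<dots> = real (r + 1) * esym b V (r + 1)"
  proof (cases "Suc r \<le> card V")
    case False
    have "{K. K \<subseteq> V \<and> card K = Suc r} = {}"
      using False assms by (auto dest: card_mono)
    then have "esym b V (Suc r) = 0" unfolding esym_def by (simp only: sum.empty)
    then show ?thesis by simp
  qed (simp add: of_nat_diff)
  finally show ?thesis .
qed

lemma esym_has_derivative:
  assumes "finite V"
  shows "((\<lambda>s. esym (\<lambda>a. b a + s) V (Suc r)) has_real_derivative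
    real (card V - r) * esym (\<lambda>a. b a + s) V r) (at s)"
proof -
  have fK: "finite K" if "K \<subseteq> V" for K using that assms finite_subset by blast
  have "((\<lambda>s. \<Prod>a\<in>K. b a + s) has_real_derivative (\<Sum>i\<in>K. \<Prod>a\<in>K - {i}. b a + s)) (at s)"
    for K
  proof -
    have "((\<lambda>s. b a + s) has_real_derivative 1) (at s)" for a
      by (auto intro!: derivative_eq_intros)
    from has_field_derivative_prod[OF this, where A = K] show ?thesis by simp
  qed
  then have "((\<lambda>s. esym (\<lambda>a. b a + s) V (Suc r)) has_real_derivative
    (\<Sum>K | K \<subseteq> V \<and> card K = Suc r. \<Sum>i\<in>K. \<Prod>a\<in>K - {i}. b a + s)) (at s)"
    unfolding esym_def using assms by (intro DERIV_sum) auto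
  also have "(\<Sum>K | K \<subseteq> V \<and> card K = Suc r. \<Sum>i\<in>K. \<Prod>a\<in>K - {i}. b a + s)
    = (\<Sum>K | K \<subseteq> V \<and> card K = Suc r. \<Sum>i | i \<in> V \<and> i \<in> K. \<Prod>a\<in>K - {i}. b a + s)"
    by (intro sum.cong refl) auto
  also have "\<dots> = (\<Sum>i\<in>V. \<Sum>K | K \<in> {K. K \<subseteq> V \<and> card K = Suc r} \<and> i \<in> K. \<Prod>a\<in>K - {i}. b a + s)"
    using assms by (intro sum.swap_restrict[symmetric]) auto
  also have "\<dots> = (\<Sum>i\<in>V. esym (\<lambda>a. b a + s) (V - {i}) r)"
  proof (rule sum.cong[OF refl])
    fix i assume i: "i \<in> V"
    show "(\<Sum>K | K \<in> {K. K \<subseteq> V \<and> card K = Suc r} \<and> i \<in> K. \<Prod>a\<in>K - {i}. b a + s)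
        = esym (\<lambda>a. b a + s) (V - {i}) r"
      unfolding esym_def
    proof (rule sum.reindex_bij_witness[where i = "insert i" and j = "\<lambda>K. K - {i}"])
      fix L assume L: "L \<in> {K. K \<subseteq> V - {i} \<and> card K = r}"
      then have "finite L" "i \<notin> L" using fK[of L] by auto
      then show "insert i L \<in> {K. K \<in> {K. K \<subseteq> V \<and> card K = Suc r} \<and> i \<in> K}" "insert i L - {i} = L"
        using L i by auto
    qed (use fK in auto)
  qed
  finally show ?thesis using assms by (simp add: sum_esym_remove)
qed

text \<open>
  At the largest zero \<open>s1\<close> of \<open>esym (V - {i}) r\<close> the recursion makes \<open>esym (V - {i}) (Suc r)\<close> positive,
  hence positive on \<open>[s1, \<infinity>)\<close>, and the induction hypothesis for \<open>V - {i}\<close> contradicts the zero.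
\<close>

lemma esym_shift_positive_remove:
  assumes "s \<ge> s0" "finite V" "i \<in> V"
    and "\<And>x. x \<ge> s0 \<Longrightarrow> esym (\<lambda>a. b a + x) V (Suc r) > 0"
  shows "esym (\<lambda>a. b a + s) (V - {i}) r > 0"
  using assms
proof (induction "card V" arbitrary: V i s0 s rule: less_induct)
  case less
  let ?U = "V - {i}"
  let ?e = "\<lambda>V r s. esym (\<lambda>a. b a + s) V r"
  have fU: "finite ?U" using less.prems by simp
  have split: "?e V (Suc r) s = (b i + s) * ?e ?U r s + ?e ?U (Suc r) s" for s
    using less.prems by (intro esym_Suc) auto
  have rV: "Suc r \<le> card V"
  proof (rule ccontr)
    assume "\<not> Suc r \<le> card V"
    then have "{K. K \<subseteq> V \<and> card K = Suc r} = {}"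
      using less.prems(2) by (auto dest: card_mono)
    then have "?e V (Suc r) s0 = 0" unfolding esym_def by (simp only: sum.empty)
    then show False using less.prems(4)[of s0] by simp
  qed
  have cU: "card ?U = card V - 1" using less.prems by simp
  define S where "S = max s0 (\<Sum>a\<in>V. \<bar>b a\<bar>) + 1"
  have large: "?e ?U r s > 0" if "s \<ge> S" for s
  proof -
    have "b a + s > 0" if "a \<in> V" for a
    proof -
      have "\<bar>b a\<bar> \<le> (\<Sum>a\<in>V. \<bar>b a\<bar>)" using that less.prems(2) by (intro member_le_sum) auto
      then show ?thesis using \<open>s \<ge> S\<close> unfolding S_def by linarith
    qed
    moreover obtain K where "K \<subseteq> ?U" "card K = r"
      using rV cU obtain_subset_with_card_n[of r ?U] by (metis diff_le_mono diff_Suc_1)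
    ultimately show ?thesis
      unfolding esym_def using less.prems(2)
      by (intro sum_pos2[of _ K]) (auto intro!: prod_pos prod_nonneg less_imp_le)
  qed
  have cont: "continuous_on A (?e W k)" for A W k
    unfolding esym_def by (intro continuous_intros)
  show ?case
  proof (rule ccontr)
    assume neg: "\<not> ?e ?U r s > 0"
    have "s \<le> S" using large[of s] neg by linarith
    then obtain z where z: "s \<le> z" "z \<le> S" "?e ?U r z = 0"
      using IVT'[of "?e ?U r" s 0 S, OF _ _ _ cont] large[of S] neg by (auto simp: not_less less_imp_le)
    let ?Z = "{x \<in> {s..S}. ?e ?U r x = 0}"
    have "closed ?Z"
      by (intro continuous_closed_preimage_constant cont closed_atLeastAtMost)
    then have "compact ?Z"
      by (rule compact_eq_bounded_closed[THEN iffD2, OF conjI, rotated])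
         (rule bounded_subset[OF bounded_closed_interval[of s S]], auto)
    then obtain s1 where s1: "s1 \<in> ?Z" and max: "\<And>x. x \<in> ?Z \<Longrightarrow> x \<le> s1"
      using compact_attains_sup[of ?Z] z by auto
    have pos1: "?e ?U r x > 0" if "x > s1" for x
    proof (rule ccontr)
      assume neg': "\<not> ?e ?U r x > 0"
      have "x \<le> S" using large[of x] neg' by linarith
      then obtain y where "x \<le> y" "y \<le> S" "?e ?U r y = 0"
        using IVT'[of "?e ?U r" x 0 S, OF _ _ _ cont] large[of S] neg' by (auto simp: not_less less_imp_le)
      then show False using max[of y] s1 that by auto
    qed
    have s1s0: "s1 \<ge> s0" using s1 less.prems(1) by auto
    have zero: "?e ?U r s1 = 0" using s1 by simp
    have "?e ?U (Suc r) s1 > 0"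
      using less.prems(4)[OF s1s0] split[of s1] zero by simp
    moreover have "?e ?U (Suc r) s1 \<le> ?e ?U (Suc r) x" if "x \<ge> s1" for x
    proof (rule DERIV_nonneg_imp_nondecreasing[OF that])
      fix y assume "s1 \<le> y"
      then have "?e ?U r y \<ge> 0" using pos1[of y] zero by (cases "y = s1") auto
      then show "\<exists>D. (?e ?U (Suc r) has_real_derivative D) (at y) \<and> D \<ge> 0"
        using esym_has_derivative[OF fU, of b r y] by auto
    qed
    ultimately have posU: "?e ?U (Suc r) x > 0" if "x \<ge> s1" for x
      using that by (blast intro: less_le_trans)
    have "?e (?U - {l}) r s1 > 0" if "l \<in> ?U" for l
    proof (rule less.hyps[where s0 = s1])
      show "card ?U < card V" using less.prems(2,3) by (rule card_Diff1_less)
    qed (use posU that fU in auto)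
    moreover have "?U \<noteq> {}"
    proof
      assume "?U = {}"
      then have "{K. K \<subseteq> ?U \<and> card K = Suc r} = {}" by (simp only:) auto
      then have "?e ?U (Suc r) s1 = 0" unfolding esym_def by (simp only: sum.empty)
      then show False using posU[of s1] by simp
    qed
    \<comment> \<open>The sum of these positive values is a multiple of \<open>?e ?U r s1\<close>,
      which is zero.\<close>
    ultimately have "(\<Sum>l\<in>?U. ?e (?U - {l}) r s1) > 0"
      using fU by (intro sum_pos) auto
    then show False using sum_esym_remove[OF fU, of "\<lambda>a. b a + s1" r] zero by simp
  qed
qed

section \<open>A quadratic form on the subsets of fixed size\<close>

lemma sum_subsets_insert:
  assumes "finite U" "i \<in> U"
  shows "(\<Sum>K | K \<subseteq> U - {i} \<and> card K = r. f (insert i K))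
    = (\<Sum>K | K \<subseteq> U \<and> card K = Suc r. if i \<in> K then f K else 0)"
proof -
  have "(\<Sum>K | K \<subseteq> U - {i} \<and> card K = Suc r. if i \<in> K then f K else 0) = 0"
    by (intro sum.neutral) auto
  then show ?thesis
    using subsets_card_split[OF assms, of "\<lambda>K. if i \<in> K then f K else 0" r] by simp
qed

text \<open>The form \<open>pair_form\<close> for \<open>s = 0\<close> below, in the normalisation in which it satisfies a recursion in \<open>d\<close>.\<close>

definition overlap_form :: "('i \<Rightarrow> real) \<Rightarrow> 'i set \<Rightarrow> nat \<Rightarrow> ('i set \<Rightarrow> real) \<Rightarrow> real" where
  "overlap_form b V d m = (\<Sum>k\<in>V. b k *
    (\<Sum>K | K \<subseteq> V - {k} \<and> card K = d. \<Sum>L | L \<subseteq> V - {k} \<and> card L = d.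
      m K * m L / real (d + 1 - card (K \<inter> L))))"

text \<open>With c = |K \<inter> L|, (d+2)/(d+2-c) = 1 + c/(d+2-c). The 1 gives the squares of full
  sums. The factor c counts the common elements of \<open>K\<close> and \<open>L\<close>; removing
  one of them lowers both the size and c by one, so the denominator d+2-c is kept.\<close>

lemma overlap_form_rec:
  assumes fV: "finite V"
  shows "real (d + 2) * overlap_form b V (Suc d) m
    = (\<Sum>k\<in>V. b k * (\<Sum>K | K \<subseteq> V - {k} \<and> card K = Suc d. m K)\<^sup>2)
    + (\<Sum>k\<in>V. overlap_form b (V - {k}) d (\<lambda>K. m (insert k K)))"
proof -
  let ?g = "\<lambda>K L. m K * m L / real (d + 2 - card (K \<inter> L))"
  let ?S = "\<lambda>U r. {K. K \<subseteq> U \<and> card K = r}"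
  have inner: "(\<Sum>k\<in>U. \<Sum>K\<in>?S (U - {k}) d. \<Sum>L\<in>?S (U - {k}) d.
      m (insert k K) * m (insert k L) / real (d + 1 - card (K \<inter> L)))
    = (\<Sum>K\<in>?S U (Suc d). \<Sum>L\<in>?S U (Suc d). real (card (K \<inter> L)) * ?g K L)" if fU: "finite U" for U
  proof -
    have "(\<Sum>K\<in>?S (U - {k}) d. \<Sum>L\<in>?S (U - {k}) d.
        m (insert k K) * m (insert k L) / real (d + 1 - card (K \<inter> L)))
      = (\<Sum>K\<in>?S U (Suc d). \<Sum>L\<in>?S U (Suc d). if k \<in> K \<inter> L then ?g K L else 0)" if k: "k \<in> U" for k
    proof -
      have "(\<Sum>K\<in>?S (U - {k}) d. \<Sum>L\<in>?S (U - {k}) d.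
          m (insert k K) * m (insert k L) / real (d + 1 - card (K \<inter> L)))
        = (\<Sum>K\<in>?S (U - {k}) d. \<Sum>L\<in>?S (U - {k}) d. ?g (insert k K) (insert k L))"
      proof (intro sum.cong refl)
        fix K L assume K: "K \<in> ?S (U - {k}) d" and L: "L \<in> ?S (U - {k}) d"
        have "insert k K \<inter> insert k L = insert k (K \<inter> L)" by auto
        moreover have "finite (K \<inter> L)" "k \<notin> K \<inter> L"
          using K fU finite_subset[of K U] by auto
        ultimately have "card (insert k K \<inter> insert k L) = Suc (card (K \<inter> L))" by simp
        then show "m (insert k K) * m (insert k L) / real (d + 1 - card (K \<inter> L))
          = ?g (insert k K) (insert k L)" by simp
      qed
      also have "\<dots> = (\<Sum>K\<in>?S U (Suc d). if k \<in> K then \<Sum>L\<in>?S (U - {k}) d. ?g K (insert k L) else 0)"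
        using sum_subsets_insert[OF fU k, where f = "\<lambda>K. \<Sum>L\<in>?S (U - {k}) d. ?g K (insert k L)" and r = d] .
      also have "\<dots> = (\<Sum>K\<in>?S U (Suc d). if k \<in> K then \<Sum>L\<in>?S U (Suc d). if k \<in> L then ?g K L else 0 else 0)"
        by (intro sum.cong refl if_cong sum_subsets_insert[OF fU k])
      also have "\<dots> = (\<Sum>K\<in>?S U (Suc d). \<Sum>L\<in>?S U (Suc d). if k \<in> K \<inter> L then ?g K L else 0)"
        by (intro sum.cong refl) (auto intro: sum.cong)
      finally show ?thesis .
    qed
    then have "(\<Sum>k\<in>U. \<Sum>K\<in>?S (U - {k}) d. \<Sum>L\<in>?S (U - {k}) d.
        m (insert k K) * m (insert k L) / real (d + 1 - card (K \<inter> L)))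
      = (\<Sum>k\<in>U. \<Sum>K\<in>?S U (Suc d). \<Sum>L\<in>?S U (Suc d). if k \<in> K \<inter> L then ?g K L else 0)"
      by (rule sum.cong[OF refl])
    also have "\<dots> = (\<Sum>K\<in>?S U (Suc d). \<Sum>L\<in>?S U (Suc d). \<Sum>k\<in>U. if k \<in> K \<inter> L then ?g K L else 0)"
      by (subst sum.swap) (intro sum.cong refl sum.swap)
    also have "\<dots> = (\<Sum>K\<in>?S U (Suc d). \<Sum>L\<in>?S U (Suc d). real (card (K \<inter> L)) * ?g K L)"
    proof (intro sum.cong refl)
      fix K L assume "K \<in> ?S U (Suc d)" "L \<in> ?S U (Suc d)"
      then have "U \<inter> (K \<inter> L) = K \<inter> L" by auto
      then show "(\<Sum>k\<in>U. if k \<in> K \<inter> L then ?g K L else 0) = real (card (K \<inter> L)) * ?g K L"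
        using fU by (simp only: sum.inter_restrict[symmetric] sum_constant)
    qed
    finally show ?thesis .
  qed
  have "(\<Sum>k\<in>V. overlap_form b (V - {k}) d (\<lambda>K. m (insert k K)))
      = (\<Sum>k\<in>V. \<Sum>l\<in>V - {k}. b l * (\<Sum>K\<in>?S (V - {k} - {l}) d. \<Sum>L\<in>?S (V - {k} - {l}) d.
          m (insert k K) * m (insert k L) / real (d + 1 - card (K \<inter> L))))"
    by (simp add: overlap_form_def)
  also have "\<dots> = (\<Sum>k\<in>V. \<Sum>l | l \<in> V \<and> k \<noteq> l. b l * (\<Sum>K\<in>?S (V - {k} - {l}) d. \<Sum>L\<in>?S (V - {k} - {l}) d.
          m (insert k K) * m (insert k L) / real (d + 1 - card (K \<inter> L))))"
    by (intro sum.cong refl) auto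
  also have "\<dots> = (\<Sum>l\<in>V. \<Sum>k | k \<in> V \<and> k \<noteq> l. b l * (\<Sum>K\<in>?S (V - {k} - {l}) d. \<Sum>L\<in>?S (V - {k} - {l}) d.
          m (insert k K) * m (insert k L) / real (d + 1 - card (K \<inter> L))))"
    using fV by (intro sum.swap_restrict)
  also have "\<dots> = (\<Sum>l\<in>V. b l * (\<Sum>k\<in>V - {l}. \<Sum>K\<in>?S (V - {l} - {k}) d. \<Sum>L\<in>?S (V - {l} - {k}) d.
          m (insert k K) * m (insert k L) / real (d + 1 - card (K \<inter> L))))"
    unfolding sum_distrib_left[symmetric]
    by (intro sum.cong refl arg_cong2[of _ _ _ _ "(*)"]) (auto simp: insert_commute Diff_insert2[symmetric])
  also have "\<dots> = (\<Sum>l\<in>V. b l * (\<Sum>K\<in>?S (V - {l}) (Suc d). \<Sum>L\<in>?S (V - {l}) (Suc d). real (card (K \<inter> L)) * ?g K L))"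
    by (simp only: inner[OF finite_Diff[OF fV]])
  finally have second: "(\<Sum>k\<in>V. overlap_form b (V - {k}) d (\<lambda>K. m (insert k K))) = \<dots>" .
  have first: "(\<Sum>k\<in>V. b k * (\<Sum>K\<in>?S (V - {k}) (Suc d). m K)\<^sup>2)
     = (\<Sum>k\<in>V. b k * (\<Sum>K\<in>?S (V - {k}) (Suc d). \<Sum>L\<in>?S (V - {k}) (Suc d). m K * m L))"
    by (simp add: power2_eq_square sum_product)
  have combine: "real (d + 2) * ?g K L = m K * m L + real (card (K \<inter> L)) * ?g K L"
    if "K \<in> ?S (V - {k}) (Suc d)" for K L k
  proof -
    have "finite K" using that fV by (auto intro: finite_subset)
    then have "card (K \<inter> L) \<le> Suc d" using that card_mono[of K "K \<inter> L"] by auto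
    then have "real (d + 2 - card (K \<inter> L)) = real (d + 2) - real (card (K \<inter> L))"
      "real (d + 2) - real (card (K \<inter> L)) \<noteq> 0" by auto
    then show ?thesis by (simp only: field_simps) (simp add: field_simps)
  qed
  have "real (d + 2) * overlap_form b V (Suc d) m
      = (\<Sum>k\<in>V. b k * (\<Sum>K\<in>?S (V - {k}) (Suc d). \<Sum>L\<in>?S (V - {k}) (Suc d). real (d + 2) * ?g K L))"
    unfolding overlap_form_def sum_distrib_left by (simp add: mult.left_commute)
  also have "\<dots> = (\<Sum>k\<in>V. b k * (\<Sum>K\<in>?S (V - {k}) (Suc d). \<Sum>L\<in>?S (V - {k}) (Suc d).
      m K * m L + real (card (K \<inter> L)) * ?g K L))"
    by (intro sum.cong refl arg_cong2[of _ _ _ _ "(*)"] combine)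
  also have "\<dots> = (\<Sum>k\<in>V. b k * (\<Sum>K\<in>?S (V - {k}) (Suc d). m K)\<^sup>2)
    + (\<Sum>k\<in>V. overlap_form b (V - {k}) d (\<lambda>K. m (insert k K)))"
    unfolding first second by (simp only: sum.distrib distrib_left)
  finally show ?thesis .
qed

text \<open>The difference is a perfect square divided by \<open>\<alpha> + \<beta>\<close>. Hence
  one of the two weights may be negative, as is necessary for negative entries of
  \<open>b\<close>.\<close>

lemma parallel_sum_bound:
  fixes \<alpha> \<beta> y z :: real
  assumes "\<alpha> + \<beta> > 0"
  shows "\<alpha> * y\<^sup>2 + \<beta> * z\<^sup>2 \<ge> \<alpha> * \<beta> / (\<alpha> + \<beta>) * (y + z)\<^sup>2"
proof -
  have "\<alpha> * y\<^sup>2 + \<beta> * z\<^sup>2 - \<alpha> * \<beta> / (\<alpha> + \<beta>) * (y + z)\<^sup>2 = (\<alpha> * y - \<beta> * z)\<^sup>2 / (\<alpha> + \<beta>)"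
    using assms by (simp add: field_simps power2_eq_square)
  also have "\<dots> \<ge> 0" using assms by simp
  finally show ?thesis by simp
qed

text \<open>In the step to d+1, the total is split for each \<open>k\<close> into the sets without
  and with \<open>k\<close>, of weights \<open>b k\<close> and \<open>\<beta>\<close>. The recursion
  for e_(d+1) makes their parallel sum \<open>b k\<close> times e_(d+1)(V-k)/e_(d+1)(V), and
  summation over \<open>k\<close> gives (d+2) e_(d+2)(V)/e_(d+1)(V). All shifts
  \<open>s \<ge> 0\<close> are in the hypothesis because positivity at 0 alone would not pass to
  \<open>V - {k}\<close>.\<close>

lemma overlap_form_bound:
  assumes "finite V" "\<And>s. s \<ge> 0 \<Longrightarrow> esym (\<lambda>a. b a + s) V d > 0"
  shows "overlap_form b V d m \<ge> esym b V (d + 1) / esym b V d * (\<Sum>K | K \<subseteq> V \<and> card K = d. m K)\<^sup>2"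
  using assms
proof (induction d arbitrary: V m)
  case 0
  have e: "{K. K \<subseteq> U \<and> card K = 0} = {{}}" if "U \<subseteq> V" for U
    using 0(1) that by (auto dest: finite_subset)
  have "overlap_form b V 0 m = (\<Sum>k\<in>V. b k * (m {})\<^sup>2)"
    unfolding overlap_form_def by (intro sum.cong refl) (simp add: e power2_eq_square)
  also have "\<dots> = esym b V 1 * (m {})\<^sup>2"
    using sum_mult_esym_remove[OF 0(1), of b 0] 0(1) by (simp add: sum_distrib_right[symmetric])
  finally show ?case using 0(1) e[of V] by simp
next
  case (Suc d)
  let ?e = "esym b" and ?M = "\<Sum>K | K \<subseteq> V \<and> card K = Suc d. m K"
  have pos: "?e V (Suc d) > 0" using Suc.prems(2)[of 0] by simp
  have summand: "b k * (\<Sum>K | K \<subseteq> V - {k} \<and> card K = Suc d. m K)\<^sup>2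
      + overlap_form b (V - {k}) d (\<lambda>K. m (insert k K))
      \<ge> b k * ?e (V - {k}) (Suc d) / ?e V (Suc d) * ?M\<^sup>2" if k: "k \<in> V" for k
  proof -
    have posk: "esym (\<lambda>a. b a + s) (V - {k}) d > 0" if "s \<ge> 0" for s
      using esym_shift_positive_remove[OF that Suc.prems(1) k] Suc.prems(2) by blast
    define \<beta> where "\<beta> = ?e (V - {k}) (Suc d) / ?e (V - {k}) d"
    have p0: "?e (V - {k}) d > 0" using posk[of 0] by simp
    have sum: "b k + \<beta> = ?e V (Suc d) / ?e (V - {k}) d"
      using p0 esym_Suc[OF Suc.prems(1) k, of b d] by (simp add: \<beta>_def field_simps)
    have "overlap_form b (V - {k}) d (\<lambda>K. m (insert k K))
        \<ge> \<beta> * (\<Sum>K | K \<subseteq> V - {k} \<and> card K = d. m (insert k K))\<^sup>2"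
      using Suc.IH[of "V - {k}" "\<lambda>K. m (insert k K)"] posk Suc.prems(1) by (simp add: \<beta>_def)
    moreover have "b k + \<beta> > 0" using sum pos p0 by simp
    note parallel_sum_bound[OF this, of "\<Sum>K | K \<subseteq> V - {k} \<and> card K = Suc d. m K"
        "\<Sum>K | K \<subseteq> V - {k} \<and> card K = d. m (insert k K)"]
    moreover have "b k * \<beta> / (b k + \<beta>) = b k * ?e (V - {k}) (Suc d) / ?e V (Suc d)"
      unfolding sum using p0 pos by (simp add: \<beta>_def)
    ultimately show ?thesis
      using subsets_card_split[OF Suc.prems(1) k, of m d] by simp
  qed
  have "real (d + 2) * (?e V (d + 2) / ?e V (Suc d) * ?M\<^sup>2)
      = (\<Sum>k\<in>V. b k * ?e (V - {k}) (Suc d)) / ?e V (Suc d) * ?M\<^sup>2"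
    using sum_mult_esym_remove[OF Suc.prems(1), of b "Suc d"] by simp
  also have "\<dots> = (\<Sum>k\<in>V. b k * ?e (V - {k}) (Suc d) / ?e V (Suc d) * ?M\<^sup>2)"
    by (simp only: sum_divide_distrib sum_distrib_right)
  also have "\<dots> \<le> (\<Sum>k\<in>V. b k * (\<Sum>K | K \<subseteq> V - {k} \<and> card K = Suc d. m K)\<^sup>2
      + overlap_form b (V - {k}) d (\<lambda>K. m (insert k K)))"
    by (intro sum_mono summand)
  also have "\<dots> = real (d + 2) * overlap_form b V (Suc d) m"
    unfolding overlap_form_rec[OF Suc.prems(1)] by (rule sum.distrib)
  finally have "?e V (d + 2) / ?e V (Suc d) * ?M\<^sup>2 \<le> overlap_form b V (Suc d) m"
    by (rule mult_left_le_imp_le) simp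
  then show ?case by simp
qed

section \<open>Off-diagonal blocks of the quadratic form\<close>

text \<open>
  \<open>pair_form b d s V\<close> is the block of minors with rows \<open>I \<union> M\<close> and columns \<open>J \<union> M\<close>, where \<open>I\<close>, \<open>J\<close> are
  disjoint of size \<open>s\<close> and \<open>V\<close> is the complement of \<open>I \<union> J\<close>. In \<open>level_weight\<close> the truncated
  subtractions only matter for terms that vanish anyway.
\<close>

definition level_sum :: "nat \<Rightarrow> nat \<Rightarrow> ('i set \<Rightarrow> 'a::comm_monoid_add) \<Rightarrow> 'i set \<Rightarrow> 'a" where
  "level_sum d s m S = (\<Sum>M | M \<subseteq> S \<and> s + card M = d. m M)"

definition level_weight :: "nat \<Rightarrow> nat \<Rightarrow> nat \<Rightarrow> real" where
  "level_weight n d r = fact (n - r - 1) * fact (r - d)"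

definition pair_form :: "('m::finite \<Rightarrow> real) \<Rightarrow> nat \<Rightarrow> nat \<Rightarrow> 'm set \<Rightarrow> ('m set \<Rightarrow> real) \<Rightarrow> real" where
  "pair_form b d s V m = (\<Sum>S\<in>Pow V. level_weight CARD('m) d (s + card S)
      * ((\<Sum>i\<in>V - S. b i) + (\<Sum>i\<in>- V. b i) / 2) * (level_sum d s m S)\<^sup>2)"

lemma level_sum_if:
  fixes S :: "'i::finite set"
  shows "level_sum d s m S = (\<Sum>M\<in>Pow S. if s + card M = d then m M else 0)"
  by (simp add: level_sum_def sum.inter_filter[symmetric] Pow_def)

lemma sum_Pow_insert:
  assumes "finite A" "x \<notin> A"
  shows "(\<Sum>T\<in>Pow (insert x A). f T) = (\<Sum>T\<in>Pow A. f T) + (\<Sum>T\<in>Pow A. f (insert x T))"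
proof -
  have inj: "inj_on (insert x) (Pow A)" using assms by (auto simp: inj_on_def)
  have "(\<Sum>T\<in>Pow A \<union> insert x ` Pow A. f T) = (\<Sum>T\<in>Pow A. f T) + (\<Sum>T\<in>insert x ` Pow A. f T)"
    using assms by (intro sum.union_disjoint) auto
  then show ?thesis by (simp add: Pow_insert sum.reindex[OF inj])
qed

text \<open>After expanding the squares, the product \<open>b k * m K * m L\<close> collects the
  weights of all \<open>S\<close> between \<open>K \<union> L\<close> and the complement of
  \<open>k\<close>. Their sum is (n-d)!/(|K \<union> L|-d+1), and |K \<union> L| - d = d - |K
  \<inter> L|.\<close>

lemma pair_form_overlap:
  fixes b :: "'m::finite \<Rightarrow> real"
  assumes d: "d < CARD('m)"
  shows "pair_form b d 0 UNIV m = fact (CARD('m) - d) * overlap_form b UNIV d m"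
proof -
  let ?n = "CARD('m)" and ?S = "\<lambda>U. {K. K \<subseteq> U \<and> card K = d}"
  have coeff: "(\<Sum>S | S \<subseteq> - {k} \<and> K \<union> L \<subseteq> S. level_weight ?n d (card S))
      = fact (?n - d) / real (d + 1 - card (K \<inter> L))"
    if K: "K \<in> ?S (- {k})" and L: "L \<in> ?S (- {k})" for k :: 'm and K L
  proof -
    have cU: "card (- {k}) = ?n - 1" by (simp add: Compl_eq_Diff_UNIV card_Diff_singleton)
    have KL: "K \<union> L \<subseteq> - {k}" "card K = d" "card L = d" using K L by auto
    have le: "card (K \<inter> L) \<le> d" using KL by (metis Int_lower1 card_mono finite)
    have cKL: "card (K \<union> L) + card (K \<inter> L) = d + d"
      using card_Un_Int[of K L] KL by simp
    have "(card (K \<union> L) - d + 1) * (\<Sum>S | K \<union> L \<subseteq> S \<and> S \<subseteq> - {k}.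
        fact (card (- {k}) - card S) * fact (card S - d)) = (fact (card (- {k}) - d + 1) :: nat)"
      using cKL le by (intro sum_fact_interval KL) auto
    moreover have "card (K \<union> L) - d + 1 = d + 1 - card (K \<inter> L)" using cKL le by linarith
    moreover have "card (- {k}) - d + 1 = ?n - d" using cU d by linarith
    ultimately have "(d + 1 - card (K \<inter> L)) * (\<Sum>S | K \<union> L \<subseteq> S \<and> S \<subseteq> - {k}.
        fact (card (- {k}) - card S) * fact (card S - d)) = (fact (?n - d) :: nat)"
      by (simp only:)
    then have "real ((d + 1 - card (K \<inter> L)) * (\<Sum>S | K \<union> L \<subseteq> S \<and> S \<subseteq> - {k}.
        fact (card (- {k}) - card S) * fact (card S - d))) = real (fact (?n - d))"
      by (rule arg_cong)
    then have "real (d + 1 - card (K \<inter> L)) * (\<Sum>S | K \<union> L \<subseteq> S \<and> S \<subseteq> - {k}.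
        fact (card (- {k}) - card S) * fact (card S - d)) = fact (?n - d)"
      by (simp only: of_nat_mult of_nat_sum of_nat_fact)
    moreover have "(\<Sum>S | S \<subseteq> - {k} \<and> K \<union> L \<subseteq> S. level_weight ?n d (card S))
       = (\<Sum>S | K \<union> L \<subseteq> S \<and> S \<subseteq> - {k}. fact (card (- {k}) - card S) * fact (card S - d))"
      unfolding cU level_weight_def by (intro sum.cong) (auto simp: diff_commute)
    moreover have "real (d + 1 - card (K \<inter> L)) \<noteq> 0" using le by simp
    ultimately show ?thesis by (simp only: eq_divide_eq if_False mult.commute) simp
  qed
  have "pair_form b d 0 UNIV m
      = (\<Sum>S\<in>Pow UNIV. \<Sum>k | k \<in> UNIV \<and> k \<notin> S. b k * (level_weight ?n d (card S) * (level_sum d 0 m S)\<^sup>2))"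
    by (simp add: pair_form_def sum_distrib_left sum_distrib_right set_diff_eq mult_ac)
  also have "\<dots> = (\<Sum>k\<in>UNIV. \<Sum>S | S \<in> Pow UNIV \<and> k \<notin> S. b k * (level_weight ?n d (card S) * (level_sum d 0 m S)\<^sup>2))"
    by (rule sum.swap_restrict) auto
  also have "\<dots> = (\<Sum>k\<in>UNIV. b k * (\<Sum>S | S \<subseteq> - {k}. level_weight ?n d (card S) * (level_sum d 0 m S)\<^sup>2))"
    by (simp add: sum_distrib_left subset_Compl_singleton)
  also have "\<dots> = (\<Sum>k\<in>UNIV. b k * (\<Sum>K\<in>?S (- {k}). \<Sum>L\<in>?S (- {k}).
      m K * m L * (fact (?n - d) / real (d + 1 - card (K \<inter> L)))))"
  proof (rule sum.cong[OF refl], rule arg_cong2[of _ _ _ _ "(*)", OF refl])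
    fix k :: 'm
    have "(\<Sum>S | S \<subseteq> - {k}. level_weight ?n d (card S) * (level_sum d 0 m S)\<^sup>2)
        = (\<Sum>S | S \<subseteq> - {k}. \<Sum>K\<in>?S (- {k}). \<Sum>L\<in>?S (- {k}).
            if K \<union> L \<subseteq> S then m K * m L * level_weight ?n d (card S) else 0)"
    proof (rule sum.cong[OF refl])
      fix S assume "S \<in> {S. S \<subseteq> - {k}}"
      then have S: "S \<subseteq> - {k}" by simp
      have "level_sum d 0 m S = (\<Sum>K\<in>?S (- {k}). if K \<subseteq> S then m K else 0)"
        unfolding level_sum_def using S by (auto simp: sum.inter_filter[symmetric] intro!: sum.cong)
      then have "(level_sum d 0 m S)\<^sup>2 = (\<Sum>K\<in>?S (- {k}). \<Sum>L\<in>?S (- {k}).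
          (if K \<subseteq> S then m K else 0) * (if L \<subseteq> S then m L else 0))"
        by (simp only: power2_eq_square) (rule sum_product)
      then show "level_weight ?n d (card S) * (level_sum d 0 m S)\<^sup>2 = (\<Sum>K\<in>?S (- {k}). \<Sum>L\<in>?S (- {k}).
            if K \<union> L \<subseteq> S then m K * m L * level_weight ?n d (card S) else 0)"
        by (simp only: sum_distrib_left) (intro sum.cong refl, simp)
    qed
    also have "\<dots> = (\<Sum>K\<in>?S (- {k}). \<Sum>L\<in>?S (- {k}). \<Sum>S | S \<subseteq> - {k}.
            if K \<union> L \<subseteq> S then m K * m L * level_weight ?n d (card S) else 0)"
      by (subst sum.swap) (intro sum.cong refl sum.swap)
    also have "\<dots> = (\<Sum>K\<in>?S (- {k}). \<Sum>L\<in>?S (- {k}).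
      m K * m L * (fact (?n - d) / real (d + 1 - card (K \<inter> L))))"
    proof (intro sum.cong refl)
      fix K L assume "K \<in> ?S (- {k})" "L \<in> ?S (- {k})"
      note c = coeff[OF this]
      have "(\<Sum>S | S \<subseteq> - {k}. if K \<union> L \<subseteq> S then m K * m L * level_weight ?n d (card S) else 0)
         = (\<Sum>S | S \<subseteq> - {k} \<and> K \<union> L \<subseteq> S. m K * m L * level_weight ?n d (card S))"
        by (subst sum.inter_filter[symmetric]) auto
      then show "(\<Sum>S | S \<subseteq> - {k}. if K \<union> L \<subseteq> S then m K * m L * level_weight ?n d (card S) else 0)
        = m K * m L * (fact (?n - d) / real (d + 1 - card (K \<inter> L)))"
        by (simp only: c[symmetric] sum_distrib_left)
    qed
    finally show "(\<Sum>S | S \<subseteq> - {k}. level_weight ?n d (card S) * (level_sum d 0 m S)\<^sup>2)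
      = (\<Sum>K\<in>?S (- {k}). \<Sum>L\<in>?S (- {k}).
          m K * m L * (fact (?n - d) / real (d + 1 - card (K \<inter> L))))" .
  qed
  also have "\<dots> = fact (?n - d) * overlap_form b UNIV d m"
    by (simp add: overlap_form_def sum_distrib_left Compl_eq_Diff_UNIV mult_ac)
  finally show ?thesis .
qed

text \<open>
  A vector on subsets of \<open>V\<close> is extended to \<open>V \<union> {p, q}\<close> antisymmetrically in \<open>p\<close> and \<open>q\<close>; the partial
  sums over sets containing neither or both of them cancel.
\<close>

lemma pair_form_extend:
  fixes b :: "'m::finite \<Rightarrow> real" and m :: "'m set \<Rightarrow> real"
  assumes pq: "p \<notin> V" "q \<notin> V" "p \<noteq> q"
  defines "m' \<equiv> (\<lambda>K. if p \<in> K \<and> q \<notin> K then m (K - {p}) else if q \<in> K \<and> p \<notin> K then - m (K - {q}) else 0)"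
  shows "pair_form b d s (insert p (insert q V)) m' = 2 * pair_form b d (Suc s) V m"
    and "level_sum d s m' (insert p (insert q V)) = 0"
proof -
  have pS: "p \<notin> S" "q \<notin> S" "p \<notin> insert q S" if "S \<subseteq> V" for S using that pq by auto
  have cards: "card (insert p S) = Suc (card S)" "card (insert q S) = Suc (card S)" if "S \<subseteq> V" for S
    using pS[OF that] by simp_all
  have m': "m' M = 0" "m' (insert p M) = m M" "m' (insert q M) = - m M" "m' (insert p (insert q M)) = 0"
    if "M \<subseteq> V" for M
    using pS[OF that] pq by (auto simp: m'_def)
  have L0: "level_sum d s m' S = 0" if "S \<subseteq> V" for S
    unfolding level_sum_def using that by (intro sum.neutral) (auto simp: m')
  have Lp: "level_sum d s m' (insert p S) = level_sum d (Suc s) m S" if "S \<subseteq> V" for S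
  proof -
    have "level_sum d s m' (insert p S) = level_sum d s m' S
        + (\<Sum>M\<in>Pow S. if s + card (insert p M) = d then m' (insert p M) else 0)"
      unfolding level_sum_if using pS[OF that] by (intro sum_Pow_insert) auto
    also have "(\<Sum>M\<in>Pow S. if s + card (insert p M) = d then m' (insert p M) else 0) = level_sum d (Suc s) m S"
      unfolding level_sum_if
    proof (rule sum.cong[OF refl])
      fix M assume "M \<in> Pow S"
      then have "M \<subseteq> V" using that by auto
      then show "(if s + card (insert p M) = d then m' (insert p M) else 0) = (if Suc s + card M = d then m M else 0)"
        by (simp add: m' cards)
    qed
    finally show ?thesis by (simp add: L0[OF that])
  qed
  have Lq: "level_sum d s m' (insert q S) = - level_sum d (Suc s) m S" if "S \<subseteq> V" for S
  proof -
    have "level_sum d s m' (insert q S) = level_sum d s m' S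
        + (\<Sum>M\<in>Pow S. if s + card (insert q M) = d then m' (insert q M) else 0)"
      unfolding level_sum_if using pS[OF that] by (intro sum_Pow_insert) auto
    also have "(\<Sum>M\<in>Pow S. if s + card (insert q M) = d then m' (insert q M) else 0) = - level_sum d (Suc s) m S"
      unfolding level_sum_if sum_negf[symmetric]
    proof (rule sum.cong[OF refl])
      fix M assume "M \<in> Pow S"
      then have "M \<subseteq> V" using that by auto
      then show "(if s + card (insert q M) = d then m' (insert q M) else 0) = - (if Suc s + card M = d then m M else 0)"
        by (simp add: m' cards)
    qed
    finally show ?thesis by (simp add: L0[OF that])
  qed
  have Lpq: "level_sum d s m' (insert p (insert q S)) = 0" if "S \<subseteq> V" for S
  proof -
    have "level_sum d s m' (insert p (insert q S)) = level_sum d s m' (insert q S)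
        + (\<Sum>M\<in>Pow (insert q S). if s + card (insert p M) = d then m' (insert p M) else 0)"
      unfolding level_sum_if using pS[OF that] by (intro sum_Pow_insert) auto
    also have "(\<Sum>M\<in>Pow (insert q S). if s + card (insert p M) = d then m' (insert p M) else 0)
        = (\<Sum>M\<in>Pow S. if s + card (insert p M) = d then m' (insert p M) else 0)
        + (\<Sum>M\<in>Pow S. if s + card (insert p (insert q M)) = d then m' (insert p (insert q M)) else 0)"
      using pS[OF that] by (intro sum_Pow_insert) auto
    also have "(\<Sum>M\<in>Pow S. if s + card (insert p (insert q M)) = d then m' (insert p (insert q M)) else 0) = 0"
      using that by (intro sum.neutral) (auto simp: m')
    also have "(\<Sum>M\<in>Pow S. if s + card (insert p M) = d then m' (insert p M) else 0) = level_sum d s m' (insert p S)"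
    proof -
      have "level_sum d s m' (insert p S) = level_sum d s m' S
        + (\<Sum>M\<in>Pow S. if s + card (insert p M) = d then m' (insert p M) else 0)"
        unfolding level_sum_if using pS[OF that] by (intro sum_Pow_insert) auto
      then show ?thesis by (simp add: L0[OF that])
    qed
    finally show ?thesis by (simp add: Lp[OF that] Lq[OF that])
  qed
  show "level_sum d s m' (insert p (insert q V)) = 0" by (simp add: Lpq)
  let ?V = "insert p (insert q V)"
  define T where "T = (\<lambda>S. level_weight CARD('m) d (s + card S)
      * ((\<Sum>i\<in>?V - S. b i) + (\<Sum>i\<in>- ?V. b i) / 2) * (level_sum d s m' S)\<^sup>2)"
  have "pair_form b d s ?V m' = (\<Sum>S\<in>Pow ?V. T S)"
    by (simp add: pair_form_def T_def)
  also have "\<dots> = (\<Sum>S\<in>Pow V. T S) + (\<Sum>S\<in>Pow V. T (insert q S)) + ((\<Sum>S\<in>Pow V. T (insert p S))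
      + (\<Sum>S\<in>Pow V. T (insert p (insert q S))))"
    using pq by (subst sum_Pow_insert, simp, simp)+ simp
  also have "\<dots> = (\<Sum>S\<in>Pow V. T S + T (insert q S) + (T (insert p S) + T (insert p (insert q S))))"
    by (simp only: sum.distrib)
  \<comment> \<open>Sets with \<open>p\<close> only see \<open>b q\<close>, sets with
    \<open>q\<close> only see \<open>b p\<close>. The sum \<open>b p + b q\<close> is twice the half
    with which \<open>p\<close> and \<open>q\<close>, being outside \<open>V\<close>, enter
    \<open>pair_form b d (Suc s) V m\<close>.\<close>
  also have "\<dots> = (\<Sum>S\<in>Pow V. 2 * (level_weight CARD('m) d (Suc s + card S)
      * ((\<Sum>i\<in>V - S. b i) + (\<Sum>i\<in>- V. b i) / 2) * (level_sum d (Suc s) m S)\<^sup>2))"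
  proof (rule sum.cong[OF refl])
    fix S assume "S \<in> Pow V"
    then have S: "S \<subseteq> V" by simp
    have "?V - insert p S = insert q (V - S)" "?V - insert q S = insert p (V - S)"
      using pq pS[OF S] by auto
    then have bs: "sum b (?V - insert p S) = b q + sum b (V - S)" "sum b (?V - insert q S) = b p + sum b (V - S)"
      using pq by simp_all
    have "- V = insert p (insert q (- ?V))" using pq by auto
    then have bV: "sum b (- V) = b p + (b q + sum b (- ?V))" using pq by simp
    have Tp: "T (insert p S) = level_weight CARD('m) d (Suc s + card S) * (b q + sum b (V - S) + sum b (- ?V) / 2)
        * (level_sum d (Suc s) m S)\<^sup>2"
      unfolding T_def by (simp only: bs Lp[OF S] cards[OF S] add_Suc_right add_Suc)
    have Tq: "T (insert q S) = level_weight CARD('m) d (Suc s + card S) * (b p + sum b (V - S) + sum b (- ?V) / 2)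
        * (level_sum d (Suc s) m S)\<^sup>2"
      unfolding T_def by (simp only: bs Lq[OF S] cards[OF S] add_Suc_right add_Suc power2_minus)
    have "T S = 0" "T (insert p (insert q S)) = 0"
      unfolding T_def by (simp_all only: L0[OF S] Lpq[OF S] power2_eq_square mult_zero_right)
    then show "T S + T (insert q S) + (T (insert p S) + T (insert p (insert q S)))
      = 2 * (level_weight CARD('m) d (Suc s + card S)
      * ((\<Sum>i\<in>V - S. b i) + (\<Sum>i\<in>- V. b i) / 2) * (level_sum d (Suc s) m S)\<^sup>2)"
      unfolding Tp Tq bV by (simp only: algebra_simps) (simp add: field_simps)
  qed
  finally show "pair_form b d s ?V m' = 2 * pair_form b d (Suc s) V m"
    by (simp add: pair_form_def sum_distrib_left)
qed

text \<open>Each step of the induction moves one pair of indices into \<open>V\<close>. The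
  antisymmetric extension has level sum 0 on the whole set, so the square with
  \<open>\<kappa>\<close> is lost at the first pair and the bound 0 remains for all
  \<open>s > 0\<close>.\<close>

lemma pair_form_bound:
  fixes b :: "'m::finite \<Rightarrow> real"
  assumes base: "\<And>m. pair_form b d 0 UNIV m \<ge> \<kappa> * (level_sum d 0 m UNIV)\<^sup>2"
    and "card (- V) = 2 * s"
  shows "pair_form b d s V m \<ge> (if s = 0 then \<kappa> * (level_sum d 0 m V)\<^sup>2 else 0)"
  using assms(2)
proof (induction s arbitrary: V m)
  case 0
  then have "V = UNIV" by auto
  then show ?case using base by simp
next
  case (Suc s)
  then obtain p where p: "p \<in> - V" by (metis card_eq_0_iff empty_iff equals0I mult_is_0 nat.distinct(1) zero_neq_numeral)
  have "card (- V - {p}) = Suc (2 * s)" using Suc.prems p by simp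
  then obtain q where q: "q \<in> - V - {p}" by (metis card_eq_0_iff equals0I nat.distinct(1))
  have pq: "p \<notin> V" "q \<notin> V" "p \<noteq> q" using p q by auto
  have "- insert p (insert q V) = - V - {p} - {q}" by auto
  then have c: "card (- insert p (insert q V)) = 2 * s"
    using \<open>card (- V - {p}) = Suc (2 * s)\<close> q by simp
  define m' where "m' = (\<lambda>K. if p \<in> K \<and> q \<notin> K then m (K - {p}) else if q \<in> K \<and> p \<notin> K then - m (K - {q}) else 0)"
  note ext = pair_form_extend(1)[OF pq, where b = b and m = m and d = d and s = s, folded m'_def]
    pair_form_extend(2)[OF pq, where m = m and d = d and s = s, folded m'_def]
  have "0 \<le> pair_form b d s (insert p (insert q V)) m'"
    using Suc.IH[OF c, of m'] ext(2) by (cases "s = 0") simp_all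
  then show ?case using ext(1) by simp
qed

section \<open>Sums of squares and the spectral theorem\<close>

lemma mconst_add: "mconst (a + b) = mconst a + mconst b"
  by (simp add: mconst_def single_add)

lemma mconst_mult: "mconst (a * b) = mconst a * mconst b"
  by (simp add: mconst_def mult_single)

lemma mconst_0 [simp]: "mconst 0 = 0" and mconst_1 [simp]: "mconst 1 = 1"
  by (simp_all add: mconst_def)

lemma mconst_sum: "mconst (sum f A) = (\<Sum>x\<in>A. mconst (f x))"
  by (induction A rule: infinite_finite_induct) (auto simp: mconst_add)

lemma mconst_uminus: "mconst (- a) = - mconst a"
  by (simp add: mconst_def single_uminus)

lemma mconst_of_nat: "mconst (of_nat n) = of_nat n"
  by (induction n) (auto simp: mconst_add)

lemma is_sos_0: "is_sos 0"
  unfolding is_sos_def by (rule exI[of _ "[]"]) simp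

lemma is_sos_add: "is_sos p \<Longrightarrow> is_sos q \<Longrightarrow> is_sos (p + q)"
  unfolding is_sos_def by (metis map_append sum_list_append)

lemma is_sos_sum: "(\<And>x. x \<in> A \<Longrightarrow> is_sos (f x)) \<Longrightarrow> is_sos (sum f A)"
  by (induction A rule: infinite_finite_induct) (auto intro: is_sos_add is_sos_0)

lemma is_sos_scale_square:
  fixes p :: "'n mpoly"
  assumes "c \<ge> 0"
  shows "is_sos (mconst c * p\<^sup>2)"
proof -
  have "(mconst c :: 'n mpoly) = (mconst (sqrt c))\<^sup>2"
    using assms by (simp add: power2_eq_square mconst_mult[symmetric])
  then show ?thesis
    unfolding is_sos_def by (intro exI[of _ "[mconst (sqrt c) * p]"]) (simp add: power_mult_distrib)
qed

lemma square_sum: "(\<Sum>k\<in>A. f k)\<^sup>2 = (\<Sum>k\<in>A. \<Sum>l\<in>A. f k * f l :: 'a::comm_semiring_1)"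
  by (simp add: power2_eq_square sum_product)

lemma is_sos_scale: "c \<ge> 0 \<Longrightarrow> is_sos p \<Longrightarrow> is_sos (mconst c * p)"
proof -
  assume c: "c \<ge> 0" and "is_sos p"
  then obtain qs where p: "p = (\<Sum>q\<leftarrow>qs. q ^ 2)" by (auto simp: is_sos_def)
  show ?thesis unfolding p
    by (induction qs) (auto simp: distrib_left intro: is_sos_add is_sos_0 is_sos_scale_square c)
qed

section \<open>Spectral theorem and simultaneous diagonalization\<close>

lemma linear_bounded_by_square_eq_0:
  fixes c C :: real
  assumes "\<And>t. 2 * t * c \<le> t\<^sup>2 * C"
  shows "c = 0"
proof (rule ccontr)
  assume c: "c \<noteq> 0"
  define D where "D = \<bar>C\<bar> + 1"
  have D: "D > 0" "C < D" by (auto simp: D_def)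
  have "2 * c\<^sup>2 / D \<le> c\<^sup>2 / D\<^sup>2 * C"
    using assms[of "c / D"] by (simp add: power_divide power2_eq_square)
  then have "2 * c\<^sup>2 * D \<le> c\<^sup>2 * C"
    using D by (simp add: field_simps power2_eq_square)
  then have "2 * D \<le> C" using c by (simp add: mult.assoc mult.left_commute[of 2])
  then show False using D by simp
qed

text \<open>Take a maximizer \<open>v\<close> of the quadratic form on the unit sphere of
  \<open>S\<close>. The first variation makes \<open>f v\<close> orthogonal to all \<open>w\<close>
  in \<open>S\<close> that are orthogonal to \<open>v\<close>. The residual
  \<open>f v - c *\<^sub>R v\<close> is such a \<open>w\<close>, and it follows that it is
  orthogonal to itself.\<close>

lemma self_adjoint_eigenvector:
  fixes f :: "'a::euclidean_space \<Rightarrow> 'a"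
  assumes lin: "linear f" and self: "\<And>x y. x \<bullet> f y = f x \<bullet> y"
    and S: "subspace S" and inv: "\<And>x. x \<in> S \<Longrightarrow> f x \<in> S" and nz: "S \<noteq> {0}"
  obtains v c where "v \<in> S" "norm v = 1" "f v = c *\<^sub>R v"
proof -
  let ?K = "S \<inter> sphere 0 1"
  obtain x0 where x0: "x0 \<in> S" "x0 \<noteq> 0" using nz S subspace_0 by blast
  have "(1 / norm x0) *\<^sub>R x0 \<in> ?K" using x0 S by (simp add: subspace_scale)
  then have "?K \<noteq> {}" by blast
  moreover have "compact ?K"
    using closed_subspace[OF S] compact_sphere by (rule closed_Int_compact)
  moreover have "continuous_on ?K (\<lambda>x. x \<bullet> f x)"
    by (intro continuous_intros linear_continuous_on lin[unfolded linear_conv_bounded_linear])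
  ultimately obtain v where v: "v \<in> ?K" and max: "\<And>x. x \<in> ?K \<Longrightarrow> x \<bullet> f x \<le> v \<bullet> f v"
    using continuous_attains_sup[of ?K "\<lambda>x. x \<bullet> f x"] by blast
  define c where "c = v \<bullet> f v"
  have vv: "v \<in> S" "v \<bullet> v = 1" "norm v = 1" using v by (auto simp: norm_eq_1)
  have bound: "x \<bullet> f x \<le> c * (x \<bullet> x)" if "x \<in> S" for x
  proof (cases "x = 0")
    case False
    then have "(1 / norm x) *\<^sub>R x \<in> ?K" using that S by (simp add: subspace_scale)
    from max[OF this] have "(x \<bullet> f x) / (norm x)\<^sup>2 \<le> c"
      by (simp add: c_def linear_cmul[OF lin] power2_eq_square)
    then show ?thesis using False by (simp add: pos_divide_le_eq dot_square_norm)
  qed (simp add: linear_0[OF lin])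
  have orth: "w \<bullet> f v = 0" if w: "w \<in> S" "w \<bullet> v = 0" for w
  proof (rule linear_bounded_by_square_eq_0)
    fix t :: real
    have "v + t *\<^sub>R w \<in> S" using w vv S by (simp add: subspace_add subspace_scale)
    from bound[OF this] have le: "(v + t *\<^sub>R w) \<bullet> f (v + t *\<^sub>R w) \<le> c * ((v + t *\<^sub>R w) \<bullet> (v + t *\<^sub>R w))" .
    have sw: "v \<bullet> f w = w \<bullet> f v" using self[of v w] inner_commute[of "f v" w] by simp
    have "(v + t *\<^sub>R w) \<bullet> f (v + t *\<^sub>R w) = c + 2 * t * (w \<bullet> f v) + t\<^sup>2 * (w \<bullet> f w)"
      by (simp add: linear_add[OF lin] linear_cmul[OF lin] inner_add_left inner_add_right sw c_def
          power2_eq_square algebra_simps)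
    moreover have "(v + t *\<^sub>R w) \<bullet> (v + t *\<^sub>R w) = 1 + t\<^sup>2 * (w \<bullet> w)"
      using w(2) inner_commute[of v w] vv(2)
      by (simp add: inner_add_left inner_add_right power2_eq_square)
    ultimately have "c + 2 * t * (w \<bullet> f v) + t\<^sup>2 * (w \<bullet> f w) \<le> c * (1 + t\<^sup>2 * (w \<bullet> w))"
      using le by (simp only:)
    then show "2 * t * (w \<bullet> f v) \<le> t\<^sup>2 * (c * (w \<bullet> w) - w \<bullet> f w)"
      by (simp add: algebra_simps)
  qed
  define r where "r = f v - c *\<^sub>R v"
  have "r \<in> S" using vv inv[of v] S by (simp add: r_def subspace_diff subspace_scale)
  moreover have rv: "r \<bullet> v = 0" using vv(2) inner_commute[of "f v" v] by (simp add: r_def inner_diff_left c_def)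
  ultimately have "r \<bullet> f v = 0" by (rule orth)
  then have "r \<bullet> (f v - c *\<^sub>R v) = 0" using rv by (simp add: inner_diff_right)
  then have "r \<bullet> r = 0" unfolding r_def[symmetric] .
  then have "f v = c *\<^sub>R v" by (simp add: r_def)
  then show ?thesis using that vv by blast
qed

text \<open>Self-adjointness keeps the orthogonal complement of an eigenvector within
  \<open>S\<close> invariant, so eigenvectors can be split off by induction on the
  dimension.\<close>

lemma self_adjoint_eigenbasis:
  fixes f :: "'a::euclidean_space \<Rightarrow> 'a"
  assumes lin: "linear f" and self: "\<And>x y. x \<bullet> f y = f x \<bullet> y"
    and "subspace S" and "\<And>x. x \<in> S \<Longrightarrow> f x \<in> S"
  shows "\<exists>B. pairwise orthogonal B \<and> (\<forall>v\<in>B. norm v = 1 \<and> (\<exists>c. f v = c *\<^sub>R v)) \<and> span B = S"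
  using assms(3,4)
proof (induction "dim S" arbitrary: S rule: less_induct)
  case less
  show ?case
  proof (cases "S = {0}")
    case True
    then show ?thesis by (intro exI[of _ "{}"]) auto
  next
    case False
    obtain v c where v: "v \<in> S" "norm v = 1" "f v = c *\<^sub>R v"
      using self_adjoint_eigenvector[OF lin self less.prems False] .
    let ?T = "{x \<in> S. v \<bullet> x = 0}"
    have T: "subspace ?T"
      using less.prems(1) by (auto simp: subspace_def inner_add_right)
    have vT: "v \<notin> ?T" using v by auto
    then have "?T \<subset> S" using v by blast
    then have "dim ?T < dim S"
      using span_eq_iff[THEN iffD2, OF T] span_eq_iff[THEN iffD2, OF less.prems(1)]
      by (intro dim_psubset) (simp only:)
    moreover have "f x \<in> ?T" if "x \<in> ?T" for x
      using that less.prems(2) v self[of v x] by simp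
    ultimately obtain B where B: "pairwise orthogonal B" "\<forall>v\<in>B. norm v = 1 \<and> (\<exists>c. f v = c *\<^sub>R v)" "span B = ?T"
      using less.hyps[of ?T] T by blast
    have BT: "B \<subseteq> ?T" using B(3) span_superset by blast
    have "pairwise orthogonal (insert v B)"
      unfolding pairwise_insert using B(1) BT by (auto simp: orthogonal_def inner_commute)
    moreover have "span (insert v B) = S"
    proof
      show "span (insert v B) \<subseteq> S"
        using v BT less.prems(1) by (intro span_minimal) auto
      show "S \<subseteq> span (insert v B)"
      proof
        fix x assume x: "x \<in> S"
        have "x - (v \<bullet> x) *\<^sub>R v \<in> ?T"
          using x v less.prems(1) by (auto simp: subspace_diff subspace_scale inner_diff_right norm_eq_1)
        then have "x - (v \<bullet> x) *\<^sub>R v \<in> span B" using B(3) by simp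
        then show "x \<in> span (insert v B)" by (auto simp: span_insert)
      qed
    qed
    ultimately show ?thesis using B(2) v by (intro exI[of _ "insert v B"]) auto
  qed
qed

lemma spectral_theorem:
  fixes G :: "real ^ 'n ^ 'n"
  assumes sym: "symmetric_matrix G"
  obtains U :: "real ^ 'n ^ 'n" and lam where "transpose U ** U = mat 1"
    and "transpose U ** G ** U = (\<chi> i j. if i = j then lam i else 0)"
proof -
  have "x \<bullet> (G *v y) = (G *v x) \<bullet> y" for x y
    using sym by (metis dot_lmul_matrix symmetric_matrix_def transpose_matrix_vector)
  then obtain B where B: "pairwise orthogonal B" "\<And>v. v \<in> B \<Longrightarrow> norm v = 1 \<and> (\<exists>c. G *v v = c *\<^sub>R v)"
      "span B = (UNIV :: (real ^ 'n) set)"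
    using self_adjoint_eigenbasis[of "(*v) G" UNIV] matrix_vector_mul_linear by (metis UNIV_I subspace_UNIV)
  have "0 \<notin> B" using B(2) by force
  then have ind: "independent B" using B(1) by (simp add: pairwise_orthogonal_independent)
  then have "card B = dim (UNIV :: (real ^ 'n) set)"
    using B(3) by (metis dim_eq_card_independent dim_span)
  then have "card B = CARD('n)" by simp
  moreover have "finite B" using ind by (rule independent_imp_finite)
  ultimately obtain e where e: "bij_betw e (UNIV :: 'n set) B"
    using finite_same_card_bij[of "UNIV :: 'n set" B] by auto
  have eB: "e j \<in> B" for j using e by (auto simp: bij_betw_def)
  define lam where "lam = (\<lambda>j. SOME c. G *v e j = c *\<^sub>R e j)"
  have lam: "G *v e j = lam j *\<^sub>R e j" for j
    unfolding lam_def by (rule someI_ex) (use B(2)[OF eB] in blast)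
  have ortho: "e i \<bullet> e j = (if i = j then 1 else 0)" for i j
  proof (cases "i = j")
    case True
    then show ?thesis using B(2)[OF eB[of j]] by (simp add: norm_eq_1)
  next
    case False
    then have "e i \<noteq> e j" using e by (auto simp: bij_betw_def inj_on_def)
    then have "orthogonal (e i) (e j)" using B(1) eB by (simp add: pairwise_def)
    then show ?thesis using False by (simp add: orthogonal_def)
  qed
  define U where "U = (\<chi> i j. e j $ i)"
  have "transpose U ** M ** U = (\<chi> i j. e i \<bullet> (M *v e j))" for M
  proof -
    have "(transpose U ** (M ** U)) $ i $ j = e i \<bullet> (M *v e j)" for i j
      by (simp add: U_def matrix_matrix_mult_def transpose_def inner_vec_def matrix_vector_mult_def)
    then show ?thesis by (simp add: vec_eq_iff matrix_mul_assoc)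
  qed
  note UMU = this
  have "transpose U ** U = mat 1"
    using UMU[of "mat 1"] unfolding matrix_mul_rid matrix_vector_mul_lid ortho by (simp only: mat_def)
  moreover have "transpose U ** G ** U = (\<chi> i j. if i = j then lam i else 0)"
    unfolding UMU by (simp add: lam ortho vec_eq_iff)
  ultimately show ?thesis by (rule that)
qed

lemma inner_conjugate:
  fixes U M :: "real ^ 'n ^ 'n"
  shows "x \<bullet> ((transpose U ** M ** U) *v x) = (U *v x) \<bullet> (M *v (U *v x))"
proof -
  have "(transpose U ** M ** U) *v x = transpose U *v (M *v (U *v x))"
    by (simp only: matrix_vector_mul_assoc matrix_mul_assoc)
  also have "\<dots> = (M *v (U *v x)) v* U" by (rule transpose_matrix_vector)
  finally show ?thesis by (simp only: inner_commute[of x] dot_lmul_matrix inner_commute[of "M *v _"])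
qed

lemma diagonal_entry_inner:
  "axis j 1 \<bullet> ((\<chi> i k. if i = k then c i else 0) *v axis j (1::real)) = c j"
  by (simp add: matrix_vector_mult_basis column_def inner_axis')

lemma diagonal_matrix_mult:
  "(\<chi> i j. if i = j then a i else 0) ** (\<chi> i j. if i = j then c i else 0)
    = ((\<chi> i j. if i = j then a i * c i else 0) :: real ^ 'n ^ 'n)"
proof -
  have "(\<Sum>k\<in>UNIV. (if i = k then a i else 0) * (if k = j then c k else 0)) = (if i = j then a i * c i else 0)"
    for i j :: 'n
  proof -
    have "(\<Sum>k\<in>UNIV. (if i = k then a i else 0) * (if k = j then c k else 0))
        = (\<Sum>k\<in>UNIV. if i = k then (if i = j then a i * c i else 0) else 0)"
      by (intro sum.cong refl) auto
    then show ?thesis by simp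
  qed
  then show ?thesis by (simp add: vec_eq_iff matrix_matrix_mult_def)
qed

text \<open>Scaling an orthonormal eigenbasis of \<open>E\<close> turns \<open>E\<close> into the
  identity. The second change of basis, which diagonalizes the transformed \<open>F\<close>, is
  orthogonal and keeps the identity.\<close>

lemma simultaneous_diagonalization:
  fixes E F :: "real ^ 'n ^ 'n"
  assumes E: "pos_definite E" and F: "symmetric_matrix F"
  obtains P :: "real ^ 'n ^ 'n" and b where "transpose P ** E ** P = mat 1"
    and "transpose P ** F ** P = (\<chi> i j. if i = j then b i else 0)"
proof -
  have "symmetric_matrix E" using E by (simp add: pos_definite_def)
  then obtain U :: "real ^ 'n ^ 'n" and lam where U: "transpose U ** U = mat 1"
      "transpose U ** E ** U = (\<chi> i j. if i = j then lam i else 0)"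
    by (rule spectral_theorem)
  have pos: "lam j > 0" for j
  proof -
    let ?v = "U *v axis j 1"
    have v: "transpose U *v ?v = axis j 1"
      by (simp only: matrix_vector_mul_assoc U matrix_vector_mul_lid)
    have nz: "?v \<noteq> 0"
    proof
      assume "?v = 0"
      then have "axis j (1::real) = 0" using v by (simp only: matrix_vector_mult_0_right)
      then show False by (simp add: axis_eq_0_iff)
    qed
    have "lam j = axis j 1 \<bullet> ((transpose U ** E ** U) *v axis j 1)"
      unfolding U(2) by (rule diagonal_entry_inner[symmetric])
    also have "\<dots> = ?v \<bullet> (E *v ?v)" by (rule inner_conjugate)
    finally show ?thesis using E nz by (simp add: pos_definite_def)
  qed
  define R where "R = U ** (\<chi> i j. if i = j then 1 / sqrt (lam i) else 0)"
  have R: "transpose R ** E ** R = mat 1"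
  proof -
    let ?D = "(\<chi> i j. if i = j then 1 / sqrt (lam i) else 0) :: real ^ 'n ^ 'n"
    have tD: "transpose ?D = ?D" by (auto simp: transpose_def vec_eq_iff)
    have "transpose R ** E ** R = ?D ** (transpose U ** E ** U) ** ?D"
      by (simp only: R_def matrix_transpose_mul tD matrix_mul_assoc)
    also have "\<dots> = mat 1"
    proof -
      have "1 / sqrt (lam i) * lam i * (1 / sqrt (lam i)) = 1" for i
        using pos[of i] by (simp add: field_simps)
      then show ?thesis unfolding U(2) diagonal_matrix_mult by (simp only: mat_def)
    qed
    finally show ?thesis .
  qed
  have "symmetric_matrix (transpose R ** F ** R)"
    using F by (simp only: symmetric_matrix_def matrix_transpose_mul matrix_mul_assoc transpose_transpose)
  then obtain V :: "real ^ 'n ^ 'n" and b where V: "transpose V ** V = mat 1"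
      "transpose V ** (transpose R ** F ** R) ** V = (\<chi> i j. if i = j then b i else 0)"
    by (rule spectral_theorem)
  have "transpose (R ** V) ** M ** (R ** V) = transpose V ** (transpose R ** M ** R) ** V" for M
    by (simp only: matrix_transpose_mul matrix_mul_assoc)
  note conj = this
  show ?thesis
    by (rule that[of "R ** V" b]) (simp_all only: conj R V matrix_mul_rid)
qed

section \<open>Sums of squares from nonnegative quadratic forms\<close>

lemma is_sos_Gram:
  fixes G :: "real ^ 'k ^ 'k" and \<mu> :: "'k \<Rightarrow> 'n mpoly"
  assumes sym: "symmetric_matrix G" and psd: "\<And>v. 0 \<le> v \<bullet> (G *v v)"
  shows "is_sos (\<Sum>k\<in>UNIV. \<Sum>l\<in>UNIV. mconst (G $ k $ l) * \<mu> k * \<mu> l)"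
proof -
  obtain U :: "real ^ 'k ^ 'k" and lam where U: "transpose U ** U = mat 1"
      "transpose U ** G ** U = (\<chi> i j. if i = j then lam i else 0)"
    using spectral_theorem[OF sym] .
  let ?D = "(\<chi> i j. if i = j then lam i else 0) :: real ^ 'k ^ 'k"
  have UU: "U ** transpose U = mat 1" using U(1) by (simp add: matrix_left_right_inverse)
  have nonneg: "lam j \<ge> 0" for j
  proof -
    let ?v = "U *v axis j 1"
    have "lam j = axis j 1 \<bullet> ((transpose U ** G ** U) *v axis j 1)"
      unfolding U(2) by (rule diagonal_entry_inner[symmetric])
    also have "\<dots> = ?v \<bullet> (G *v ?v)" by (rule inner_conjugate)
    finally show ?thesis using psd by simp
  qed
  have "G = U ** ?D ** transpose U"
  proof -
    have "U ** (transpose U ** G ** U) ** transpose U = (U ** transpose U) ** G ** (U ** transpose U)"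
      by (simp add: matrix_mul_assoc)
    then show ?thesis by (simp add: U(2) UU)
  qed
  then have G: "G $ k $ l = (\<Sum>j\<in>UNIV. lam j * U $ k $ j * U $ l $ j)" for k l
    by (simp add: matrix_matrix_mult_def transpose_def if_distrib[of "\<lambda>x. _ * x"] sum.delta mult_ac cong: if_cong)
  have "(\<Sum>k\<in>UNIV. \<Sum>l\<in>UNIV. mconst (G $ k $ l) * \<mu> k * \<mu> l)
      = (\<Sum>k\<in>UNIV. \<Sum>l\<in>UNIV. \<Sum>j\<in>UNIV. mconst (lam j) * ((mconst (U $ k $ j) * \<mu> k) * (mconst (U $ l $ j) * \<mu> l)))"
    by (simp add: G mconst_sum mconst_mult sum_distrib_left sum_distrib_right mult_ac)
  also have "\<dots> = (\<Sum>k\<in>UNIV. \<Sum>j\<in>UNIV. \<Sum>l\<in>UNIV. mconst (lam j) * ((mconst (U $ k $ j) * \<mu> k) * (mconst (U $ l $ j) * \<mu> l)))"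
    by (intro sum.cong refl sum.swap)
  also have "\<dots> = (\<Sum>j\<in>UNIV. \<Sum>k\<in>UNIV. \<Sum>l\<in>UNIV. mconst (lam j) * ((mconst (U $ k $ j) * \<mu> k) * (mconst (U $ l $ j) * \<mu> l)))"
    by (rule sum.swap)
  also have "\<dots> = (\<Sum>j\<in>UNIV. mconst (lam j) * (\<Sum>k\<in>UNIV. mconst (U $ k $ j) * \<mu> k)\<^sup>2)"
    by (simp only: square_sum sum_distrib_left)
  finally show ?thesis by (simp add: is_sos_sum is_sos_scale_square nonneg)
qed

text \<open>The passage from real inequalities to polynomials. Single weights \<open>w j\<close> may
  be negative; it is the nonnegativity of the whole form, expressed by its Gram matrix, that
  survives substituting the polynomials \<open>\<mu>\<close> for the variables.\<close>

lemma is_sos_nonneg_form: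
  fixes A :: "'j \<Rightarrow> 'k::finite \<Rightarrow> real" and \<mu> :: "'k \<Rightarrow> 'n mpoly"
  assumes fin: "finite J" and nonneg: "\<And>m. 0 \<le> (\<Sum>j\<in>J. w j * (\<Sum>k\<in>UNIV. A j k * m k)\<^sup>2)"
  shows "is_sos (\<Sum>j\<in>J. mconst (w j) * (\<Sum>k\<in>UNIV. mconst (A j k) * \<mu> k)\<^sup>2)"
proof -
  define G :: "real ^ 'k ^ 'k" where "G = (\<chi> k l. \<Sum>j\<in>J. w j * A j k * A j l)"
  have "symmetric_matrix G"
    by (simp add: symmetric_matrix_def transpose_def G_def vec_eq_iff mult_ac)
  moreover have "0 \<le> v \<bullet> (G *v v)" for v
  proof -
    have "v \<bullet> (G *v v) = (\<Sum>k\<in>UNIV. \<Sum>l\<in>UNIV. \<Sum>j\<in>J. w j * ((A j k * v $ k) * (A j l * v $ l)))"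
      by (simp add: G_def inner_vec_def matrix_vector_mult_def sum_distrib_left sum_distrib_right mult_ac)
    also have "\<dots> = (\<Sum>j\<in>J. \<Sum>k\<in>UNIV. \<Sum>l\<in>UNIV. w j * ((A j k * v $ k) * (A j l * v $ l)))"
      by (simp only: sum.swap[of _ J UNIV])
    also have "\<dots> = (\<Sum>j\<in>J. w j * (\<Sum>k\<in>UNIV. A j k * v $ k)\<^sup>2)"
      by (simp only: square_sum sum_distrib_left)
    finally show ?thesis using nonneg by simp
  qed
  ultimately have "is_sos (\<Sum>k\<in>UNIV. \<Sum>l\<in>UNIV. mconst (G $ k $ l) * \<mu> k * \<mu> l)"
    by (rule is_sos_Gram)
  also have "(\<Sum>k\<in>UNIV. \<Sum>l\<in>UNIV. mconst (G $ k $ l) * \<mu> k * \<mu> l)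
      = (\<Sum>k\<in>UNIV. \<Sum>l\<in>UNIV. \<Sum>j\<in>J. mconst (w j) * ((mconst (A j k) * \<mu> k) * (mconst (A j l) * \<mu> l)))"
    by (simp add: G_def mconst_sum mconst_mult sum_distrib_left sum_distrib_right mult_ac)
  also have "\<dots> = (\<Sum>j\<in>J. \<Sum>k\<in>UNIV. \<Sum>l\<in>UNIV. mconst (w j) * ((mconst (A j k) * \<mu> k) * (mconst (A j l) * \<mu> l)))"
    by (simp only: sum.swap[of _ J UNIV])
  also have "\<dots> = (\<Sum>j\<in>J. mconst (w j) * (\<Sum>k\<in>UNIV. mconst (A j k) * \<mu> k)\<^sup>2)"
    by (simp only: square_sum sum_distrib_left)
  finally show ?thesis .
qed

section \<open>Evaluation and derivatives of polynomials\<close>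

lemma poly_mapping_sum_single: "p = (\<Sum>u\<in>Poly_Mapping.keys p. Poly_Mapping.single u (Poly_Mapping.lookup p u))"
proof (rule poly_mapping_eqI)
  fix k
  have "Poly_Mapping.lookup (\<Sum>u\<in>Poly_Mapping.keys p. Poly_Mapping.single u (Poly_Mapping.lookup p u)) k
      = (\<Sum>u\<in>Poly_Mapping.keys p. if u = k then Poly_Mapping.lookup p k else 0)"
    unfolding lookup_sum by (intro sum.cong refl) (auto simp: lookup_single)
  then show "Poly_Mapping.lookup p k
      = Poly_Mapping.lookup (\<Sum>u\<in>Poly_Mapping.keys p. Poly_Mapping.single u (Poly_Mapping.lookup p u)) k"
    by (simp add: in_keys_iff)
qed

lemma additive_sum:
  fixes F :: "'a::ab_group_add \<Rightarrow> 'b::ab_group_add"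
  assumes "\<And>p q. F (p + q) = F p + F q"
  shows "F (sum f A) = (\<Sum>x\<in>A. F (f x))"
proof -
  have "F 0 = 0" using assms[of 0 0] by simp
  then show ?thesis by (induction A rule: infinite_finite_induct) (auto simp: assms)
qed

text \<open>Every polynomial is a sum of monomials, so an identity additive in both arguments only
  has to be checked on monomials. Multiplicativity of \<open>meval\<close> and the Leibniz rule are
  obtained in this way.\<close>

lemma mpoly_bilinear_eqI:
  fixes F G :: "'n mpoly \<Rightarrow> 'n mpoly \<Rightarrow> 'b::ab_group_add"
  assumes F: "\<And>p p' q. F (p + p') q = F p q + F p' q" "\<And>p q q'. F p (q + q') = F p q + F p q'"
    and G: "\<And>p p' q. G (p + p') q = G p q + G p' q" "\<And>p q q'. G p (q + q') = G p q + G p q'"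
    and single: "\<And>u c v d. F (Poly_Mapping.single u c) (Poly_Mapping.single v d)
      = G (Poly_Mapping.single u c) (Poly_Mapping.single v d)"
  shows "F p q = G p q"
proof -
  have expand: "H p q = (\<Sum>u\<in>Poly_Mapping.keys p. \<Sum>v\<in>Poly_Mapping.keys q.
      H (Poly_Mapping.single u (Poly_Mapping.lookup p u)) (Poly_Mapping.single v (Poly_Mapping.lookup q v)))"
    if H: "\<And>p p' q. H (p + p') q = H p q + H p' q" "\<And>p q q'. H p (q + q') = H p q + H p q'"
    for H :: "'n mpoly \<Rightarrow> 'n mpoly \<Rightarrow> 'b"
  proof -
    have "H p q = H (\<Sum>u\<in>Poly_Mapping.keys p. Poly_Mapping.single u (Poly_Mapping.lookup p u))
        (\<Sum>v\<in>Poly_Mapping.keys q. Poly_Mapping.single v (Poly_Mapping.lookup q v))"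
      using poly_mapping_sum_single[of p] poly_mapping_sum_single[of q] by simp
    then show ?thesis
      by (simp only: additive_sum[of "\<lambda>p. H p _", OF H(1)] additive_sum[of "H _", OF H(2)])
         (rule sum.swap)
  qed
  show ?thesis unfolding expand[of F, OF F] expand[of G, OF G] single by (rule refl)
qed

lemma meval_superset:
  assumes "finite A" "Poly_Mapping.keys p \<subseteq> A"
  shows "meval p x = (\<Sum>u\<in>A. Poly_Mapping.lookup p u * (\<Prod>i\<in>UNIV. (x $ i) ^ Poly_Mapping.lookup u i))"
  unfolding meval_def using assms by (intro sum.mono_neutral_left) (auto simp: in_keys_iff)

lemma meval_add: "meval (p + q) x = meval p x + meval q x"
proof -
  let ?A = "Poly_Mapping.keys p \<union> Poly_Mapping.keys q"
  have "Poly_Mapping.keys (p + q) \<subseteq> ?A" by (rule keys_add)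
  then show ?thesis
    by (simp add: meval_superset[of ?A] lookup_add sum.distrib distrib_right)
qed

lemma meval_single: "meval (Poly_Mapping.single u c) x = c * (\<Prod>i\<in>UNIV. (x $ i) ^ Poly_Mapping.lookup u i)"
  by (subst meval_superset[of "{u}"]) auto

lemma meval_mult: "meval (p * q) x = meval p x * meval q x"
  by (rule mpoly_bilinear_eqI)
     (simp_all add: meval_add meval_single mult_single distrib_left distrib_right lookup_add power_add prod.distrib)

lemma meval_mconst [simp]: "meval (mconst c) x = c"
  by (simp add: mconst_def meval_single)

lemma meval_mvar [simp]: "meval (mvar i) x = x $ i"
proof -
  have "(\<Prod>j\<in>UNIV. (x $ j) ^ Poly_Mapping.lookup (Poly_Mapping.single i 1) j)
      = (\<Prod>j\<in>UNIV. if j = i then x $ i else 1)"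
    by (intro prod.cong refl) (simp add: lookup_single when_def)
  then show ?thesis by (simp add: mvar_def meval_single)
qed

lemma meval_sum: "meval (sum f A) x = (\<Sum>a\<in>A. meval (f a) x)"
  by (rule additive_sum) (rule meval_add)

lemma mpderiv_superset:
  assumes "finite A" "Poly_Mapping.keys p \<subseteq> A"
  shows "mpderiv i p = (\<Sum>u\<in>A. Poly_Mapping.single (u - Poly_Mapping.single i 1)
       (of_nat (Poly_Mapping.lookup u i) * Poly_Mapping.lookup p u))"
  unfolding mpderiv_def using assms by (intro sum.mono_neutral_left) (auto simp: in_keys_iff)

lemma mpderiv_add: "mpderiv i (p + q) = mpderiv i p + mpderiv i q"
proof -
  let ?A = "Poly_Mapping.keys p \<union> Poly_Mapping.keys q"
  have "Poly_Mapping.keys (p + q) \<subseteq> ?A" by (rule keys_add)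
  then show ?thesis
    by (simp add: mpderiv_superset[of ?A] lookup_add sum.distrib distrib_left single_add)
qed

lemma mpderiv_single: "mpderiv i (Poly_Mapping.single u c)
    = Poly_Mapping.single (u - Poly_Mapping.single i 1) (of_nat (Poly_Mapping.lookup u i) * c)"
  by (subst mpderiv_superset[of "{u}"]) auto

text \<open>The assumption rules out truncation of the exponent. In the Leibniz rule the excluded
  case has coefficient 0.\<close>

lemma exponent_minus_add:
  assumes "Poly_Mapping.lookup u i \<noteq> (0::nat)"
  shows "u - Poly_Mapping.single i 1 + v = u + v - Poly_Mapping.single i 1"
  using assms by (intro poly_mapping_eqI) (auto simp: lookup_add lookup_minus lookup_single when_def)

lemma mpderiv_mult:
  fixes p q :: "'n mpoly"
  shows "mpderiv i (p * q) = mpderiv i p * q + p * mpderiv i q"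
proof (rule mpoly_bilinear_eqI[where F = "\<lambda>p q. mpderiv i (p * q)"
      and G = "\<lambda>p q. mpderiv i p * q + p * mpderiv i q"])
  fix u v :: "'n \<Rightarrow>\<^sub>0 nat" and c d :: real
  have 1: "Poly_Mapping.single (u - Poly_Mapping.single i 1) (of_nat (Poly_Mapping.lookup u i) * c) * Poly_Mapping.single v d
      = Poly_Mapping.single (u + v - Poly_Mapping.single i 1) (of_nat (Poly_Mapping.lookup u i) * c * d)"
    by (cases "Poly_Mapping.lookup u i = 0") (simp_all only: mult_single exponent_minus_add of_nat_0 mult_zero_left single_zero not_False_eq_True)
  have 2: "Poly_Mapping.single u c * Poly_Mapping.single (v - Poly_Mapping.single i 1) (of_nat (Poly_Mapping.lookup v i) * d)
      = Poly_Mapping.single (u + v - Poly_Mapping.single i 1) (c * (of_nat (Poly_Mapping.lookup v i) * d))"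
    by (cases "Poly_Mapping.lookup v i = 0")
       (simp_all only: mult_single exponent_minus_add add.commute[of u] of_nat_0 mult_zero_left mult_zero_right single_zero not_False_eq_True)
  show "mpderiv i (Poly_Mapping.single u c * Poly_Mapping.single v d)
      = mpderiv i (Poly_Mapping.single u c) * Poly_Mapping.single v d
      + Poly_Mapping.single u c * mpderiv i (Poly_Mapping.single v d)"
    unfolding mult_single[of u c v d] unfolding mpderiv_single 1 2 single_add[symmetric]
    by (simp add: lookup_add algebra_simps)
qed (simp_all add: mpderiv_add algebra_simps)

lemma mpderiv_mconst: "mpderiv i (mconst c) = 0"
  by (simp add: mconst_def mpderiv_single)

lemma mpderiv_mvar: "mpderiv i (mvar j) = (if i = j then 1 else 0)"
  by (simp add: mvar_def mpderiv_single lookup_single when_def)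

lemma dderiv_add: "dderiv v (p + q) = dderiv v p + dderiv v q"
  by (simp add: dderiv_def mpderiv_add distrib_left sum.distrib)

lemma dderiv_mult: "dderiv v (p * q) = dderiv v p * q + p * dderiv v q"
  by (simp add: dderiv_def mpderiv_mult distrib_left sum.distrib sum_distrib_left sum_distrib_right mult_ac)

lemma dderiv_mconst [simp]: "dderiv v (mconst c) = 0"
  by (simp add: dderiv_def mpderiv_mconst)

lemma dderiv_mvar [simp]: "dderiv v (mvar i) = mconst (v $ i)"
proof -
  have "dderiv v (mvar i) = (\<Sum>j\<in>UNIV. if j = i then mconst (v $ i) else 0)"
    unfolding dderiv_def by (intro sum.cong refl) (simp add: mpderiv_mvar)
  then show ?thesis by simp
qed

lemma dderiv_sum: "dderiv v (sum f A) = (\<Sum>a\<in>A. dderiv v (f a))"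
  by (rule additive_sum) (rule dderiv_add)

lemma dderiv_mconst_mult: "dderiv v (mconst c * p) = mconst c * dderiv v p"
  by (simp add: dderiv_mult)

lemma dderiv_pow_mconst_mult: "(dderiv v ^^ k) (mconst c * p) = mconst c * (dderiv v ^^ k) p"
  by (induction k) (simp_all add: dderiv_mconst_mult)

definition linear_form :: "('n::finite \<Rightarrow> real) \<Rightarrow> 'n mpoly" where
  "linear_form l = (\<Sum>i\<in>UNIV. mvar i * mconst (l i))"

lemma dderiv_linear_form: "dderiv v (linear_form l) = mconst (\<Sum>i\<in>UNIV. v $ i * l i)"
  by (simp add: linear_form_def dderiv_sum dderiv_mult mconst_sum mconst_mult)

lemma meval_linear_form: "meval (linear_form l) x = (\<Sum>i\<in>UNIV. x $ i * l i)"
  by (simp add: linear_form_def meval_sum meval_mult)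

section \<open>Derivatives of sums of principal minors\<close>

lemma minor_sum_0: "finite V \<Longrightarrow> minor_sum V 0 Y = 1"
proof -
  assume "finite V"
  then have "{S. S \<subseteq> V \<and> card S = 0} = {{}}" by (auto dest: finite_subset)
  then show ?thesis by (simp add: minor_sum_def)
qed

lemma minor_sum_card: "finite V \<Longrightarrow> minor_sum V (card V) Y = minor V Y"
proof -
  assume "finite V"
  then have "{S. S \<subseteq> V \<and> card S = card V} = {V}" by (auto dest: card_subset_eq)
  then show ?thesis by (simp add: minor_sum_def)
qed

lemma minor_sum_remove:
  assumes "finite V"
  shows "(\<Sum>i\<in>V. minor_sum (V - {i}) r Y) = of_nat (card V - r) * minor_sum V r Y"
proof -
  have "(\<Sum>i\<in>V. minor_sum (V - {i}) r Y) = (\<Sum>S | S \<subseteq> V \<and> card S = r. (\<Sum>i\<in>V - S. 1) * minor S Y)"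
    using sum_subsets_remove[OF assms, where g = "\<lambda>_. 1" and f = "\<lambda>S. minor S Y" and r = r]
    by (simp add: minor_sum_def)
  also have "\<dots> = (\<Sum>S | S \<subseteq> V \<and> card S = r. of_nat (card V - r) * minor S Y)"
    using assms by (intro sum.cong refl) (auto simp: card_Diff_subset finite_subset)
  finally show ?thesis by (simp add: minor_sum_def sum_distrib_left)
qed

text \<open>Each minor of size \<open>Suc r\<close> containing \<open>i\<close> contributes the
  minor without \<open>i\<close>, and every set of size \<open>r\<close> avoiding \<open>i\<close>
  arises exactly once in this way. The lemma serves the directions \<open>e\<close> and
  \<open>a\<close> alike, as both make the derivative of the matrix diagonal.\<close>

lemma minor_sum_derivation:
  fixes D :: "'a::comm_ring_1 \<Rightarrow> 'a"
  assumes fin: "finite V"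
    and Dadd: "\<And>x y. D (x + y) = D x + D y"
    and Dmul: "\<And>x y. D (x * y) = D x * y + x * D y"
    and DY: "\<And>r c. D (Y r c) = (if r = c then \<beta> r else 0)"
  shows "D (minor_sum V (Suc r) Y) = (\<Sum>i\<in>V. \<beta> i * minor_sum (V - {i}) r Y)"
proof -
  have "D (minor_sum V (Suc r) Y) = (\<Sum>S | S \<subseteq> V \<and> card S = Suc r. D (minor S Y))"
    unfolding minor_sum_def by (rule additive_sum) (rule Dadd)
  also have "\<dots> = (\<Sum>S | S \<subseteq> V \<and> card S = Suc r. \<Sum>i\<in>V. if i \<in> S then \<beta> i * minor (S - {i}) Y else 0)"
  proof (rule sum.cong[OF refl])
    fix S assume "S \<in> {S. S \<subseteq> V \<and> card S = Suc r}"
    then have S: "S \<subseteq> V" by simp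
    have "D (minor S Y) = (\<Sum>i\<in>S. \<beta> i * minor (S - {i}) Y)"
      using finite_subset[OF S fin] Dadd Dmul DY by (rule minor_derivation)
    also have "\<dots> = (\<Sum>i\<in>V. if i \<in> S then \<beta> i * minor (S - {i}) Y else 0)"
      using S fin by (simp add: sum.If_cases Int_absorb1)
    finally show "D (minor S Y) = \<dots>" .
  qed
  also have "\<dots> = (\<Sum>i\<in>V. \<Sum>S | S \<subseteq> V \<and> card S = Suc r. if i \<in> S then \<beta> i * minor (S - {i}) Y else 0)"
    by (rule sum.swap)
  also have "\<dots> = (\<Sum>i\<in>V. \<beta> i * minor_sum (V - {i}) r Y)"
  proof (rule sum.cong[OF refl])
    fix i assume i: "i \<in> V"
    have "(\<Sum>S | S \<subseteq> V \<and> card S = Suc r. if i \<in> S then \<beta> i * minor (S - {i}) Y else 0)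
        = (\<Sum>S | S \<subseteq> V - {i} \<and> card S = r. \<beta> i * minor (insert i S - {i}) Y)"
      by (rule sum_subsets_insert[OF fin i, symmetric])
    also have "\<dots> = (\<Sum>S | S \<subseteq> V - {i} \<and> card S = r. \<beta> i * minor S Y)"
    proof (rule sum.cong[OF refl])
      fix S assume "S \<in> {S. S \<subseteq> V - {i} \<and> card S = r}"
      then have "insert i S - {i} = S" by auto
      then show "\<beta> i * minor (insert i S - {i}) Y = \<beta> i * minor S Y" by simp
    qed
    finally show "(\<Sum>S | S \<subseteq> V \<and> card S = Suc r. if i \<in> S then \<beta> i * minor (S - {i}) Y else 0)
      = \<beta> i * minor_sum (V - {i}) r Y"
      by (simp add: minor_sum_def sum_distrib_left)
  qed
  finally show ?thesis .
qed

lemma minor_diagonal: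
  fixes b :: "'i \<Rightarrow> 'a::comm_ring_1"
  assumes "finite S"
  shows "minor S (\<lambda>r c. if r = c then b r else 0) = (\<Prod>a\<in>S. b a)"
proof -
  have zero: "minor K (\<lambda>r c. 0 :: 'a) = (if K = {} then 1 else 0)" if "finite K" for K :: "'i set"
    using that by (cases "K = {}") (simp_all add: minor_def power_0_left)
  have "minor S (\<lambda>r c. (if r = c then b r else 0) + 0)
      = (\<Sum>K\<in>Pow S. (\<Prod>a\<in>S - K. b a) * minor K (\<lambda>r c. 0))"
    using assms by (rule minor_diag_add)
  also have "\<dots> = (\<Sum>K\<in>Pow S. if K = {} then \<Prod>a\<in>S. b a else 0)"
  proof (rule sum.cong[OF refl])
    fix K assume "K \<in> Pow S"
    then have "finite K" using assms finite_subset by blast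
    then show "(\<Prod>a\<in>S - K. b a) * minor K (\<lambda>r c. 0) = (if K = {} then \<Prod>a\<in>S. b a else 0)"
      unfolding zero[OF \<open>finite K\<close>] by simp
  qed
  also have "\<dots> = (\<Prod>a\<in>S. b a)" using assms by simp
  finally show ?thesis by simp
qed

lemma meval_minor: "meval (minor S Y) x = minor S (\<lambda>r c. meval (Y r c) x)"
  using minor_hom[of "\<lambda>p. meval p x" S Y] meval_mconst[of 1 x] by (simp add: meval_mult meval_add)

lemma meval_minor_sum_diagonal:
  fixes Y :: "'m::finite \<Rightarrow> 'm \<Rightarrow> 'n::finite mpoly"
  assumes "\<And>r c. meval (Y r c) x = (if r = c then b r else 0)"
  shows "meval (minor_sum V r Y) x = esym b V r"
  by (simp add: minor_sum_def esym_def meval_sum meval_minor assms minor_diagonal)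

section \<open>The blocks of the Wronskian as sums of squares\<close>

lemma is_sos_pair_form:
  fixes b :: "'m::finite \<Rightarrow> real" and \<mu> :: "'m set \<Rightarrow> 'n mpoly"
  assumes bound: "\<And>m. \<kappa> * (level_sum d s m V)\<^sup>2 \<le> pair_form b d s V m"
  shows "is_sos ((\<Sum>S\<in>Pow V. mconst (level_weight CARD('m) d (s + card S)
      * ((\<Sum>i\<in>V - S. b i) + (\<Sum>i\<in>- V. b i) / 2)) * (level_sum d s \<mu> S)\<^sup>2)
      - mconst \<kappa> * (level_sum d s \<mu> V)\<^sup>2)"
proof -
  \<comment> \<open>\<open>None\<close> stands for the subtracted square, with weight
    \<open>- \<kappa>\<close>, and \<open>Some S\<close> for the square of the level sum over
    \<open>S\<close>. The assumed bound is then the nonnegativity of a single weighted family of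
    squares.\<close>
  define w where "w = (\<lambda>j. case j of None \<Rightarrow> - \<kappa>
    | Some S \<Rightarrow> level_weight CARD('m) d (s + card S) * ((\<Sum>i\<in>V - S. b i) + (\<Sum>i\<in>- V. b i) / 2))"
  define A where "A = (\<lambda>j (M :: 'm set). if M \<subseteq> (case j of None \<Rightarrow> V | Some S \<Rightarrow> S) \<and> s + card M = d then 1 else 0 :: real)"
  let ?J = "insert None (Some ` Pow V)"
  have real_rows: "(\<Sum>M\<in>UNIV. A j M * m M) = level_sum d s m (case j of None \<Rightarrow> V | Some S \<Rightarrow> S)" for j m
    by (simp add: A_def level_sum_def sum.inter_filter[symmetric] if_distrib[of "\<lambda>x. x * _"] cong: if_cong)
  have mpoly_rows: "(\<Sum>M\<in>UNIV. mconst (A j M) * \<mu> M) = level_sum d s \<mu> (case j of None \<Rightarrow> V | Some S \<Rightarrow> S)" for j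
  proof -
    have "(\<Sum>M\<in>UNIV. mconst (A j M) * \<mu> M)
        = (\<Sum>M\<in>UNIV. if M \<subseteq> (case j of None \<Rightarrow> V | Some S \<Rightarrow> S) \<and> s + card M = d then \<mu> M else 0)"
      by (intro sum.cong refl) (simp add: A_def)
    then show ?thesis by (simp add: level_sum_def sum.inter_filter[symmetric])
  qed
  have split: "(\<Sum>j\<in>?J. f j) = f None + (\<Sum>S\<in>Pow V. f (Some S))" for f :: "'m set option \<Rightarrow> 'c::comm_monoid_add"
    by (subst sum.insert) (auto simp: sum.reindex)
  have "is_sos (\<Sum>j\<in>?J. mconst (w j) * (\<Sum>M\<in>UNIV. mconst (A j M) * \<mu> M)\<^sup>2)"
  proof (rule is_sos_nonneg_form)
    fix m
    show "0 \<le> (\<Sum>j\<in>?J. w j * (\<Sum>M\<in>UNIV. A j M * m M)\<^sup>2)"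
      unfolding real_rows split using bound[of m] by (simp add: w_def pair_form_def)
  qed simp
  then show ?thesis
    unfolding mpoly_rows split by (simp add: w_def mconst_uminus)
qed

text \<open>A pair \<open>(P, Q)\<close> is determined by its two differences \<open>I\<close>,
  \<open>J\<close> and its intersection \<open>S\<close>. Fixing \<open>I\<close> and
  \<open>J\<close> collects the terms of one block.\<close>

lemma sum_equal_card_pairs:
  fixes f :: "'m::finite set \<Rightarrow> 'm set \<Rightarrow> 'a::comm_monoid_add"
  shows "(\<Sum>(P, Q)\<in>{(P, Q). card Q = card P}. f P Q)
    = (\<Sum>(I, J)\<in>{(I, J). I \<inter> J = {} \<and> card I = card J}. \<Sum>S\<in>Pow (- (I \<union> J)). f (I \<union> S) (J \<union> S))"
proof -
  let ?D = "{(I, J :: 'm set). I \<inter> J = {} \<and> card I = card J}"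
  let ?j = "\<lambda>x :: 'm set \<times> 'm set. ((fst x - snd x, snd x - fst x), fst x \<inter> snd x)"
  let ?i = "\<lambda>y :: ('m set \<times> 'm set) \<times> 'm set. (fst (fst y) \<union> snd y, snd (fst y) \<union> snd y)"
  have "(\<Sum>x\<in>{(P, Q). card Q = card P}. f (fst x) (snd x))
      = (\<Sum>y\<in>(SIGMA IJ:?D. Pow (- (fst IJ \<union> snd IJ))). f (fst (fst y) \<union> snd y) (snd (fst y) \<union> snd y))"
  proof (rule sum.reindex_bij_witness[where j = ?j and i = ?i])
    fix x :: "'m set \<times> 'm set" assume x: "x \<in> {(P, Q). card Q = card P}"
    have e: "(fst x - snd x) \<union> (fst x \<inter> snd x) = fst x" "(snd x - fst x) \<union> (fst x \<inter> snd x) = snd x" by auto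
    have "card (fst x - snd x) = card (snd x - fst x)" using x by (intro card_Diff_eq) auto
    then show "?j x \<in> (SIGMA IJ:?D. Pow (- (fst IJ \<union> snd IJ)))" by auto
    show "?i (?j x) = x" by (simp add: e)
    show "f (fst (fst (?j x)) \<union> snd (?j x)) (snd (fst (?j x)) \<union> snd (?j x)) = f (fst x) (snd x)"
      by (simp add: e)
  next
    fix y :: "('m set \<times> 'm set) \<times> 'm set"
    assume y: "y \<in> (SIGMA IJ:?D. Pow (- (fst IJ \<union> snd IJ)))"
    obtain I J S where [simp]: "y = ((I, J), S)" by (metis surj_pair)
    have IJS: "I \<inter> J = {}" "card I = card J" "S \<inter> I = {}" "S \<inter> J = {}" using y by auto
    have "card (I \<union> S) = card I + card S" "card (J \<union> S) = card J + card S"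
      using IJS card_Un_disjoint[of I S] card_Un_disjoint[of J S] by (simp_all add: Int_commute)
    then show "?i y \<in> {(P, Q). card Q = card P}" using IJS by simp
    have "(I \<union> S) - (J \<union> S) = I" "(J \<union> S) - (I \<union> S) = J" "(I \<union> S) \<inter> (J \<union> S) = S"
      using IJS by blast+
    then show "?j (?i y) = y"
      by (simp only: \<open>y = ((I, J), S)\<close> fst_conv snd_conv)
  qed
  also have "\<dots> = (\<Sum>IJ\<in>?D. \<Sum>S\<in>Pow (- (fst IJ \<union> snd IJ)). f (fst IJ \<union> S) (snd IJ \<union> S))"
    by (subst sum.Sigma) (auto simp: case_prod_beta)
  finally show ?thesis by (simp add: case_prod_beta)
qed

lemma off_minor_sum_commute:
  fixes X :: "'m::finite \<Rightarrow> 'm \<Rightarrow> 'a::comm_ring_1"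
  assumes sym: "\<And>r c. X r c = X c r" and card: "card Q = card P"
  shows "off_minor_sum d X Q P = off_minor_sum d X P Q"
proof -
  have c: "card (P - Q) = card (Q - P)" using card by (intro card_Diff_eq) auto
  have "off_minor X (Q - P) (P - Q) M = off_minor X (P - Q) (Q - P) M" if "M \<subseteq> P \<inter> Q" for M
    using that by (intro off_minor_commute sym c) auto
  then show ?thesis
    unfolding off_minor_sum_def c by (intro sum.cong) auto
qed

lemma off_minor_sum_eq_level_sum:
  assumes "I \<inter> J = {}" "S \<inter> (I \<union> J) = {}"
  shows "off_minor_sum d X (I \<union> S) (J \<union> S) = level_sum d (card I) (off_minor X I J) S"
proof -
  have "(I \<union> S) - (J \<union> S) = I" "(J \<union> S) - (I \<union> S) = J" "(I \<union> S) \<inter> (J \<union> S) = S"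
    using assms by blast+
  then show ?thesis by (simp only: off_minor_sum_def level_sum_def)
qed

lemma level_sum_off_minor_empty:
  "level_sum d 0 (off_minor X {} {}) (UNIV :: 'm::finite set) = minor_sum UNIV d X"
proof -
  have "swap_map {} {} c = (c :: 'm)" for c by (intro swap_map(3)) auto
  then show ?thesis by (simp add: level_sum_def minor_sum_def off_minor_def)
qed

text \<open>The identities of \<open>minor_sum_wronskian\<close> are added with the weights
  \<open>b i\<close>, symmetrized in \<open>P\<close> and \<open>Q\<close> and sorted into blocks.
  The subtracted square goes to the block with \<open>I\<close> and \<open>J\<close> empty, whose
  level sum over \<open>UNIV\<close> is the sum of all principal minors of size
  \<open>d\<close>.\<close>

lemma is_sos_minor_sum_wronskian:
  fixes b :: "'m::finite \<Rightarrow> real" and Y :: "'m \<Rightarrow> 'm \<Rightarrow> 'n mpoly"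
  assumes sym: "\<And>r c. Y r c = Y c r" and d: "d < CARD('m)"
    and bound: "\<And>m. \<kappa> * (level_sum d 0 m UNIV)\<^sup>2 \<le> pair_form b d 0 UNIV m"
  shows "is_sos (mconst (fact (CARD('m) - d)) * (\<Sum>i\<in>UNIV. mconst (b i) *
      (minor_sum UNIV d Y * minor_sum (- {i}) d Y
        - minor_sum UNIV (d + 1) Y * (if d = 0 then 0 else minor_sum (- {i}) (d - 1) Y)))
    - mconst \<kappa> * (minor_sum UNIV d Y)\<^sup>2)"
proof -
  let ?n = "CARD('m)"
  let ?W = "\<lambda>i. minor_sum UNIV d Y * minor_sum (- {i}) d Y
        - minor_sum UNIV (d + 1) Y * (if d = 0 then 0 else minor_sum (- {i}) (d - 1) Y)"
  let ?z = "off_minor_sum d Y" and ?w = "\<lambda>S :: 'm set. level_weight ?n d (card S)"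
  let ?D = "{(P, Q :: 'm set). card Q = card P}"
  let ?E = "{(I, J :: 'm set). I \<inter> J = {} \<and> card I = card J}"
  let ?C = "mconst \<kappa> * (minor_sum UNIV d Y)\<^sup>2"
  have small: "?z P Q = 0" if "\<not> d \<le> card P" for P Q
  proof -
    have "card (P - Q) + card M \<le> card P" if "M \<subseteq> P \<inter> Q" for M
    proof -
      have "card M \<le> card (P \<inter> Q)" using that by (simp add: card_mono)
      then show ?thesis using card_Int_Diff[of P Q] by simp
    qed
    then show ?thesis using that unfolding off_minor_sum_def by (intro sum.neutral) force
  qed
  have star: "mconst (fact (?n - d)) * ?W i
      = (\<Sum>P | i \<notin> P. mconst (?w P) * (\<Sum>Q | card Q = card P. (?z P Q)\<^sup>2))" for i
  proof -
    have "mconst (fact (?n - d)) * ?W i = of_nat (fact (?n - d)) * ?W i"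
      by (simp only: mconst_of_nat[symmetric] of_nat_fact)
    also have "\<dots> = (\<Sum>P | P \<subseteq> - {i} \<and> d \<le> card P. of_nat (fact (?n - card P - 1) * fact (card P - d))
        * (\<Sum>Q | card Q = card P. (?z P Q)\<^sup>2))"
      by (rule minor_sum_wronskian[OF sym d])
    also have "\<dots> = (\<Sum>P | P \<subseteq> - {i} \<and> d \<le> card P. mconst (?w P) * (\<Sum>Q | card Q = card P. (?z P Q)\<^sup>2))"
      unfolding level_weight_def by (simp only: mconst_of_nat[symmetric] of_nat_fact of_nat_mult)
    also have "\<dots> = (\<Sum>P | i \<notin> P. mconst (?w P) * (\<Sum>Q | card Q = card P. (?z P Q)\<^sup>2))"
    proof (rule sum.mono_neutral_left)
      show "\<forall>P\<in>{P. i \<notin> P} - {P. P \<subseteq> - {i} \<and> d \<le> card P}.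
          mconst (?w P) * (\<Sum>Q | card Q = card P. (?z P Q)\<^sup>2) = 0"
      proof
        fix P assume "P \<in> {P. i \<notin> P} - {P. P \<subseteq> - {i} \<and> d \<le> card P}"
        then have "\<not> d \<le> card P" by auto
        then show "mconst (?w P) * (\<Sum>Q | card Q = card P. (?z P Q)\<^sup>2) = 0"
          by (simp add: small)
      qed
    qed auto
    finally show ?thesis .
  qed
  have "mconst (fact (?n - d)) * (\<Sum>i\<in>UNIV. mconst (b i) * ?W i)
      = (\<Sum>i\<in>UNIV. mconst (b i) * (mconst (fact (?n - d)) * ?W i))"
    by (simp only: sum_distrib_left mult.left_commute)
  also have "\<dots> = (\<Sum>i\<in>UNIV. \<Sum>P | P \<in> UNIV \<and> i \<notin> P. mconst (b i) * (mconst (?w P) * (\<Sum>Q | card Q = card P. (?z P Q)\<^sup>2)))"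
    unfolding star by (simp only: sum_distrib_left UNIV_I simp_thms)
  also have "\<dots> = (\<Sum>P\<in>UNIV. \<Sum>i | i \<in> UNIV \<and> i \<notin> P. mconst (b i) * (mconst (?w P) * (\<Sum>Q | card Q = card P. (?z P Q)\<^sup>2)))"
    by (rule sum.swap_restrict) auto
  also have "\<dots> = (\<Sum>P\<in>UNIV. mconst (?w P * sum b (- P)) * (\<Sum>Q | card Q = card P. (?z P Q)\<^sup>2))"
  proof (rule sum.cong[OF refl])
    fix P :: "'m set"
    have "{i. i \<in> UNIV \<and> i \<notin> P} = - P" by auto
    then show "(\<Sum>i | i \<in> UNIV \<and> i \<notin> P. mconst (b i) * (mconst (?w P) * (\<Sum>Q | card Q = card P. (?z P Q)\<^sup>2)))
      = mconst (?w P * sum b (- P)) * (\<Sum>Q | card Q = card P. (?z P Q)\<^sup>2)"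
      by (simp only: sum_distrib_right[symmetric] mconst_sum mconst_mult mult.assoc mult.left_commute)
  qed
  also have "\<dots> = (\<Sum>P\<in>UNIV. \<Sum>Q | card Q = card P. mconst (?w P * sum b (- P)) * (?z P Q)\<^sup>2)"
    by (simp only: sum_distrib_left)
  also have "\<dots> = (\<Sum>(P, Q)\<in>?D. mconst (?w P * sum b (- P)) * (?z P Q)\<^sup>2)"
    by (subst sum.Sigma) (auto intro: sum.cong)
  finally have T: "mconst (fact (?n - d)) * (\<Sum>i\<in>UNIV. mconst (b i) * ?W i)
      = (\<Sum>(P, Q)\<in>?D. mconst (?w P * sum b (- P)) * (?z P Q)\<^sup>2)" (is "?T = _") .
  \<comment> \<open>Exchanging \<open>P\<close> and \<open>Q\<close> replaces the complement of the
    row set by that of the column set. In the average an index of \<open>I \<union> J\<close> lies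
    in exactly one of the two complements, which is the origin of the one half in
    \<open>pair_form\<close>.\<close>
  have swap: "(\<Sum>(P, Q)\<in>?D. mconst (?w P * sum b (- P)) * (?z P Q)\<^sup>2)
      = (\<Sum>(P, Q)\<in>?D. mconst (?w P * sum b (- Q)) * (?z P Q)\<^sup>2)"
    by (rule sum.reindex_bij_witness[where i = prod.swap and j = prod.swap])
       (auto simp: off_minor_sum_commute[OF sym])
  have "mconst (1 / 2) * (?T + ?T)
      = mconst (1 / 2) * ((\<Sum>(P, Q)\<in>?D. mconst (?w P * sum b (- P)) * (?z P Q)\<^sup>2)
        + (\<Sum>(P, Q)\<in>?D. mconst (?w P * sum b (- Q)) * (?z P Q)\<^sup>2))"
    unfolding T by (simp only: swap)
  also have "\<dots> = (\<Sum>(P, Q)\<in>?D. mconst (?w P * ((sum b (- P) + sum b (- Q)) / 2)) * (?z P Q)\<^sup>2)"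
  proof (subst sum.distrib[symmetric], subst sum_distrib_left, rule sum.cong[OF refl], clarify, (unfold prod.case)?)
    fix P Q :: "'m set"
    have "?w P * ((sum b (- P) + sum b (- Q)) / 2) = 1 / 2 * (?w P * sum b (- P) + ?w P * sum b (- Q))"
      by (simp add: algebra_simps)
    then show "mconst (1 / 2) * (mconst (?w P * sum b (- P)) * (?z P Q)\<^sup>2 + mconst (?w P * sum b (- Q)) * (?z P Q)\<^sup>2)
        = mconst (?w P * ((sum b (- P) + sum b (- Q)) / 2)) * (?z P Q)\<^sup>2"
      by (simp only: mconst_mult[of "1 / 2"] mconst_add distrib_right mult.assoc)
  qed
  finally have "mconst (1 / 2) * (?T + ?T)
      = (\<Sum>(P, Q)\<in>?D. mconst (?w P * ((sum b (- P) + sum b (- Q)) / 2)) * (?z P Q)\<^sup>2)" .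
  moreover have "mconst (1 / 2) * (?T + ?T) = ?T"
  proof -
    have "mconst (1 / 2) * (?T + ?T) = (mconst (1 / 2) + mconst (1 / 2)) * ?T"
      by (simp only: distrib_left distrib_right)
    also have "\<dots> = ?T" unfolding mconst_add[symmetric] by simp
    finally show ?thesis .
  qed
  ultimately have "?T = (\<Sum>(P, Q)\<in>?D. mconst (?w P * ((sum b (- P) + sum b (- Q)) / 2)) * (?z P Q)\<^sup>2)"
    by (simp only:)
  also have "\<dots> = (\<Sum>(I, J)\<in>?E. \<Sum>S\<in>Pow (- (I \<union> J)).
      mconst (?w (I \<union> S) * ((sum b (- (I \<union> S)) + sum b (- (J \<union> S))) / 2)) * (?z (I \<union> S) (J \<union> S))\<^sup>2)"
    by (rule sum_equal_card_pairs)
  also have "\<dots> = (\<Sum>(I, J)\<in>?E. \<Sum>S\<in>Pow (- (I \<union> J)). mconst (level_weight ?n d (card I + card S)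
      * (sum b (- (I \<union> J) - S) + sum b (- (- (I \<union> J))) / 2)) * (level_sum d (card I) (off_minor Y I J) S)\<^sup>2)"
  proof (rule sum.cong[OF refl], clarify, (unfold prod.case)?, rule sum.cong[OF refl])
    fix I J S :: "'m set"
    assume IJ: "I \<inter> J = {}" "card I = card J" and "S \<in> Pow (- (I \<union> J))"
    then have S: "S \<inter> (I \<union> J) = {}" by auto
    have "- (I \<union> S) = J \<union> (- (I \<union> J) - S)" "- (J \<union> S) = I \<union> (- (I \<union> J) - S)"
      using IJ S by auto
    then have "sum b (- (I \<union> S)) = sum b J + sum b (- (I \<union> J) - S)"
      "sum b (- (J \<union> S)) = sum b I + sum b (- (I \<union> J) - S)"
      by (auto intro!: sum.union_disjoint)
    moreover have "sum b (- (- (I \<union> J))) = sum b I + sum b J"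
      using IJ by (simp add: sum.union_disjoint)
    moreover have "card (I \<union> S) = card I + card S"
      using S by (intro card_Un_disjoint) auto
    ultimately show "mconst (?w (I \<union> S) * ((sum b (- (I \<union> S)) + sum b (- (J \<union> S))) / 2)) * (?z (I \<union> S) (J \<union> S))\<^sup>2
      = mconst (level_weight ?n d (card I + card S)
      * (sum b (- (I \<union> J) - S) + sum b (- (- (I \<union> J))) / 2)) * (level_sum d (card I) (off_minor Y I J) S)\<^sup>2"
      using off_minor_sum_eq_level_sum[OF IJ(1) S, of d Y] by (simp add: field_simps)
  qed
  finally have eq: "?T = (\<Sum>(I, J)\<in>?E. \<Sum>S\<in>Pow (- (I \<union> J)). mconst (level_weight ?n d (card I + card S)
      * (sum b (- (I \<union> J) - S) + sum b (- (- (I \<union> J))) / 2)) * (level_sum d (card I) (off_minor Y I J) S)\<^sup>2)" .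
  have delta: "(\<Sum>x\<in>?E. if x = ({}, {}) then ?C else 0) = ?C"
    by (subst sum.delta) auto
  have "?T - ?C = (\<Sum>x\<in>?E. (case x of (I, J) \<Rightarrow> \<Sum>S\<in>Pow (- (I \<union> J)). mconst (level_weight ?n d (card I + card S)
      * (sum b (- (I \<union> J) - S) + sum b (- (- (I \<union> J))) / 2)) * (level_sum d (card I) (off_minor Y I J) S)\<^sup>2)
      - (if x = ({}, {}) then ?C else 0))"
    unfolding sum_subtractf delta eq by (rule refl)
  also have "is_sos \<dots>"
  proof (intro is_sos_sum, clarify, (unfold prod.case)?)
    fix I J :: "'m set"
    assume IJ: "I \<inter> J = {}" "card I = card J"
    let ?V = "- (I \<union> J)"
    show "is_sos ((\<Sum>S\<in>Pow ?V. mconst (level_weight ?n d (card I + card S)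
      * (sum b (?V - S) + sum b (- ?V) / 2)) * (level_sum d (card I) (off_minor Y I J) S)\<^sup>2)
      - (if (I, J) = ({}, {}) then ?C else 0))"
    proof (cases "(I, J) = ({}, {})")
      case True
      then have e: "I = {}" "J = {}" by auto
      show ?thesis
        using is_sos_pair_form[OF bound, of "off_minor Y {} {}"]
        by (simp only: e Un_empty_left Compl_empty_eq card.empty if_True level_sum_off_minor_empty refl)
    next
      case False
      then have "card I \<noteq> 0" using IJ by auto
      moreover have "card (- ?V) = 2 * card I"
        using IJ by (simp add: card_Un_disjoint)
      ultimately have "0 * (level_sum d (card I) m ?V)\<^sup>2 \<le> pair_form b d (card I) ?V m" for m
        using pair_form_bound[OF bound, of ?V "card I" m] by simp
      from is_sos_pair_form[OF this, of "off_minor Y I J"] show ?thesis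
        by (simp only: if_not_P[OF False] mconst_0 mult_zero_left diff_zero)
    qed
  qed
  finally show ?thesis .
qed

section \<open>Proof of the theorem\<close>

lemma esym_uminus: "esym (\<lambda>a. - b a) V r = (- 1) ^ r * esym b V r"
proof -
  have "(\<Prod>a\<in>K. - b a) = (- 1) ^ card K * (\<Prod>a\<in>K. b a)" for K
    by (induction K rule: infinite_finite_induct) auto
  then show ?thesis by (simp add: esym_def sum_distrib_left)
qed

lemma continuous_on_esym_shift: "continuous_on A (\<lambda>s. esym (\<lambda>a. b a + s) V r)"
  unfolding esym_def by (intro continuous_intros)

lemma esym_shift_large:
  assumes "finite V" "r \<le> card V" "\<And>a. a \<in> V \<Longrightarrow> b a + s > 0"
  shows "esym (\<lambda>a. b a + s) V r > 0"
proof -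
  obtain K where "K \<subseteq> V" "card K = r"
    using obtain_subset_with_card_n[OF assms(2)] by blast
  then show ?thesis
    unfolding esym_def using assms by (intro sum_pos2[of _ K]) (auto intro!: prod_pos prod_nonneg less_imp_le)
qed

text \<open>For large shifts all \<open>b a + s\<close> are positive, and by the intermediate value
  theorem the sign cannot change without a zero.\<close>

lemma esym_shift_pos_of_nonzero:
  assumes fin: "finite V" and r: "r \<le> card V"
    and nz: "\<And>s. s > 0 \<Longrightarrow> esym (\<lambda>a. b a + s) V r \<noteq> 0" and s: "s > 0"
  shows "esym (\<lambda>a. b a + s) V r > 0"
proof (rule ccontr)
  assume neg: "\<not> esym (\<lambda>a. b a + s) V r > 0"
  define S where "S = s + (\<Sum>a\<in>V. \<bar>b a\<bar>)"
  have sS: "s \<le> S" by (simp add: S_def sum_nonneg)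
  have "b a + S > 0" if "a \<in> V" for a
  proof -
    have "\<bar>b a\<bar> \<le> (\<Sum>a\<in>V. \<bar>b a\<bar>)" using that fin by (intro member_le_sum) auto
    then show ?thesis using s unfolding S_def by linarith
  qed
  then have "esym (\<lambda>a. b a + S) V r > 0" using esym_shift_large[OF fin r] by blast
  then obtain z where "s \<le> z" "esym (\<lambda>a. b a + z) V r = 0"
    using IVT'[of "\<lambda>s. esym (\<lambda>a. b a + s) V r" s 0 S, OF _ _ sS continuous_on_esym_shift] neg
    by (auto simp: not_less)
  then show False using nz[of z] s by simp
qed

text \<open>Positivity in degree \<open>Suc r\<close> passes to degree \<open>r\<close> on every
  \<open>V - {i}\<close>, and these values add up to a positive multiple of the value on
  \<open>V\<close>.\<close>

lemma esym_shift_pos_pred: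
  assumes fin: "finite V" and r: "r < card V"
    and pos: "\<And>s. s > 0 \<Longrightarrow> esym (\<lambda>a. b a + s) V (Suc r) > 0" and s: "s > 0"
  shows "esym (\<lambda>a. b a + s) V r > 0"
proof -
  have "esym (\<lambda>a. b a + s) (V - {i}) r > 0" if "i \<in> V" for i
    by (rule esym_shift_positive_remove[where s0 = s]) (use fin that pos s in auto)
  moreover have "V \<noteq> {}" using r by auto
  ultimately have "(\<Sum>i\<in>V. esym (\<lambda>a. b a + s) (V - {i}) r) > 0"
    using fin by (intro sum_pos) auto
  then have "real (card V - r) * esym (\<lambda>a. b a + s) V r > 0"
    by (simp only: sum_esym_remove[OF fin])
  then show ?thesis using r by (simp add: zero_less_mult_iff)
qed

lemma nonneg_at_0:
  fixes f :: "real \<Rightarrow> real"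
  assumes cont: "continuous_on UNIV f" and pos: "\<And>s. s > 0 \<Longrightarrow> 0 \<le> f s"
  shows "0 \<le> f 0"
proof (rule tendsto_lowerbound)
  have "isCont f 0" using cont by (simp add: continuous_on_eq_continuous_at)
  then show "(f \<longlongrightarrow> f 0) (at_right 0)" by (simp add: isCont_def filterlim_at_split)
  show "\<forall>\<^sub>F s in at_right 0. 0 \<le> f s" using pos by (auto simp: eventually_at_right_less intro: eventually_at_rightI[of 0 1])
qed simp

text \<open>Here the value at shift 0 may vanish, as for \<open>a\<close> on the boundary of the
  cone. Replacing \<open>b\<close> by its shift by \<open>\<epsilon> > 0\<close> makes
  \<open>overlap_form_bound\<close> applicable, and the form is continuous in
  \<open>\<epsilon>\<close>.\<close>

lemma overlap_form_nonneg:
  assumes fin: "finite V" and d: "d < card V"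
    and pos: "\<And>s. s > 0 \<Longrightarrow> esym (\<lambda>a. b a + s) V (Suc d) > 0"
  shows "0 \<le> overlap_form b V d m"
proof -
  have "0 \<le> overlap_form (\<lambda>a. b a + \<epsilon>) V d m" if \<epsilon>: "\<epsilon> > 0" for \<epsilon>
  proof -
    have "esym (\<lambda>a. b a + \<epsilon> + s) V d > 0" if "s \<ge> 0" for s
      using esym_shift_pos_pred[where s = "\<epsilon> + s", OF fin d pos] that \<epsilon> by (simp add: add.assoc)
    from overlap_form_bound[OF fin this, of m]
    have "esym (\<lambda>a. b a + \<epsilon>) V (d + 1) / esym (\<lambda>a. b a + \<epsilon>) V d * (\<Sum>K | K \<subseteq> V \<and> card K = d. m K)\<^sup>2
        \<le> overlap_form (\<lambda>a. b a + \<epsilon>) V d m" .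
    moreover have "esym (\<lambda>a. b a + \<epsilon>) V (d + 1) > 0" "esym (\<lambda>a. b a + \<epsilon>) V d > 0"
      using pos[OF \<epsilon>] esym_shift_pos_pred[OF fin d pos \<epsilon>] by simp_all
    then have "0 \<le> esym (\<lambda>a. b a + \<epsilon>) V (d + 1) / esym (\<lambda>a. b a + \<epsilon>) V d * (\<Sum>K | K \<subseteq> V \<and> card K = d. m K)\<^sup>2"
      by simp
    ultimately show ?thesis by linarith
  qed
  moreover have "continuous_on UNIV (\<lambda>\<epsilon>. overlap_form (\<lambda>a. b a + \<epsilon>) V d m)"
    unfolding overlap_form_def by (intro continuous_intros)
  ultimately show ?thesis using nonneg_at_0[of "\<lambda>\<epsilon>. overlap_form (\<lambda>a. b a + \<epsilon>) V d m"] by simp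
qed

section \<open>Derivatives and Wronskian in the diagonalizing coordinates\<close>

lemma dderiv_minor_sum:
  fixes Y :: "'m::finite \<Rightarrow> 'm \<Rightarrow> 'n::finite mpoly"
  assumes "\<And>r c. dderiv v (Y r c) = (if r = c then mconst (\<beta> r) else 0)"
  shows "dderiv v (minor_sum V (Suc r) Y) = (\<Sum>i\<in>V. mconst (\<beta> i) * minor_sum (V - {i}) r Y)"
  by (rule minor_sum_derivation[OF finite dderiv_add dderiv_mult assms])

lemma dderiv_minor_sum_unit:
  fixes Y :: "'m::finite \<Rightarrow> 'm \<Rightarrow> 'n::finite mpoly"
  assumes "\<And>r c. dderiv v (Y r c) = (if r = c then 1 else 0)"
  shows "dderiv v (minor_sum V (Suc r) Y) = mconst (real (card V - r)) * minor_sum V r Y"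
proof -
  have "dderiv v (minor_sum V (Suc r) Y) = (\<Sum>i\<in>V. mconst 1 * minor_sum (V - {i}) r Y)"
    by (rule dderiv_minor_sum) (simp add: assms)
  then show ?thesis by (simp add: minor_sum_remove mconst_of_nat)
qed

text \<open>Each derivative lowers the size of the minors by one. A minor of the new size arises
  once for every index outside it, and these counts 1, 2, ..., k multiply to the factorial.\<close>

lemma dderiv_power_minor_sum:
  fixes Y :: "'m::finite \<Rightarrow> 'm \<Rightarrow> 'n::finite mpoly"
  assumes "\<And>r c. dderiv v (Y r c) = (if r = c then 1 else 0)" "k \<le> CARD('m)"
  shows "(dderiv v ^^ k) (minor UNIV Y) = mconst (fact k) * minor_sum UNIV (CARD('m) - k) Y"
  using assms(2)
proof (induction k)
  case 0
  then show ?case using minor_sum_card[of "UNIV :: 'm set" Y] by simp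
next
  case (Suc k)
  then obtain r where r: "CARD('m) = Suc (k + r)" by (metis add_Suc le_iff_add)
  have "(dderiv v ^^ Suc k) (minor UNIV Y) = dderiv v (mconst (fact k) * minor_sum UNIV (Suc r) Y)"
    using Suc r by simp
  also have "\<dots> = mconst (fact k) * (mconst (real (CARD('m) - r)) * minor_sum UNIV r Y)"
    unfolding dderiv_mconst_mult by (simp only: dderiv_minor_sum_unit[OF assms(1)])
  also have "\<dots> = mconst (fact (Suc k)) * minor_sum UNIV (CARD('m) - Suc k) Y"
    by (simp add: r mult.assoc[symmetric] mconst_mult[symmetric] mult.commute)
  finally show ?case .
qed

lemma matrix_conjugate_entry:
  fixes P M :: "'a::comm_semiring_1 ^ 'm ^ 'm"
  shows "(transpose P ** M ** P) $ r $ c = (\<Sum>k\<in>UNIV. \<Sum>l\<in>UNIV. P $ k $ r * M $ k $ l * P $ l $ c)"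
proof -
  have "(transpose P ** M ** P) $ r $ c = (\<Sum>l\<in>UNIV. \<Sum>k\<in>UNIV. P $ k $ r * M $ k $ l * P $ l $ c)"
    by (simp add: matrix_matrix_mult_def transpose_def sum_distrib_right)
  then show ?thesis by (subst sum.swap) simp
qed

text \<open>
  Used with the \<open>P\<close> that turns \<open>A(e)\<close> into the identity and \<open>A(a)\<close> into a diagonal matrix.
\<close>

definition conjugated_pencil :: "('n::finite \<Rightarrow> real ^ 'm ^ 'm) \<Rightarrow> real ^ 'm ^ 'm \<Rightarrow> 'm::finite \<Rightarrow> 'm \<Rightarrow> 'n mpoly" where
  "conjugated_pencil A P r c = linear_form (\<lambda>i. (transpose P ** A i ** P) $ r $ c)"

lemma conjugated_pencil_at:
  fixes P :: "real ^ 'm ^ 'm"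
  shows "(\<Sum>i\<in>UNIV. v $ i * (transpose P ** A i ** P) $ r $ c) = (transpose P ** pencil_at A v ** P) $ r $ c"
proof -
  have "(\<Sum>i\<in>UNIV. v $ i * (transpose P ** A i ** P) $ r $ c)
      = (\<Sum>i\<in>UNIV. \<Sum>k\<in>UNIV. \<Sum>l\<in>UNIV. P $ k $ r * (v $ i * A i $ k $ l) * P $ l $ c)"
    unfolding matrix_conjugate_entry by (simp add: sum_distrib_left mult_ac)
  also have "\<dots> = (\<Sum>k\<in>UNIV. \<Sum>l\<in>UNIV. \<Sum>i\<in>UNIV. P $ k $ r * (v $ i * A i $ k $ l) * P $ l $ c)"
    by (subst sum.swap) (intro sum.cong refl sum.swap)
  also have "\<dots> = (transpose P ** pencil_at A v ** P) $ r $ c"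
    unfolding matrix_conjugate_entry by (simp add: pencil_at_def sum_distrib_left sum_distrib_right mult_ac)
  finally show ?thesis .
qed

lemma dderiv_conjugated_pencil:
  "dderiv v (conjugated_pencil A P r c) = mconst ((transpose P ** pencil_at A v ** P) $ r $ c)"
  by (simp add: conjugated_pencil_def dderiv_linear_form conjugated_pencil_at)

lemma meval_conjugated_pencil:
  "meval (conjugated_pencil A P r c) x = (transpose P ** pencil_at A x ** P) $ r $ c"
  by (simp add: conjugated_pencil_def meval_linear_form conjugated_pencil_at)

lemma minor_conjugated_pencil:
  fixes A :: "'n::finite \<Rightarrow> real ^ 'm ^ 'm"
  shows "minor UNIV (conjugated_pencil A P) = mconst ((det P)\<^sup>2) * det (pencil A)"
proof -
  define C :: "'n mpoly ^ 'm ^ 'm" where "C = (\<chi> r c. mconst (P $ r $ c))"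
  have detC: "det C = mconst (det P)"
  proof -
    have "mconst (minor UNIV (\<lambda>r c. P $ r $ c)) = (minor UNIV (\<lambda>r c. mconst (P $ r $ c)) :: 'n mpoly)"
      by (rule minor_hom) (simp_all add: mconst_mult mconst_add)
    then show ?thesis by (simp add: minor_UNIV C_def)
  qed
  have "conjugated_pencil A P r c = (transpose C ** pencil A ** C) $ r $ c" for r c
  proof -
    have "conjugated_pencil A P r c = (\<Sum>i\<in>UNIV. \<Sum>k\<in>UNIV. \<Sum>l\<in>UNIV.
        mconst (P $ k $ r) * (mvar i * mconst (A i $ k $ l)) * mconst (P $ l $ c))"
      unfolding conjugated_pencil_def linear_form_def matrix_conjugate_entry
      by (simp add: mconst_sum mconst_mult sum_distrib_left mult_ac)
    also have "\<dots> = (\<Sum>k\<in>UNIV. \<Sum>l\<in>UNIV. \<Sum>i\<in>UNIV.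
        mconst (P $ k $ r) * (mvar i * mconst (A i $ k $ l)) * mconst (P $ l $ c))"
      by (subst sum.swap) (intro sum.cong refl sum.swap)
    also have "\<dots> = (transpose C ** pencil A ** C) $ r $ c"
      unfolding matrix_conjugate_entry
      by (simp add: pencil_def C_def sum_distrib_left sum_distrib_right)
    finally show ?thesis .
  qed
  then have "minor UNIV (conjugated_pencil A P) = det (transpose C ** pencil A ** C)"
    by (simp add: minor_UNIV)
  also have "\<dots> = mconst ((det P)\<^sup>2) * det (pencil A)"
    by (simp add: det_mul det_transpose detC mconst_mult power2_eq_square)
  finally show ?thesis .
qed

lemma dderiv_minor_sum_pred:
  fixes Y :: "'m::finite \<Rightarrow> 'm \<Rightarrow> 'n::finite mpoly"
  assumes "\<And>r c. dderiv v (Y r c) = (if r = c then 1 else 0)" "d < CARD('m)"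
  shows "dderiv v (minor_sum (- {i}) d Y)
    = mconst (real (CARD('m) - d)) * (if d = 0 then 0 else minor_sum (- {i}) (d - 1) Y)"
proof (cases d)
  case 0
  then show ?thesis using dderiv_mconst[of v 1] by (simp add: minor_sum_0)
next
  case (Suc d')
  have "card (- {i}) - d' = CARD('m) - d" using Suc by (simp add: Compl_eq_Diff_UNIV card_Diff_singleton)
  then show ?thesis using dderiv_minor_sum_unit[OF assms(1), of "- {i}" d'] Suc by simp
qed

lemma wronskian_minor_sum:
  fixes Y :: "'m::finite \<Rightarrow> 'm \<Rightarrow> 'n::finite mpoly"
  assumes De: "\<And>r c. dderiv e (Y r c) = (if r = c then 1 else 0)"
    and Da: "\<And>r c. dderiv a (Y r c) = (if r = c then mconst (b r) else 0)"
    and d: "d < CARD('m)" and h: "h = mconst \<gamma> * minor_sum UNIV (d + 1) Y"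
  shows "wronskian e a h = mconst (\<gamma>\<^sup>2 * real (CARD('m) - d)) * (\<Sum>i\<in>UNIV. mconst (b i) *
      (minor_sum UNIV d Y * minor_sum (- {i}) d Y
        - minor_sum UNIV (d + 1) Y * (if d = 0 then 0 else minor_sum (- {i}) (d - 1) Y)))"
proof -
  let ?N = "real (CARD('m) - d)"
  let ?s = "\<lambda>i. if d = 0 then 0 else minor_sum (- {i}) (d - 1) Y"
  define A1 where "A1 = (\<Sum>i\<in>UNIV. mconst (b i) * minor_sum (- {i}) d Y)"
  define A2 where "A2 = (\<Sum>i\<in>UNIV. mconst (b i) * ?s i)"
  have Deh: "dderiv e h = mconst \<gamma> * (mconst ?N * minor_sum UNIV d Y)"
    unfolding h dderiv_mconst_mult by (simp add: dderiv_minor_sum_unit[OF De])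
  have Dah: "dderiv a h = mconst \<gamma> * A1"
    unfolding h dderiv_mconst_mult A1_def by (simp add: dderiv_minor_sum[OF Da] Compl_eq_Diff_UNIV)
  have DeDa: "dderiv e (dderiv a h) = mconst \<gamma> * (mconst ?N * A2)"
    unfolding Dah dderiv_mconst_mult A1_def A2_def dderiv_sum dderiv_minor_sum_pred[OF De d]
    by (simp only: sum_distrib_left mult.left_commute)
  have W: "(\<Sum>i\<in>UNIV. mconst (b i) * (minor_sum UNIV d Y * minor_sum (- {i}) d Y - minor_sum UNIV (d + 1) Y * ?s i))
      = minor_sum UNIV d Y * A1 - minor_sum UNIV (d + 1) Y * A2"
    unfolding A1_def A2_def
    by (simp only: right_diff_distrib sum_subtractf sum_distrib_left mult.left_commute)
  have "wronskian e a h = mconst \<gamma> * (mconst ?N * minor_sum UNIV d Y) * (mconst \<gamma> * A1)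
      - mconst \<gamma> * minor_sum UNIV (d + 1) Y * (mconst \<gamma> * (mconst ?N * A2))"
    unfolding wronskian_def DeDa unfolding Deh Dah unfolding h by (rule refl)
  also have "\<dots> = mconst (\<gamma>\<^sup>2 * ?N) * (minor_sum UNIV d Y * A1 - minor_sum UNIV (d + 1) Y * A2)"
    by (simp add: mconst_mult power2_eq_square algebra_simps)
  finally show ?thesis unfolding W .
qed

theorem corollary6p6:
  fixes A :: "'n::finite \<Rightarrow> real ^ 'm ^ 'm"
    and e :: "real ^ 'n" and k :: nat and h :: "'n mpoly"
  assumes "\<And>i. symmetric_matrix (A i)"
    and "pos_definite (pencil_at A e)"
    and "k \<le> CARD('m)"
    and "h = (dderiv e ^^ k) (det (pencil A))"
  shows "(\<forall>a \<in> hyperbolicity_cone h e. meval (dderiv e h) a \<noteq> 0 \<longrightarrow>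
            is_sos (wronskian e a h
              - mconst (meval h a / meval (dderiv e h) a) * (dderiv e h) ^ 2))
       \<and> (\<forall>a \<in> hyperbolicity_cone h e. is_sos (wronskian e a h))"
proof -
  have "(meval (dderiv e h) a \<noteq> 0 \<longrightarrow> is_sos (wronskian e a h
      - mconst (meval h a / meval (dderiv e h) a) * (dderiv e h) ^ 2)) \<and> is_sos (wronskian e a h)"
    if cone: "a \<in> hyperbolicity_cone h e" for a
  proof -
    have "symmetric_matrix (pencil_at A a)"
      using assms(1) by (simp add: symmetric_matrix_def pencil_at_def transpose_def vec_eq_iff)
    with assms(2) obtain P :: "real ^ 'm ^ 'm" and b where P: "transpose P ** pencil_at A e ** P = mat 1"
        "transpose P ** pencil_at A a ** P = (\<chi> i j. if i = j then b i else 0)"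
      by (rule simultaneous_diagonalization)
    define Y where "Y = conjugated_pencil A P"
    have sym: "Y r c = Y c r" for r c
    proof -
      have "transpose (transpose P ** A i ** P) = transpose P ** A i ** P" for i
        using assms(1)[of i] by (simp only: symmetric_matrix_def matrix_transpose_mul matrix_mul_assoc transpose_transpose)
      then have "(transpose P ** A i ** P) $ r $ c = (transpose P ** A i ** P) $ c $ r" for i
        by (metis (no_types, lifting) transpose_def vec_lambda_beta)
      then show ?thesis by (simp add: Y_def conjugated_pencil_def)
    qed
    have De: "dderiv e (Y r c) = (if r = c then 1 else 0)" for r c
      by (simp add: Y_def dderiv_conjugated_pencil P mat_def)
    have Da: "dderiv a (Y r c) = (if r = c then mconst (b r) else 0)" for r c
      by (simp add: Y_def dderiv_conjugated_pencil P)
    have Ya: "meval (Y r c) a = (if r = c then b r else 0)" for r c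
      by (simp add: Y_def meval_conjugated_pencil P)
    have Ye: "meval (Y r c) e = (if r = c then 1 else 0)" for r c
      by (simp add: Y_def meval_conjugated_pencil P mat_def)
    have Yt: "meval (Y r c) (t *\<^sub>R e - a) = (if r = c then t - b r else 0)" for r c t
    proof -
      have "meval (Y r c) (t *\<^sub>R e - a) = t * meval (Y r c) e - meval (Y r c) a"
        by (simp add: Y_def conjugated_pencil_def meval_linear_form sum_subtractf sum_distrib_left algebra_simps)
      then show ?thesis by (simp add: Ya Ye)
    qed
    have "det (transpose P ** pencil_at A e ** P) = 1" by (simp add: P)
    then have detP: "det P \<noteq> 0" by (auto simp: det_mul)
    define \<gamma> where "\<gamma> = fact k / (det P)\<^sup>2"
    have \<gamma>: "\<gamma> > 0" using detP by (simp add: \<gamma>_def)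
    have h: "h = mconst \<gamma> * minor_sum UNIV (CARD('m) - k) Y"
    proof -
      have "det (pencil A) = mconst (1 / (det P)\<^sup>2) * minor UNIV Y"
        unfolding Y_def minor_conjugated_pencil using detP
        by (simp add: mult.assoc[symmetric] mconst_mult[symmetric])
      then have "h = mconst (1 / (det P)\<^sup>2) * (mconst (fact k) * minor_sum UNIV (CARD('m) - k) Y)"
        by (simp only: assms(4) dderiv_pow_mconst_mult dderiv_power_minor_sum[OF De assms(3)])
      then show ?thesis by (simp add: \<gamma>_def mult.assoc[symmetric] mconst_mult[symmetric])
    qed
    show ?thesis
    proof (cases "k = CARD('m)")
      \<comment> \<open>Here \<open>h\<close> is constant and there is no \<open>d\<close> with
        \<open>CARD('m) - k = d + 1\<close>. The first claim is vacuous and the Wronskian is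
        0.\<close>
      case True
      then have "h = mconst \<gamma>" using h by (simp add: minor_sum_0)
      then have "dderiv v h = 0" for v by simp
      then show ?thesis
        using meval_mconst[of 0 a] dderiv_mconst[of e 0] by (simp add: wronskian_def is_sos_0)
    next
      case False
      define d where "d = CARD('m) - k - 1"
      have d: "d < CARD('m)" and dk: "CARD('m) - k = d + 1"
        using False assms(3) by (auto simp: d_def)
      let ?N = "real (CARD('m) - d)" and ?e = "esym b UNIV"
      have N: "?N > 0" using d by simp
      note h' = h[unfolded dk]
      let ?W = "\<Sum>i\<in>UNIV. mconst (b i) * (minor_sum UNIV d Y * minor_sum (- {i}) d Y
        - minor_sum UNIV (d + 1) Y * (if d = 0 then 0 else minor_sum (- {i}) (d - 1) Y))"
      have W: "wronskian e a h = mconst (\<gamma>\<^sup>2 * ?N) * ?W"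
        by (rule wronskian_minor_sum[OF De Da d h'])
      have Deh: "dderiv e h = mconst (\<gamma> * ?N) * minor_sum UNIV d Y"
        unfolding h' dderiv_mconst_mult by (simp add: dderiv_minor_sum_unit[OF De] mconst_mult mult.assoc)
      \<comment> \<open>A zero at \<open>s > 0\<close> would make \<open>- s\<close> a negative zero
        of h(te - a), against membership in the cone.\<close>
      have nz: "esym (\<lambda>i. b i + s) UNIV (Suc d) \<noteq> 0" if s: "s > 0" for s
      proof
        assume zero: "esym (\<lambda>i. b i + s) UNIV (Suc d) = 0"
        have "meval h ((- s) *\<^sub>R e - a) = \<gamma> * esym (\<lambda>i. - s - b i) UNIV (Suc d)"
          unfolding h' meval_mult meval_mconst meval_minor_sum_diagonal[OF Yt] by simp
        also have "(\<lambda>i. - s - b i) = (\<lambda>i. - (b i + s))" by auto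
        also have "\<gamma> * esym (\<lambda>i. - (b i + s)) UNIV (Suc d) = 0" by (simp only: esym_uminus zero)
        finally have "0 \<le> - s" using cone unfolding hyperbolicity_cone_def by blast
        then show False using s by simp
      qed
      have pos: "esym (\<lambda>i. b i + s) UNIV (Suc d) > 0" if "s > 0" for s
        by (rule esym_shift_pos_of_nonzero[OF finite _ nz that]) (use d in simp_all)
      have pos': "esym (\<lambda>i. b i + s) UNIV d > 0" if "s > 0" for s
        by (rule esym_shift_pos_pred[OF finite d pos that])
      \<comment> \<open>This constant exchanges the factorial in
        \<open>is_sos_minor_sum_wronskian\<close> for the factor that the Wronskian carries in
        \<open>W\<close>.\<close>
      let ?c = "\<gamma>\<^sup>2 * ?N / fact (CARD('m) - d)"
      have c: "?c \<ge> 0" using N by simp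
      have scale: "is_sos (mconst ?c * (mconst (fact (CARD('m) - d)) * ?W - mconst \<kappa> * (minor_sum UNIV d Y)\<^sup>2))"
        if "\<And>m. \<kappa> * (level_sum d 0 m (UNIV :: 'm set))\<^sup>2 \<le> pair_form b d 0 UNIV m" for \<kappa>
        by (intro is_sos_scale c is_sos_minor_sum_wronskian sym d that)
      have cW: "mconst ?c * (mconst (fact (CARD('m) - d)) * ?W) = wronskian e a h"
        unfolding W mult.assoc[symmetric] mconst_mult[symmetric] by simp
      have "0 * (level_sum d 0 m (UNIV :: 'm set))\<^sup>2 \<le> pair_form b d 0 UNIV m" for m
        using overlap_form_nonneg[OF finite d pos, of m] by (simp add: pair_form_overlap[OF d])
      from scale[OF this] have second: "is_sos (wronskian e a h)"
        by (simp only: mconst_0 mult_zero_left diff_zero cW)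
      have "is_sos (wronskian e a h - mconst (meval h a / meval (dderiv e h) a) * (dderiv e h) ^ 2)"
        if nonzero: "meval (dderiv e h) a \<noteq> 0"
      proof -
        have ma: "meval h a = \<gamma> * ?e (d + 1)" "meval (dderiv e h) a = \<gamma> * ?N * ?e d"
          unfolding Deh unfolding h' by (simp_all add: meval_mult meval_minor_sum_diagonal[OF Ya])
        \<comment> \<open>As a limit of positive values \<open>?e d\<close> is nonnegative. Since
          D_e h(a) is a multiple of it, the assumption makes it positive, so that the shift 0 is
          admissible in \<open>overlap_form_bound\<close>.\<close>
        have "0 \<le> ?e d"
          using nonneg_at_0[OF continuous_on_esym_shift[of UNIV b UNIV d]] pos' by (simp add: less_imp_le)
        then have ed: "?e d > 0" using nonzero ma by (cases "?e d = 0") auto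
        then have "esym (\<lambda>i. b i + s) UNIV d > 0" if "s \<ge> 0" for s
          using pos'[of s] that by (cases "s = 0") auto
        from overlap_form_bound[OF finite this]
        have ov: "?e (d + 1) / ?e d * (level_sum d 0 m (UNIV :: 'm set))\<^sup>2 \<le> overlap_form b UNIV d m" for m
          by (simp add: level_sum_def)
        \<comment> \<open>By \<open>ma\<close> the quotient h(a)/D_e h(a) is
          \<open>?e (d + 1) / (?N * ?e d)\<close>. The square of D_e h carries the factor
          \<open>(\<gamma> * ?N)\<^sup>2\<close>, which together with this quotient equals
          \<open>?c * \<kappa>\<close>.\<close>
        define \<kappa> where "\<kappa> = fact (CARD('m) - d) * (?e (d + 1) / ?e d)"
        have "\<kappa> * (level_sum d 0 m (UNIV :: 'm set))\<^sup>2 \<le> pair_form b d 0 UNIV m" for m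
          unfolding pair_form_overlap[OF d] \<kappa>_def mult.assoc by (intro mult_left_mono ov) simp
        from scale[OF this]
        have "is_sos (wronskian e a h - mconst ?c * (mconst \<kappa> * (minor_sum UNIV d Y)\<^sup>2))"
          by (simp only: right_diff_distrib[of "mconst ?c" "mconst (fact (CARD('m) - d)) * ?W"] cW)
        moreover have "mconst ?c * (mconst \<kappa> * (minor_sum UNIV d Y)\<^sup>2)
            = mconst (meval h a / meval (dderiv e h) a) * (dderiv e h) ^ 2"
        proof -
          have "?c * \<kappa> = meval h a / meval (dderiv e h) a * (\<gamma> * ?N)\<^sup>2"
            unfolding ma \<kappa>_def using ed N \<gamma> by (simp add: field_simps power2_eq_square)
          moreover have "(mconst x)\<^sup>2 = (mconst (x\<^sup>2) :: 'n mpoly)" for x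
            by (simp only: power2_eq_square mconst_mult)
          then have "(dderiv e h)\<^sup>2 = mconst ((\<gamma> * ?N)\<^sup>2) * (minor_sum UNIV d Y)\<^sup>2"
            by (simp only: Deh power_mult_distrib[of "mconst _"])
          ultimately show ?thesis
            by (simp only: mult.assoc[symmetric] mconst_mult[symmetric])
        qed
        ultimately show ?thesis by simp
      qed
      then show ?thesis using second by blast
    qed
  qed
  then show ?thesis by blast
qed

end
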